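(* Assume the spectral gap, removable singularity, quadratic degeneracy, $a$-regularity, $b$-regularity and unitary transfer conditions stated in the context. Let $\{\lambda^{(k)}_{\varepsilon,\theta}\}_{k\in\mathbb N}$ and $\{\lambda^{(k)}_\xi\}_{k}$ be the eigenvalues of $\mathcal L_{\varepsilon,\theta}$ and $\mathbb L_\xi$ respectively, listed in ascending order with multiplicities. Then there is $C_{11}>0$, independent of $\varepsilon\in(0,1)$, $\theta$ and $k$, such that: if $\dim(V_\star\dot+Z)=\infty$, then $$\Big|\frac1{\lambda^{(k)}_{\varepsilon,\theta}}-\frac1{\lambda^{(k)}_{\theta/\varepsilon}}\Big|\le C_{11}\varepsilon\qquad\forall k\in\mathbb N,\ \forall\theta\in\Theta;$$ if $\dim(V_\star\dot+Z)=N<\infty$, then $$\Big|\frac1{\lambda^{(k)}_{\varepsilon,\theta}}-\frac1{\lambda^{(k)}_{\theta/\varepsilon}}\Big|\le C_{11}\varepsilon,\qquad \Big|\frac1{\lambda^{(p)}_{\varepsilon,\theta}}\Big|\le C_{11}\varepsilon\qquad \forall k\le N,\ \forall p\ge N+1,\ \forall\theta\in\Theta .$$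
   Context: $H$ is a separable complex Hilbert space, $n\ge 1$, $\Theta\subset\mathbb R^n$ is compact and connected with $0$ an interior point, and for each $\theta\in\Theta$, $a_\theta$ and $b_\theta$ are non-negative sesquilinear forms on $H\times H$. For a sesquilinear form $\mathfrak b$ write $\mathfrak b[u]:=\mathfrak b(u,u)$. Standing assumptions: for each $\theta$, $(u,\tilde u)_\theta:=a_\theta(u,\tilde u)+b_\theta(u,\tilde u)$ is an inner product on $H$ equivalent to the original one, with norm $\|\cdot\|_\theta$; there is $K>0$ with $\|u\|_{\theta_1}\le K\|u\|_{\theta_2}$ for all $u\in H$, $\theta_1,\theta_2\in\Theta$; there is $L_a>0$ with $|a_{\theta_1}(u,\tilde u)-a_{\theta_2}(u,\tilde u)|\le L_a|\theta_1-\theta_2|\,\|u\|_{\theta_1}\|\tilde u\|_{\theta_1}$ for all $u,\tilde u\in H$, $\theta_1,\theta_2\in\Theta$. $V_\theta:=\{v\in H: a_\theta[v]=0\}$ (a closed subspace), $W_\theta:=\{w\in H:(w,v)_\theta=0\ \forall v\in V_\theta\}$. Spectral gap condition: for every $\theta\in\Theta$ there is $\nu_\theta>0$ with $a_\theta[w]\ge\nu_\theta\|w\|_\theta^2$ for all $w\in W_\theta$. Removable singularity condition: there are a closed subspace $V_\star\subset H$ and $L_\star\ge0$ such that, with $V^\star_\theta:=V_\theta$ for $\theta\ne0$ and $V^\star_0:=V_\star$, one has $\inf_{v_2\in V^\star_{\theta_2}}\|v_1-v_2\|_{\theta_2}\le L_\star|\theta_1-\theta_2|\,\|v_1\|_{\theta_1}$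 for all $v_1\in V^\star_{\theta_1}$, $\theta_1,\theta_2\in\Theta$. (Then $V_\star\subset V_0$.) $Z$ is a fixed closed subspace of $V_0$ with $V_0=V_\star\dot+Z$ (direct sum) and, for some $0\le K_Z<1$, $|(v_\star,z)_0|\le K_Z\|v_\star\|_0\|z\|_0$ for all $v_\star\in V_\star$, $z\in Z$. Quadratic degeneracy: there is $\gamma>0$ with $a_\theta[w]\ge\gamma|\theta|^2\|w\|_\theta^2$ for all $w\in W_\theta$, $\theta\in\Theta$. $a$-regularity: there exist sesquilinear maps $a_0':V_0\times H\to\mathbb C^n$, $a_0'':V_0\times V_0\to\mathbb C^{n\times n}$ and constants $K_{a'},K_{a''}\ge0$ with $|a_\theta(v,u)-a_0'(v,u)\cdot\theta|\le K_{a'}|\theta|^2\|v\|_0\|u\|_0$ for all $v\in V_0,u\in H,\theta\in\Theta$, and $|a_\theta(v,\tilde v)-a_0''(v,\tilde v)\theta\cdot\theta|\le K_{a''}|\theta|^3\|v\|_0\|\tilde v\|_0$ for all $v,\tilde v\in V_0$, $\theta\in\Theta$. $b$-regularity: there is $L_b\ge0$ with $|b_\theta(v,\tilde v)-b_0(v,\tilde v)|\le L_b|\theta|\,\|v\|_0\|\tilde v\|_\theta$ for all $v,\tilde v\in V_0$, $\theta\in\Theta$. Homogenised form: for $\theta\in\mathbb R^n$, $N_\theta:V_0\to W_0$ is the linear map such that $N_\theta v$ is the unique solution in $W_0$ of $a_0(N_\theta v,\tilde w_0)=-a_0'(v,\tilde w_0)\cdot\theta$ for all $\tilde w_0\in W_0$;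 and $a^{\rm h}_\theta(v,\tilde v):=a_0''(v,\tilde v)\theta\cdot\theta-a_0(N_\theta v,N_\theta\tilde v)$ for $v,\tilde v\in V_0$, $\theta\in\mathbb R^n$. Ambient space: $\mathcal H$ is a complex separable (infinite-dimensional) Hilbert space with a family of equivalent inner products $d_\theta$, $\theta\in\Theta$, such that $d_{\theta_1}[u]\le K_d\,d_{\theta_2}[u]$ for some $K_d>0$ and all $u,\theta_1,\theta_2$; $H$ is a compactly embedded dense subset of $\mathcal H$; and $d_\theta[u]\le b_\theta[u]$ for all $u\in H$, $\theta\in\Theta$. $\mathcal L_{\varepsilon,\theta}$ is the self-adjoint operator in $(\mathcal H,d_\theta)$ generated by the closed form $\varepsilon^{-2}a_\theta+b_\theta$ with form domain $H$; it has compact resolvent. $\mathcal H_0$ is the closure of $V_\star\dot+Z$ in $\mathcal H$, equipped with $d_0$. For $\xi\in\mathbb R^n$, $\mathbb L_\xi$ is the self-adjoint operator in $\mathcal H_0$ generated by the form $\mathbb S_\xi(v+z,\tilde v+\tilde z):=a^{\rm h}_\xi(z,\tilde z)+b_0(v+z,\tilde v+\tilde z)$ with form domain $V_\star\dot+Z$; it has compact resolvent. Unitary transfer condition: there are linear bijections $\mathcal E_\theta:V_\star\to V_\theta^\star$, $\theta\in\Theta$, with $b_\theta(\mathcal E_\theta v,\mathcal E_\theta\tilde v)=b_0(v,\tilde v)$ for all $v,\tilde v\in V_\star$ and $|b_\theta(\mathcal E_\theta v,z)-b_0(v,z)|\le K_b|\theta|\|v\|_0\|z\|_0$ for all $v\in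 V_\star,z\in Z$ ($K_b\ge0$ independent of $\theta$), which extend to bijections of $\mathcal H$ (again denoted $\mathcal E_\theta$) satisfying $d_\theta(\mathcal E_\theta u,\mathcal E_\theta\tilde u)=d_0(u,\tilde u)$ for all $u,\tilde u\in\mathcal H$, $\mathcal E_0=I$, and $\|\mathcal E_{\theta_1}-\mathcal E_{\theta_2}\|_{(\mathcal H,d_0)\to(\mathcal H,d_{\theta_1})}\le K_e|\theta_1-\theta_2|$ for all $\theta_1,\theta_2\in\Theta$ and some $K_e\ge0$. *)

theory Defs
  imports "HOL-Analysis.Analysis"
begin

text \<open>
  The ambient space is a type \<open>'a\<close> with a complex scalar multiplication \<open>sc\<close> that makes it
  a \<^locale>\<open>vector_space\<close>; all other spaces are subsets of it, and an inner product (or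
  sesquilinear form) is a function on the whole type of which only the values on the relevant
  subspace matter. Forms are linear in the first and conjugate linear in the second argument.
\<close>

type_synonym 'a form = "'a \<Rightarrow> 'a \<Rightarrow> complex"

definition sesquilinear_on ::
  "(complex \<Rightarrow> 'a \<Rightarrow> 'a::ab_group_add) \<Rightarrow> 'a set \<Rightarrow> 'a set \<Rightarrow> 'a form \<Rightarrow> bool" where
  "sesquilinear_on sc S T g \<longleftrightarrow>
     (\<forall>u\<in>S. \<forall>u'\<in>S. \<forall>w\<in>T. g (u + u') w = g u w + g u' w) \<and>
     (\<forall>c. \<forall>u\<in>S. \<forall>w\<in>T. g (sc c u) w = c * g u w) \<and>
     (\<forall>u\<in>S. \<forall>w\<in>T. \<forall>w'\<in>T. g u (w + w') = g u w + g u w') \<and>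
     (\<forall>c. \<forall>u\<in>S. \<forall>w\<in>T. g u (sc c w) = cnj c * g u w)"

definition nonneg_form ::
  "(complex \<Rightarrow> 'a \<Rightarrow> 'a::ab_group_add) \<Rightarrow> 'a set \<Rightarrow> 'a form \<Rightarrow> bool" where
  "nonneg_form sc S g \<longleftrightarrow> sesquilinear_on sc S S g \<and> (\<forall>u\<in>S. g u u \<in> \<real>\<^sub>\<ge>\<^sub>0)"

text \<open>Hermitian symmetry follows from non-negativity by polarisation.\<close>

definition inner_product_on ::
  "(complex \<Rightarrow> 'a \<Rightarrow> 'a::ab_group_add) \<Rightarrow> 'a set \<Rightarrow> 'a form \<Rightarrow> bool" where
  "inner_product_on sc S g \<longleftrightarrow> nonneg_form sc S g \<and> (\<forall>u\<in>S. g u u = 0 \<longrightarrow> u = 0)"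

text \<open>The quadratic form is real on the forms considered, so taking \<^const>\<open>Re\<close> loses nothing.\<close>

definition quad :: "'a form \<Rightarrow> 'a \<Rightarrow> real" where
  "quad g u = Re (g u u)"

definition form_norm :: "'a form \<Rightarrow> 'a \<Rightarrow> real" where
  "form_norm g u = sqrt (quad g u)"

definition equivalent_on :: "'a set \<Rightarrow> 'a form \<Rightarrow> 'a form \<Rightarrow> bool" where
  "equivalent_on S g h \<longleftrightarrow>
     (\<exists>c>0. \<exists>C>0. \<forall>u\<in>S. c * form_norm h u \<le> form_norm g u \<and> form_norm g u \<le> C * form_norm h u)"

text \<open>\<^locale>\<open>Metric_space\<close> demands a distance that is symmetric and non-negative on the
  whole type, hence the value 0 outside \<open>S\<close>.\<close>

definition form_dist :: "'a::ab_group_add set \<Rightarrow> 'a form \<Rightarrow> 'a \<Rightarrow> 'a \<Rightarrow> real" where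
  "form_dist S g x y = (if x \<in> S \<and> y \<in> S then form_norm g (x - y) else 0)"

definition form_topology :: "'a::ab_group_add set \<Rightarrow> 'a form \<Rightarrow> 'a topology" where
  "form_topology S g = Metric_space.mtopology S (form_dist S g)"

definition separable_hilbert_space ::
  "(complex \<Rightarrow> 'a \<Rightarrow> 'a::ab_group_add) \<Rightarrow> 'a set \<Rightarrow> 'a form \<Rightarrow> bool" where
  "separable_hilbert_space sc S g \<longleftrightarrow>
     module.subspace sc S \<and> inner_product_on sc S g \<and>
     Metric_space.mcomplete S (form_dist S g) \<and> separable_space (form_topology S g)"

definition closed_subspace ::
  "(complex \<Rightarrow> 'a \<Rightarrow> 'a::ab_group_add) \<Rightarrow> 'a set \<Rightarrow> 'a form \<Rightarrow> 'a set \<Rightarrow> bool" where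
  "closed_subspace sc S g M \<longleftrightarrow> module.subspace sc M \<and> closedin (form_topology S g) M"

definition finite_dim :: "(complex \<Rightarrow> 'a \<Rightarrow> 'a::ab_group_add) \<Rightarrow> 'a set \<Rightarrow> bool" where
  "finite_dim sc S \<longleftrightarrow> (\<exists>B. finite B \<and> S \<subseteq> module.span sc B)"

definition linear_map_on ::
  "(complex \<Rightarrow> 'a \<Rightarrow> 'a::ab_group_add) \<Rightarrow> 'a set \<Rightarrow> ('a \<Rightarrow> 'a) \<Rightarrow> bool" where
  "linear_map_on sc S f \<longleftrightarrow>
     (\<forall>u\<in>S. \<forall>v\<in>S. f (u + v) = f u + f v) \<and> (\<forall>c. \<forall>u\<in>S. f (sc c u) = sc c (f u))"

text \<open>Triviality of the intersection is required separately.\<close>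

definition direct_sum :: "'a::ab_group_add set \<Rightarrow> 'a set \<Rightarrow> 'a set" where
  "direct_sum S T = {s + t | s t. s \<in> S \<and> t \<in> T}"


section \<open>Operators generated by forms and their eigenvalues\<close>

text \<open>The operator in the Hilbert space \<open>(X, g)\<close> generated by the form \<open>t\<close> with form domain
  \<open>D\<close>, represented by its graph. It is single-valued because \<open>D\<close> is dense in \<open>X\<close>.\<close>

definition form_operator :: "'a set \<Rightarrow> 'a form \<Rightarrow> 'a set \<Rightarrow> 'a form \<Rightarrow> ('a \<times> 'a) set" where
  "form_operator X g D t = {(u, f). u \<in> D \<and> f \<in> X \<and> (\<forall>v\<in>D. t u v = g f v)}"

definition eigenspace ::
  "(complex \<Rightarrow> 'a \<Rightarrow> 'a) \<Rightarrow> ('a \<times> 'a) set \<Rightarrow> complex \<Rightarrow> 'a set" where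
  "eigenspace sc A \<mu> = {u. (u, sc \<mu> u) \<in> A}"

text \<open>\<open>lam\<close>, indexed by \<open>I\<close>, lists all eigenvalues of \<open>A\<close> in ascending order, each repeated
  according to its (finite) multiplicity. The finiteness clauses are needed because
  \<^const>\<open>card\<close> and the dimension function return 0 in the infinite case.\<close>

definition lists_eigenvalues ::
  "(complex \<Rightarrow> 'a \<Rightarrow> 'a::ab_group_add) \<Rightarrow> ('a \<times> 'a) set \<Rightarrow> nat set \<Rightarrow> (nat \<Rightarrow> real) \<Rightarrow> bool" where
  "lists_eigenvalues sc A I lam \<longleftrightarrow>
     mono_on I lam \<and>
     (\<forall>\<mu>. finite_dim sc (eigenspace sc A \<mu>) \<and>
          finite {k \<in> I. complex_of_real (lam k) = \<mu>} \<and>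
          card {k \<in> I. complex_of_real (lam k) = \<mu>} = vector_space.dim sc (eigenspace sc A \<mu>))"

definition eigenvalue_indices ::
  "(complex \<Rightarrow> 'a \<Rightarrow> 'a::ab_group_add) \<Rightarrow> 'a set \<Rightarrow> nat set" where
  "eigenvalue_indices sc S = (if finite_dim sc S then {1..vector_space.dim sc S} else {1..})"


section \<open>Families of forms and the conditions on them\<close>

definition ab :: "('p \<Rightarrow> 'a form) \<Rightarrow> ('p \<Rightarrow> 'a form) \<Rightarrow> 'p \<Rightarrow> 'a form" where
  "ab a b \<theta> u v = a \<theta> u v + b \<theta> u v"

definition Vsp :: "'a set \<Rightarrow> ('p \<Rightarrow> 'a form) \<Rightarrow> 'p \<Rightarrow> 'a set" where
  "Vsp H a \<theta> = {v \<in> H. a \<theta> v v = 0}"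

definition Wsp :: "'a set \<Rightarrow> ('p \<Rightarrow> 'a form) \<Rightarrow> ('p \<Rightarrow> 'a form) \<Rightarrow> 'p \<Rightarrow> 'a set" where
  "Wsp H a b \<theta> = {w \<in> H. \<forall>v\<in>Vsp H a \<theta>. ab a b \<theta> w v = 0}"

definition Vstar :: "'a set \<Rightarrow> ('p::zero \<Rightarrow> 'a form) \<Rightarrow> 'a set \<Rightarrow> 'p \<Rightarrow> 'a set" where
  "Vstar H a Vs \<theta> = (if \<theta> = 0 then Vs else Vsp H a \<theta>)"

definition standing_assumptions ::
  "(complex \<Rightarrow> 'a \<Rightarrow> 'a::ab_group_add) \<Rightarrow> 'a set \<Rightarrow> 'a form \<Rightarrow> (real^'n) set \<Rightarrow>
   (real^'n \<Rightarrow> 'a form) \<Rightarrow> (real^'n \<Rightarrow> 'a form) \<Rightarrow> bool" where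
  "standing_assumptions sc H ipH \<Theta> a b \<longleftrightarrow>
     separable_hilbert_space sc H ipH \<and>
     compact \<Theta> \<and> connected \<Theta> \<and> 0 \<in> interior \<Theta> \<and>
     (\<forall>\<theta>\<in>\<Theta>. nonneg_form sc H (a \<theta>) \<and> nonneg_form sc H (b \<theta>) \<and>
        inner_product_on sc H (ab a b \<theta>) \<and> equivalent_on H (ab a b \<theta>) ipH) \<and>
     (\<exists>K>0. \<forall>u\<in>H. \<forall>\<theta>1\<in>\<Theta>. \<forall>\<theta>2\<in>\<Theta>.
        form_norm (ab a b \<theta>1) u \<le> K * form_norm (ab a b \<theta>2) u) \<and>
     (\<exists>La>0. \<forall>u\<in>H. \<forall>v\<in>H. \<forall>\<theta>1\<in>\<Theta>. \<forall>\<theta>2\<in>\<Theta>.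
        cmod (a \<theta>1 u v - a \<theta>2 u v)
          \<le> La * norm (\<theta>1 - \<theta>2) * form_norm (ab a b \<theta>1) u * form_norm (ab a b \<theta>1) v)"

definition spectral_gap ::
  "'a set \<Rightarrow> (real^'n) set \<Rightarrow> (real^'n \<Rightarrow> 'a form) \<Rightarrow> (real^'n \<Rightarrow> 'a form) \<Rightarrow> bool" where
  "spectral_gap H \<Theta> a b \<longleftrightarrow>
     (\<forall>\<theta>\<in>\<Theta>. \<exists>\<nu>>0. \<forall>w\<in>Wsp H a b \<theta>. quad (a \<theta>) w \<ge> \<nu> * (form_norm (ab a b \<theta>) w)\<^sup>2)"

definition removable_singularity ::
  "(complex \<Rightarrow> 'a \<Rightarrow> 'a::ab_group_add) \<Rightarrow> 'a set \<Rightarrow> 'a form \<Rightarrow> (real^'n) set \<Rightarrow>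
   (real^'n \<Rightarrow> 'a form) \<Rightarrow> (real^'n \<Rightarrow> 'a form) \<Rightarrow> 'a set \<Rightarrow> bool" where
  "removable_singularity sc H ipH \<Theta> a b Vs \<longleftrightarrow>
     closed_subspace sc H ipH Vs \<and>
     (\<exists>Lstar\<ge>0. \<forall>\<theta>1\<in>\<Theta>. \<forall>\<theta>2\<in>\<Theta>. \<forall>v1\<in>Vstar H a Vs \<theta>1.
        (INF v2\<in>Vstar H a Vs \<theta>2. form_norm (ab a b \<theta>2) (v1 - v2))
          \<le> Lstar * norm (\<theta>1 - \<theta>2) * form_norm (ab a b \<theta>1) v1)"

definition admissible_complement ::
  "(complex \<Rightarrow> 'a \<Rightarrow> 'a::ab_group_add) \<Rightarrow> 'a set \<Rightarrow> 'a form \<Rightarrow>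
   (real^'n \<Rightarrow> 'a form) \<Rightarrow> (real^'n \<Rightarrow> 'a form) \<Rightarrow> 'a set \<Rightarrow> 'a set \<Rightarrow> bool" where
  "admissible_complement sc H ipH a b Vs Z \<longleftrightarrow>
     closed_subspace sc H ipH Z \<and> Vsp H a 0 = direct_sum Vs Z \<and> Vs \<inter> Z = {0} \<and>
     (\<exists>KZ\<ge>0. KZ < 1 \<and> (\<forall>v\<in>Vs. \<forall>z\<in>Z.
        cmod (ab a b 0 v z) \<le> KZ * form_norm (ab a b 0) v * form_norm (ab a b 0) z))"

definition quadratic_degeneracy ::
  "'a set \<Rightarrow> (real^'n) set \<Rightarrow> (real^'n \<Rightarrow> 'a form) \<Rightarrow> (real^'n \<Rightarrow> 'a form) \<Rightarrow> bool" where
  "quadratic_degeneracy H \<Theta> a b \<longleftrightarrow>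
     (\<exists>\<gamma>>0. \<forall>\<theta>\<in>\<Theta>. \<forall>w\<in>Wsp H a b \<theta>.
        quad (a \<theta>) w \<ge> \<gamma> * (norm \<theta>)\<^sup>2 * (form_norm (ab a b \<theta>) w)\<^sup>2)"

definition cdot :: "complex^'n \<Rightarrow> real^'n \<Rightarrow> complex" where
  "cdot x \<theta> = (\<Sum>i\<in>UNIV. x $ i * complex_of_real (\<theta> $ i))"

definition cquad :: "complex^'n^'n \<Rightarrow> real^'n \<Rightarrow> complex" where
  "cquad A \<theta> = cdot (A *v (\<chi> i. complex_of_real (\<theta> $ i))) \<theta>"

definition a_regularity ::
  "(complex \<Rightarrow> 'a \<Rightarrow> 'a::ab_group_add) \<Rightarrow> 'a set \<Rightarrow> (real^'n) set \<Rightarrow>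
   (real^'n \<Rightarrow> 'a form) \<Rightarrow> (real^'n \<Rightarrow> 'a form) \<Rightarrow>
   ('a \<Rightarrow> 'a \<Rightarrow> complex^'n) \<Rightarrow> ('a \<Rightarrow> 'a \<Rightarrow> complex^'n^'n) \<Rightarrow> bool" where
  "a_regularity sc H \<Theta> a b a' a'' \<longleftrightarrow>
     (\<forall>i. sesquilinear_on sc (Vsp H a 0) H (\<lambda>v u. a' v u $ i)) \<and>
     (\<forall>i j. sesquilinear_on sc (Vsp H a 0) (Vsp H a 0) (\<lambda>v u. a'' v u $ i $ j)) \<and>
     (\<exists>K'\<ge>0. \<forall>v\<in>Vsp H a 0. \<forall>u\<in>H. \<forall>\<theta>\<in>\<Theta>.
        cmod (a \<theta> v u - cdot (a' v u) \<theta>)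
          \<le> K' * (norm \<theta>)\<^sup>2 * form_norm (ab a b 0) v * form_norm (ab a b 0) u) \<and>
     (\<exists>K''\<ge>0. \<forall>v\<in>Vsp H a 0. \<forall>u\<in>Vsp H a 0. \<forall>\<theta>\<in>\<Theta>.
        cmod (a \<theta> v u - cquad (a'' v u) \<theta>)
          \<le> K'' * norm \<theta> ^ 3 * form_norm (ab a b 0) v * form_norm (ab a b 0) u)"

definition b_regularity ::
  "'a set \<Rightarrow> (real^'n) set \<Rightarrow> (real^'n \<Rightarrow> 'a form) \<Rightarrow> (real^'n \<Rightarrow> 'a form) \<Rightarrow> bool" where
  "b_regularity H \<Theta> a b \<longleftrightarrow>
     (\<exists>Lb\<ge>0. \<forall>v\<in>Vsp H a 0. \<forall>u\<in>Vsp H a 0. \<forall>\<theta>\<in>\<Theta>.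
        cmod (b \<theta> v u - b 0 v u)
          \<le> Lb * norm \<theta> * form_norm (ab a b 0) v * form_norm (ab a b \<theta>) u)"


section \<open>Homogenised objects\<close>

definition corrector ::
  "'a set \<Rightarrow> (real^'n \<Rightarrow> 'a form) \<Rightarrow> (real^'n \<Rightarrow> 'a form) \<Rightarrow>
   ('a \<Rightarrow> 'a \<Rightarrow> complex^'n) \<Rightarrow> real^'n \<Rightarrow> 'a \<Rightarrow> 'a" where
  "corrector H a b a' \<theta> v =
     (THE w. w \<in> Wsp H a b 0 \<and> (\<forall>w0\<in>Wsp H a b 0. a 0 w w0 = - cdot (a' v w0) \<theta>))"

definition hom_form ::
  "'a set \<Rightarrow> (real^'n \<Rightarrow> 'a form) \<Rightarrow> (real^'n \<Rightarrow> 'a form) \<Rightarrow>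
   ('a \<Rightarrow> 'a \<Rightarrow> complex^'n) \<Rightarrow> ('a \<Rightarrow> 'a \<Rightarrow> complex^'n^'n) \<Rightarrow> real^'n \<Rightarrow> 'a form" where
  "hom_form H a b a' a'' \<theta> v u =
     cquad (a'' v u) \<theta> - a 0 (corrector H a b a' \<theta> v) (corrector H a b a' \<theta> u)"

definition Z_component :: "'a::ab_group_add set \<Rightarrow> 'a set \<Rightarrow> 'a \<Rightarrow> 'a" where
  "Z_component Vs Z x = (THE z. z \<in> Z \<and> x - z \<in> Vs)"

definition S_form ::
  "'a set \<Rightarrow> (real^'n \<Rightarrow> 'a::ab_group_add form) \<Rightarrow> (real^'n \<Rightarrow> 'a form) \<Rightarrow>
   ('a \<Rightarrow> 'a \<Rightarrow> complex^'n) \<Rightarrow> ('a \<Rightarrow> 'a \<Rightarrow> complex^'n^'n) \<Rightarrow> 'a set \<Rightarrow> 'a set \<Rightarrow>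
   real^'n \<Rightarrow> 'a form" where
  "S_form H a b a' a'' Vs Z \<xi> x y =
     hom_form H a b a' a'' \<xi> (Z_component Vs Z x) (Z_component Vs Z y) + b 0 x y"


section \<open>The ambient space and unitary transfer\<close>

definition ambient_space ::
  "(complex \<Rightarrow> 'a \<Rightarrow> 'a::ab_group_add) \<Rightarrow> 'a form \<Rightarrow> 'a set \<Rightarrow> 'a form \<Rightarrow> (real^'n) set \<Rightarrow>
   (real^'n \<Rightarrow> 'a form) \<Rightarrow> (real^'n \<Rightarrow> 'a form) \<Rightarrow> bool" where
  "ambient_space sc ip H ipH \<Theta> b d \<longleftrightarrow>
     separable_hilbert_space sc UNIV ip \<and> \<not> finite_dim sc UNIV \<and>
     (\<forall>\<theta>\<in>\<Theta>. inner_product_on sc UNIV (d \<theta>) \<and> equivalent_on UNIV (d \<theta>) ip) \<and>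
     (\<exists>Kd>0. \<forall>u. \<forall>\<theta>1\<in>\<Theta>. \<forall>\<theta>2\<in>\<Theta>. quad (d \<theta>1) u \<le> Kd * quad (d \<theta>2) u) \<and>
     form_topology UNIV ip closure_of H = UNIV \<and>
     compactin (form_topology UNIV ip)
       (form_topology UNIV ip closure_of {u \<in> H. form_norm ipH u \<le> 1}) \<and>
     (\<forall>u\<in>H. \<forall>\<theta>\<in>\<Theta>. quad (d \<theta>) u \<le> quad (b \<theta>) u)"

definition L_operator ::
  "(complex \<Rightarrow> 'a \<Rightarrow> 'a) \<Rightarrow> 'a set \<Rightarrow> (real^'n \<Rightarrow> 'a form) \<Rightarrow> (real^'n \<Rightarrow> 'a form) \<Rightarrow>
   (real^'n \<Rightarrow> 'a form) \<Rightarrow> real \<Rightarrow> real^'n \<Rightarrow> ('a \<times> 'a) set" where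
  "L_operator sc H a b d \<epsilon> \<theta> =
     form_operator UNIV (d \<theta>) H (\<lambda>u v. complex_of_real (1 / \<epsilon>\<^sup>2) * a \<theta> u v + b \<theta> u v)"

definition hom_operator ::
  "'a form \<Rightarrow> 'a::ab_group_add set \<Rightarrow> (real^'n \<Rightarrow> 'a form) \<Rightarrow> (real^'n \<Rightarrow> 'a form) \<Rightarrow>
   (real^'n \<Rightarrow> 'a form) \<Rightarrow> ('a \<Rightarrow> 'a \<Rightarrow> complex^'n) \<Rightarrow> ('a \<Rightarrow> 'a \<Rightarrow> complex^'n^'n) \<Rightarrow>
   'a set \<Rightarrow> 'a set \<Rightarrow> real^'n \<Rightarrow> ('a \<times> 'a) set" where
  "hom_operator ip H a b d a' a'' Vs Z \<xi> =
     form_operator (form_topology UNIV ip closure_of direct_sum Vs Z) (d 0) (direct_sum Vs Z)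
       (S_form H a b a' a'' Vs Z \<xi>)"

text \<open>\<open>E \<theta>\<close> denotes the map already extended to the ambient space; the extension is
  automatically linear since it preserves inner products. The last clause is the operator norm
  bound for \<open>E \<theta>1 - E \<theta>2\<close>.\<close>

definition unitary_transfer ::
  "(complex \<Rightarrow> 'a \<Rightarrow> 'a::ab_group_add) \<Rightarrow> 'a set \<Rightarrow> (real^'n) set \<Rightarrow>
   (real^'n \<Rightarrow> 'a form) \<Rightarrow> (real^'n \<Rightarrow> 'a form) \<Rightarrow> (real^'n \<Rightarrow> 'a form) \<Rightarrow>
   'a set \<Rightarrow> 'a set \<Rightarrow> (real^'n \<Rightarrow> 'a \<Rightarrow> 'a) \<Rightarrow> bool" where
  "unitary_transfer sc H \<Theta> a b d Vs Z E \<longleftrightarrow>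
     (\<forall>\<theta>\<in>\<Theta>. linear_map_on sc Vs (E \<theta>) \<and> bij_betw (E \<theta>) Vs (Vstar H a Vs \<theta>) \<and>
        (\<forall>v\<in>Vs. \<forall>v'\<in>Vs. b \<theta> (E \<theta> v) (E \<theta> v') = b 0 v v')) \<and>
     (\<exists>Kb\<ge>0. \<forall>\<theta>\<in>\<Theta>. \<forall>v\<in>Vs. \<forall>z\<in>Z.
        cmod (b \<theta> (E \<theta> v) z - b 0 v z)
          \<le> Kb * norm \<theta> * form_norm (ab a b 0) v * form_norm (ab a b 0) z) \<and>
     (\<forall>\<theta>\<in>\<Theta>. bij (E \<theta>) \<and> (\<forall>u u'. d \<theta> (E \<theta> u) (E \<theta> u') = d 0 u u')) \<and>
     E 0 = id \<and>
     (\<exists>Ke\<ge>0. \<forall>\<theta>1\<in>\<Theta>. \<forall>\<theta>2\<in>\<Theta>. \<forall>u.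
        form_norm (d \<theta>1) (E \<theta>1 u - E \<theta>2 u) \<le> Ke * norm (\<theta>1 - \<theta>2) * form_norm (d 0) u)"

end

theory Submission
  imports Defs
begin

text \<open>
  Both families of reciprocal eigenvalues are eigenvalues of compact solution operators, so by the
  min-max principle it suffices to compare the quadratic forms of these operators, transported by
  the unitary \<open>E \<theta>\<close>, up to an error of order \<open>\<epsilon>\<close>. The quadratic form at \<open>f\<close> is the maximum of
  \<open>2 Re d(f, w) - t[w]\<close> over \<open>w\<close>, so each inequality needs only one good trial vector. For the
  \<open>\<epsilon>\<close>-problem it is \<open>E \<theta> v + z + N \<theta> z\<close>, built from the homogenised solution \<open>v + z\<close>; for the
  homogenised problem it is read off from the splitting of \<open>u\<close> into \<open>V \<theta>\<close>, \<open>Vs\<close>, \<open>Z\<close> and \<open>W 0\<close>.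
  With \<open>\<xi> = \<theta> / \<epsilon>\<close>, all errors carry a factor \<open>|\<theta>| |z|\<close>, and quadratic degeneracy gives
  \<open>(1 + |\<xi>|\<^sup>2) |z| = O(1)\<close>, whence \<open>|\<theta>| |z| = \<epsilon> |\<xi>| |z| = O(\<epsilon>)\<close> uniformly in \<open>\<theta>\<close>.
  Weak compactness is never needed: maximising sequences converge by the parallelogram law.
\<close>

section \<open>Non-negative forms\<close>

text \<open>The obstacle is that the null space of \<open>a \<theta>\<close> jumps at the origin:
  its limit is Vs, which is smaller than V_0 unless Z is trivial, so the gap on its complement
  closes as \<theta> tends to 0. Two estimates share the work: the gap at the origin controls W 0,
  and quadratic degeneracy controls the Z directions. The Vs component costs nothing:
  \<open>E \<theta>\<close> sends Vs into the null space of \<open>a \<theta>\<close> and preserves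
  b and d exactly, so every error comes from z. The parameter \<xi> leaves \<Theta>, where alone the
  hypotheses speak. Homogeneity bridges this: facts about a', a'' and the homogenised form are
  proved at s \<theta> for small s, then rescaled or obtained in the limit s to 0. For the
  \<epsilon>-problem a residual of norm O(\<epsilon>) does not suffice, since its energy is divided
  by the square of \<epsilon>; the missing power is won by testing the equation with the residual
  itself. Eigenvalues are known only through multiplicities, so the min-max comparison is carried
  out as a dimension count between eigenbases.\<close>

locale sesq_form = vector_space sc
  for sc :: "complex \<Rightarrow> 'a::ab_group_add \<Rightarrow> 'a" +
  fixes S :: "'a set" and g :: "'a form"
  assumes subspace_carrier: "subspace S" and nonneg_form: "nonneg_form sc S g"
begin

lemma carrier_closed [simp]:
  "0 \<in> S" "u \<in> S \<Longrightarrow> v \<in> S \<Longrightarrow> u + v \<in> S" "u \<in> S \<Longrightarrow> v \<in> S \<Longrightarrow> u - v \<in> S"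
  "u \<in> S \<Longrightarrow> sc c u \<in> S" "u \<in> S \<Longrightarrow> - u \<in> S"
  using subspace_carrier
  by (auto intro: subspace_0 subspace_add subspace_diff subspace_scale subspace_neg)

lemma add_left: "u \<in> S \<Longrightarrow> v \<in> S \<Longrightarrow> w \<in> S \<Longrightarrow> g (u + v) w = g u w + g v w"
  and add_right: "u \<in> S \<Longrightarrow> v \<in> S \<Longrightarrow> w \<in> S \<Longrightarrow> g w (u + v) = g w u + g w v"
  and scale_left: "u \<in> S \<Longrightarrow> w \<in> S \<Longrightarrow> g (sc c u) w = c * g u w"
  and scale_right: "u \<in> S \<Longrightarrow> w \<in> S \<Longrightarrow> g w (sc c u) = cnj c * g w u"
  using nonneg_form by (auto simp: nonneg_form_def sesquilinear_on_def)

lemma zero_left [simp]: "w \<in> S \<Longrightarrow> g 0 w = 0"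
  and zero_right [simp]: "w \<in> S \<Longrightarrow> g w 0 = 0"
  using add_left[of 0 0 w] add_right[of 0 0 w] by auto

lemma minus_left: "u \<in> S \<Longrightarrow> w \<in> S \<Longrightarrow> g (- u) w = - g u w"
  using add_left[of u "- u" w] by (simp add: add_eq_0_iff)

lemma minus_right: "u \<in> S \<Longrightarrow> w \<in> S \<Longrightarrow> g w (- u) = - g w u"
  using add_right[of u "- u" w] by (simp add: add_eq_0_iff)

lemma diff_left: "u \<in> S \<Longrightarrow> v \<in> S \<Longrightarrow> w \<in> S \<Longrightarrow> g (u - v) w = g u w - g v w"
  using add_left[of u "- v" w] minus_left[of v w] by simp

lemma diff_right: "u \<in> S \<Longrightarrow> v \<in> S \<Longrightarrow> w \<in> S \<Longrightarrow> g w (u - v) = g w u - g w v"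
  using add_right[of u "- v" w] minus_right[of v w] by simp

lemma quad_nonneg [simp]: "u \<in> S \<Longrightarrow> 0 \<le> quad g u"
  and diag: "u \<in> S \<Longrightarrow> g u u = complex_of_real (quad g u)"
  using nonneg_form
  by (auto simp: nonneg_form_def quad_def complex_nonneg_Reals_iff complex_eq_iff)

lemma form_norm_nonneg [simp]: "u \<in> S \<Longrightarrow> 0 \<le> form_norm g u"
  by (simp add: form_norm_def)

lemma form_norm_sq: "u \<in> S \<Longrightarrow> (form_norm g u)\<^sup>2 = quad g u"
  by (simp add: form_norm_def)

lemma hermitian:
  assumes "u \<in> S" "v \<in> S"
  shows "g v u = cnj (g u v)"
proof -
  have im: "Im (g x y + g y x) = 0" if "x \<in> S" "y \<in> S" for x y
  proof -
    have "Im (g (x + y) (x + y)) = 0" "Im (g x x) = 0" "Im (g y y) = 0"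
      using that by (simp_all add: diag)
    then show ?thesis
      using that by (simp add: add_left add_right)
  qed
  have "Im (g u v + g v u) = 0"
    using assms by (rule im)
  \<comment> \<open>The pair (u, i v) turns the statement on imaginary parts into equality of the
    real parts of g u v and g v u.\<close>
  moreover have "Im (g u (sc \<i> v) + g (sc \<i> v) u) = 0"
    using assms by (intro im) simp_all
  ultimately show ?thesis
    using assms by (simp add: scale_left scale_right complex_eq_iff)
qed

lemma quad_add:
  "u \<in> S \<Longrightarrow> v \<in> S \<Longrightarrow> quad g (u + v) = quad g u + quad g v + 2 * Re (g u v)"
  using hermitian[of u v] by (simp add: quad_def add_left add_right)

lemma quad_minus: "u \<in> S \<Longrightarrow> quad g (- u) = quad g u"
  by (simp add: quad_def minus_left minus_right)

lemma quad_diff: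
  "u \<in> S \<Longrightarrow> v \<in> S \<Longrightarrow> quad g (u - v) = quad g u + quad g v - 2 * Re (g u v)"
  using quad_add[of u "- v"] by (simp add: quad_minus minus_right)

lemma quad_scale: "u \<in> S \<Longrightarrow> quad g (sc c u) = (cmod c)\<^sup>2 * quad g u"
proof -
  assume u: "u \<in> S"
  have "g (sc c u) (sc c u) = c * cnj c * complex_of_real (quad g u)"
    using u diag[of u] by (simp add: scale_left scale_right)
  then have "g (sc c u) (sc c u) = complex_of_real ((cmod c)\<^sup>2 * quad g u)"
    by (simp only: complex_norm_square[symmetric] of_real_mult of_real_power)
  then show ?thesis
    by (simp add: quad_def)
qed

lemma quad_zero [simp]: "quad g 0 = 0"
  by (simp add: quad_def)

lemma form_norm_zero [simp]: "form_norm g 0 = 0"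
  by (simp add: form_norm_def)

lemma form_norm_scale: "u \<in> S \<Longrightarrow> form_norm g (sc c u) = cmod c * form_norm g u"
  by (simp add: form_norm_def quad_scale real_sqrt_mult)

lemma form_norm_minus: "u \<in> S \<Longrightarrow> form_norm g (- u) = form_norm g u"
  by (simp add: form_norm_def quad_minus)

lemma form_norm_minus_commute:
  "u \<in> S \<Longrightarrow> v \<in> S \<Longrightarrow> form_norm g (u - v) = form_norm g (v - u)"
  using form_norm_minus[of "u - v"] by simp

text \<open>Non-negativity at u - s \<alpha> v for all real s, where the factor \<alpha> = g u v
  makes the cross term real. The form may be degenerate; if \<open>quad g v = 0\<close>, the
  expression is affine in s and is treated separately.\<close>

lemma cauchy_schwarz_sq:
  assumes "u \<in> S" "v \<in> S"
  shows "(cmod (g u v))\<^sup>2 \<le> quad g u * quad g v"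
proof -
  define \<alpha> where "\<alpha> = g u v"
  have le: "0 \<le> quad g u - 2 * s * (cmod \<alpha>)\<^sup>2 + s\<^sup>2 * (cmod \<alpha>)\<^sup>2 * quad g v" for s :: real
  proof -
    let ?c = "complex_of_real s * \<alpha>"
    have "0 \<le> quad g (u - sc ?c v)"
      using assms by simp
    also have "\<dots> = quad g u + (cmod ?c)\<^sup>2 * quad g v - 2 * Re (cnj ?c * \<alpha>)"
      using assms by (simp add: quad_diff quad_scale scale_right \<alpha>_def)
    also have "Re (cnj ?c * \<alpha>) = s * (cmod \<alpha>)\<^sup>2"
      by (simp only: cmod_power2) (simp add: power2_eq_square algebra_simps)
    finally show ?thesis
      by (simp add: norm_mult power_mult_distrib)
  qed
  show ?thesis
  proof (cases "quad g v = 0")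
    case True
    have "cmod \<alpha> = 0"
    proof (rule ccontr)
      assume "cmod \<alpha> \<noteq> 0"
      then show False
        \<comment> \<open>This value of s makes the affine expression equal to -1.\<close>
        using le[of "(quad g u + 1) / (2 * (cmod \<alpha>)\<^sup>2)"] True quad_nonneg[OF assms(1)]
        by (simp add: field_simps)
    qed
    then show ?thesis
      using True by (simp add: \<alpha>_def)
  next
    case False
    then have "quad g v > 0"
      using assms quad_nonneg[of v] by linarith
    then show ?thesis
      using le[of "1 / quad g v"] by (simp add: \<alpha>_def field_simps power2_eq_square)
  qed
qed

lemma cauchy_schwarz:
  assumes "u \<in> S" "v \<in> S"
  shows "cmod (g u v) \<le> form_norm g u * form_norm g v"
  using cauchy_schwarz_sq[OF assms]
  by (simp add: form_norm_def real_le_rsqrt flip: real_sqrt_mult)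

lemma null_left: "u \<in> S \<Longrightarrow> v \<in> S \<Longrightarrow> quad g u = 0 \<Longrightarrow> g u v = 0"
  and null_right: "u \<in> S \<Longrightarrow> v \<in> S \<Longrightarrow> quad g u = 0 \<Longrightarrow> g v u = 0"
  using cauchy_schwarz_sq[of u v] cauchy_schwarz_sq[of v u] by auto

lemma form_norm_triangle:
  assumes "u \<in> S" "v \<in> S"
  shows "form_norm g (u + v) \<le> form_norm g u + form_norm g v"
proof -
  have "Re (g u v) \<le> form_norm g u * form_norm g v"
    using cauchy_schwarz[OF assms] complex_Re_le_cmod order_trans by blast
  then have "quad g (u + v) \<le> (form_norm g u + form_norm g v)\<^sup>2"
    using assms by (simp add: quad_add power2_sum form_norm_sq)
  then show ?thesis
    using assms by (simp add: form_norm_def[of g "u + v"] real_le_lsqrt)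
qed

lemma form_norm_triangle_diff:
  assumes "u \<in> S" "v \<in> S"
  shows "form_norm g (u - v) \<le> form_norm g u + form_norm g v"
  using form_norm_triangle[of u "- v"] assms by (simp add: form_norm_minus)

lemma form_norm_triangle_sub:
  assumes "u \<in> S" "v \<in> S"
  shows "form_norm g u \<le> form_norm g v + form_norm g (u - v)"
  using form_norm_triangle[of v "u - v"] assms by simp

lemma form_norm_abs_diff:
  assumes "u \<in> S" "v \<in> S"
  shows "\<bar>form_norm g u - form_norm g v\<bar> \<le> form_norm g (u - v)"
  using form_norm_triangle_sub[of u v] form_norm_triangle_sub[of v u] assms
    form_norm_minus_commute[of u v] by linarith

lemma parallelogram:
  assumes "u \<in> S" "v \<in> S"
  shows "quad g (u - v) = 2 * quad g u + 2 * quad g v - quad g (u + v)"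
  using assms by (simp add: quad_diff quad_add)

lemma quad_half: "u \<in> S \<Longrightarrow> quad g (sc (1/2) u) = quad g u / 4"
  by (simp add: quad_scale power2_eq_square norm_divide)

lemma restrict: "subspace T \<Longrightarrow> T \<subseteq> S \<Longrightarrow> sesq_form sc T g"
  using nonneg_form
  by unfold_locales (auto simp: nonneg_form_def sesquilinear_on_def subset_iff)

lemma tendsto_form_norm:
  assumes "\<And>n. x n \<in> S" "l \<in> S" "(\<lambda>n. form_norm g (x n - l)) \<longlonglongrightarrow> 0"
  shows "(\<lambda>n. form_norm g (x n)) \<longlonglongrightarrow> form_norm g l"
proof -
  have "(\<lambda>n. form_norm g (x n) - form_norm g l) \<longlonglongrightarrow> 0"
  proof (rule tendsto_0_le[OF assms(3), of _ 1], intro always_eventually allI)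
    show "norm (form_norm g (x n) - form_norm g l) \<le> norm (form_norm g (x n - l)) * 1" for n
      using form_norm_abs_diff[of "x n" l] assms(1,2) by simp
  qed
  then show ?thesis
    by (rule LIM_zero_cancel)
qed

lemma tendsto_quad:
  assumes "\<And>n. x n \<in> S" "l \<in> S" "(\<lambda>n. form_norm g (x n - l)) \<longlonglongrightarrow> 0"
  shows "(\<lambda>n. quad g (x n)) \<longlonglongrightarrow> quad g l"
  using tendsto_power[OF tendsto_form_norm[OF assms], of 2] assms by (simp add: form_norm_sq)

lemma tendsto_form_left:
  assumes "\<And>n. x n \<in> S" "l \<in> S" "v \<in> S" "(\<lambda>n. form_norm g (x n - l)) \<longlonglongrightarrow> 0"
  shows "(\<lambda>n. g (x n) v) \<longlonglongrightarrow> g l v"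
proof -
  have "(\<lambda>n. g (x n) v - g l v) \<longlonglongrightarrow> 0"
  proof (rule tendsto_0_le[OF assms(4), of _ "form_norm g v"], intro always_eventually allI)
    show "norm (g (x n) v - g l v) \<le> norm (form_norm g (x n - l)) * form_norm g v" for n
      using cauchy_schwarz[of "x n - l" v] assms(1-3) by (simp add: diff_left)
  qed
  then show ?thesis
    by (rule LIM_zero_cancel)
qed

end

section \<open>Completeness in the norm of a form\<close>

definition form_Cauchy :: "'a::ab_group_add form \<Rightarrow> (nat \<Rightarrow> 'a) \<Rightarrow> bool" where
  "form_Cauchy g x \<longleftrightarrow> (\<forall>e>0. \<exists>N. \<forall>m\<ge>N. \<forall>n\<ge>N. form_norm g (x m - x n) < e)"

text \<open>Sequential and phrased through the form alone, so that it passes easily to closed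
  subspaces and to equivalent forms. The metric-space notion of the assumptions is linked to it in
  \<open>form_complete_of_hilbert_space\<close>.\<close>

definition form_complete :: "'a::ab_group_add set \<Rightarrow> 'a form \<Rightarrow> bool" where
  "form_complete S g \<longleftrightarrow> (\<forall>x. (\<forall>n. x n \<in> S) \<and> form_Cauchy g x \<longrightarrow>
     (\<exists>l\<in>S. (\<lambda>n. form_norm g (x n - l)) \<longlonglongrightarrow> 0))"

lemma form_completeE:
  assumes "form_complete S g" "\<And>n. x n \<in> S" "form_Cauchy g x"
  obtains l where "l \<in> S" "(\<lambda>n. form_norm g (x n - l)) \<longlonglongrightarrow> 0"
  using assms by (auto simp: form_complete_def)

text \<open>Allowing y to differ from x covers a change of norm and a rescaling of the vectors at
  once.\<close>

lemma form_Cauchy_dominated: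
  assumes "form_Cauchy g x" "C > 0" "\<And>m n. form_norm h (y m - y n) \<le> C * form_norm g (x m - x n)"
  shows "form_Cauchy h y"
  unfolding form_Cauchy_def
proof (intro allI impI)
  fix e :: real
  assume "e > 0"
  then have "e / C > 0"
    using assms(2) by simp
  then obtain N where N: "\<forall>m\<ge>N. \<forall>n\<ge>N. form_norm g (x m - x n) < e / C"
    using assms(1) unfolding form_Cauchy_def by meson
  have "form_norm h (y m - y n) < e" if "m \<ge> N" "n \<ge> N" for m n
  proof -
    have "form_norm g (x m - x n) < e / C"
      using N that by blast
    then have "C * form_norm g (x m - x n) < e"
      using assms(2) by (simp add: field_simps)
    then show ?thesis
      using assms(3)[of m n] by linarith
  qed
  then show "\<exists>N. \<forall>m\<ge>N. \<forall>n\<ge>N. form_norm h (y m - y n) < e"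
    by blast
qed

lemma form_complete_equivalent:
  assumes "form_complete S g" "sesq_form sc S h" "c > 0" "C > 0"
    and "\<And>u. u \<in> S \<Longrightarrow> form_norm g u \<le> c * form_norm h u"
    and "\<And>u. u \<in> S \<Longrightarrow> form_norm h u \<le> C * form_norm g u"
  shows "form_complete S h"
  unfolding form_complete_def
proof (intro allI impI)
  fix x
  assume x: "(\<forall>n. x n \<in> S) \<and> form_Cauchy h x"
  interpret h: sesq_form sc S h by fact
  have "form_Cauchy g x"
  proof (rule form_Cauchy_dominated)
    show "form_norm g (x m - x n) \<le> c * form_norm h (x m - x n)" for m n
      using assms(5)[of "x m - x n"] x by simp
  qed (use x assms(3) in auto)
  then obtain l where l: "l \<in> S" "(\<lambda>n. form_norm g (x n - l)) \<longlonglongrightarrow> 0"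
    using form_completeE[OF assms(1), of x] x by blast
  have le: "form_norm h (x n - l) \<le> C * form_norm g (x n - l)" for n
    using assms(6)[of "x n - l"] x l(1) by auto
  have "(\<lambda>n. form_norm h (x n - l)) \<longlonglongrightarrow> 0"
  proof (rule tendsto_0_le[OF l(2), of _ C])
    show "\<forall>\<^sub>F n in sequentially. norm (form_norm h (x n - l)) \<le> norm (form_norm g (x n - l)) * C"
    proof (intro always_eventually allI)
      fix n
      have "form_norm h (x n - l) \<ge> 0"
        using x l by simp
      moreover have "C * form_norm g (x n - l) \<le> C * \<bar>form_norm g (x n - l)\<bar>"
        using assms(4) by simp
      ultimately show "norm (form_norm h (x n - l)) \<le> norm (form_norm g (x n - l)) * C"
        using le[of n] by (simp add: mult.commute)
    qed
  qed
  then show "\<exists>l\<in>S. (\<lambda>n. form_norm h (x n - l)) \<longlonglongrightarrow> 0"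
    using l(1) by blast
qed

context sesq_form
begin

lemma form_Cauchy_sq:
  assumes "\<And>n. x n \<in> S" and "\<And>e. e > 0 \<Longrightarrow> \<exists>N. \<forall>m\<ge>N. \<forall>n\<ge>N. quad g (x m - x n) < e"
  shows "form_Cauchy g x"
  unfolding form_Cauchy_def
proof (intro allI impI)
  fix e :: real
  assume e: "e > 0"
  then obtain N where "\<forall>m\<ge>N. \<forall>n\<ge>N. quad g (x m - x n) < e\<^sup>2"
    using assms(2)[of "e\<^sup>2"] by auto
  then show "\<exists>N. \<forall>m\<ge>N. \<forall>n\<ge>N. form_norm g (x m - x n) < e"
    using e by (intro exI[of _ N]) (auto simp: form_norm_def intro!: real_less_lsqrt)
qed

text \<open>First variation at a minimum: along c = - s \<alpha> the linear term is -2 s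
  |\<alpha>|^2 while the quadratic one is of order s^2, so a small s > 0 would make the sum
  negative. The shift in \<open>q = quad g v + 1\<close> keeps s = 1/q defined when
  \<open>quad g v = 0\<close>.\<close>

lemma real_affine_form_zero:
  assumes "u \<in> S" "v \<in> S" "\<And>c. 0 \<le> quad g (sc c v) + 2 * Re (cnj c * \<alpha>)"
  shows "\<alpha> = 0"
proof (rule ccontr)
  assume "\<alpha> \<noteq> 0"
  then have pos: "(cmod \<alpha>)\<^sup>2 > 0"
    by simp
  have le: "0 \<le> s\<^sup>2 * (cmod \<alpha>)\<^sup>2 * quad g v - 2 * s * (cmod \<alpha>)\<^sup>2" for s :: real
  proof -
    have "Re (cnj (complex_of_real (- s) * \<alpha>) * \<alpha>) = - s * (cmod \<alpha>)\<^sup>2"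
      by (simp only: cmod_power2) (simp add: power2_eq_square algebra_simps)
    moreover have "quad g (sc (complex_of_real (- s) * \<alpha>) v) = s\<^sup>2 * (cmod \<alpha>)\<^sup>2 * quad g v"
      by (simp only: quad_scale[OF assms(2)] norm_mult power_mult_distrib norm_of_real
          power2_abs power2_minus)
    ultimately show ?thesis
      using assms(3)[of "complex_of_real (- s) * \<alpha>"] by linarith
  qed
  define q where "q = quad g v + 1"
  have q: "q > 0" "quad g v < q"
    using quad_nonneg[OF assms(2)] unfolding q_def by linarith+
  have "0 \<le> (1/q)\<^sup>2 * quad g v - 2 * (1/q)"
  proof -
    have "0 \<le> ((1/q)\<^sup>2 * quad g v - 2 * (1/q)) * (cmod \<alpha>)\<^sup>2"
      using le[of "1/q"] by (simp add: algebra_simps)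
    then show ?thesis
      using pos by (simp add: zero_le_mult_iff)
  qed
  then show False
    using q by (simp add: field_simps power2_eq_square)
qed

text \<open>Direct method: completing the square bounds J below, the parallelogram law makes a
  minimising sequence Cauchy, and the first variation at the limit is the claimed identity. F is
  conjugate linear because it is represented in the second argument.\<close>

lemma riesz_representation:
  assumes "form_complete S g"
    and F_add: "\<And>u v. u \<in> S \<Longrightarrow> v \<in> S \<Longrightarrow> F (u + v) = F u + F v"
    and F_scale: "\<And>c u. u \<in> S \<Longrightarrow> F (sc c u) = cnj c * F u"
    and F_bound: "\<And>u. u \<in> S \<Longrightarrow> cmod (F u) \<le> M * form_norm g u"
  obtains w where "w \<in> S" "\<And>v. v \<in> S \<Longrightarrow> g w v = F v"
proof -
  define J where "J u = quad g u - 2 * Re (F u)" for u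
  have bdd: "- (M\<^sup>2) \<le> J u" if "u \<in> S" for u
  proof -
    have "Re (F u) \<le> M * form_norm g u"
      using F_bound[OF that] complex_Re_le_cmod order_trans by blast
    moreover have "0 \<le> (form_norm g u - M)\<^sup>2"
      by simp
    ultimately show ?thesis
      using that unfolding J_def by (simp add: form_norm_sq[symmetric] power2_diff algebra_simps)
  qed
  define m where "m = Inf (J ` S)"
  have bddb: "bdd_below (J ` S)"
    using bdd by (auto simp: bdd_below_def)
  have m_le: "m \<le> J u" if "u \<in> S" for u
    unfolding m_def using bddb that by (auto intro: cInf_lower)
  have ex: "\<exists>u\<in>S. J u < m + e" if "e > 0" for e
    using cInf_lessD[of "J ` S" "m + e"] that carrier_closed(1) unfolding m_def by fastforce
  have "\<exists>u. u \<in> S \<and> J u < m + 1 / Suc n" for n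
    using ex[of "1 / Suc n"] by auto
  then obtain x where x: "\<And>n. x n \<in> S" "\<And>n. J (x n) < m + 1 / Suc n"
    by metis
  \<comment> \<open>The midpoint of u and v has J at least m; the parallelogram law converts this
    into a bound on their distance by the excess of J over m.\<close>
  have mid: "quad g (u - v) \<le> 2 * J u + 2 * J v - 4 * m" if uv: "u \<in> S" "v \<in> S" for u v
  proof -
    have F_half: "F (sc (1/2) (u + v)) = (F u + F v) / 2"
      using uv F_scale[of "u + v" "1/2"] F_add[of u v] carrier_closed(2) by simp
    have "4 * J (sc (1/2) (u + v)) = quad g (u + v) - 4 * Re (F u + F v)"
      using uv unfolding J_def F_half
      by (simp add: quad_half right_diff_distrib add_divide_distrib del: scale_right_distrib)
    then have "4 * m \<le> quad g (u + v) - 4 * Re (F u + F v)"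
      using m_le[of "sc (1/2) (u + v)"] uv by auto
    then show ?thesis
      using uv by (simp add: parallelogram J_def)
  qed
  have "form_Cauchy g x"
  proof (rule form_Cauchy_sq)
    fix e :: real
    assume "e > 0"
    then obtain N where N: "1 / Suc N < e / 4"
      using nat_approx_posE[of "e/4"] by auto
    have "quad g (x k - x n) < e" if "k \<ge> N" "n \<ge> N" for k n
    proof -
      have "1 / real (Suc k) \<le> 1 / Suc N" "1 / real (Suc n) \<le> 1 / Suc N"
        using that by (simp_all add: frac_le)
      then show ?thesis
        using mid[OF x(1) x(1), of k n] x(2)[of k] x(2)[of n] N by linarith
    qed
    then show "\<exists>N. \<forall>m\<ge>N. \<forall>n\<ge>N. quad g (x m - x n) < e"
      by blast
  qed (use x in blast)
  then obtain w where w: "w \<in> S" "(\<lambda>n. form_norm g (x n - w)) \<longlonglongrightarrow> 0"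
    using form_completeE[OF assms(1)] x(1) by blast
  have F_diff: "F (u - v) = F u - F v" if "u \<in> S" "v \<in> S" for u v
    using F_add[of "u - v" v] that by simp
  have F_lim: "(\<lambda>n. F (x n)) \<longlonglongrightarrow> F w"
  proof -
    have "(\<lambda>n. F (x n) - F w) \<longlonglongrightarrow> 0"
    proof (rule tendsto_0_le[OF w(2), of _ M], intro always_eventually allI)
      show "norm (F (x n) - F w) \<le> norm (form_norm g (x n - w)) * M" for n
        using F_bound[of "x n - w"] x(1) w(1) by (simp add: F_diff mult.commute)
    qed
    then show ?thesis
      by (rule LIM_zero_cancel)
  qed
  have J_lim: "(\<lambda>n. J (x n)) \<longlonglongrightarrow> J w"
    unfolding J_def
    by (intro tendsto_diff tendsto_mult tendsto_const tendsto_Re F_lim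
        tendsto_quad[OF x(1) w(1) w(2)])
  have "(\<lambda>n. m + 1 / real (Suc n)) \<longlonglongrightarrow> m + 0"
    using LIMSEQ_Suc[OF lim_1_over_n] by (intro tendsto_intros) auto
  then have Jw: "J w \<le> m"
    using LIMSEQ_le[OF J_lim, of "\<lambda>n. m + 1 / real (Suc n)" m] x(2) by (auto intro: less_imp_le)
  have "g w v = F v" if v: "v \<in> S" for v
  proof -
    have "0 \<le> quad g (sc c v) + 2 * Re (cnj c * (g w v - F v))" for c
    proof -
      have "J w \<le> J (w + sc c v)"
        using m_le[of "w + sc c v"] Jw w(1) v by auto
      then show ?thesis
        using w(1) v by (simp add: J_def quad_add F_add F_scale scale_right algebra_simps)
    qed
    then have "g w v - F v = 0"
      using real_affine_form_zero[OF w(1) v] by blast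
    then show ?thesis
      by simp
  qed
  then show ?thesis
    using that w(1) by blast
qed

text \<open>The projection is the Riesz representative in T of the restricted functional
  \<open>g u\<close>, which is why completeness is asked of T.\<close>

lemma orthogonal_decomposition:
  assumes "subspace T" "T \<subseteq> S" "form_complete T g" "u \<in> S"
  obtains p where "p \<in> T" "\<And>v. v \<in> T \<Longrightarrow> g (u - p) v = 0"
proof -
  interpret T: sesq_form sc T g
    using restrict assms(1,2) by blast
  obtain p where p: "p \<in> T" "\<And>v. v \<in> T \<Longrightarrow> g p v = g u v"
  proof (rule T.riesz_representation[of "g u" "form_norm g u"])
    show "form_complete T g" by fact
    show "g u (x + y) = g u x + g u y" if "x \<in> T" "y \<in> T" for x y
      using that assms(2,4) by (auto intro: add_right)
    show "g u (sc c x) = cnj c * g u x" if "x \<in> T" for c x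
      using that assms(2,4) by (auto intro: scale_right)
    show "cmod (g u x) \<le> form_norm g u * form_norm g x" if "x \<in> T" for x
      using that assms(2,4) by (auto intro: cauchy_schwarz)
  qed (use that in auto)
  then have "g (u - p) v = 0" if "v \<in> T" for v
    using that p assms(2,4) by (subst diff_left) auto
  then show ?thesis
    using that p by blast
qed

end

section \<open>Compact eigenvalue problems\<close>

context vector_space
begin

text \<open>Serves to glue bases of eigenspaces belonging to different eigenvalues.\<close>

lemma independent_Un:
  assumes "independent A" "independent C" "finite C" "span A \<inter> span C \<subseteq> {0}"
  shows "independent (A \<union> C)"
  using assms(3,2,4)
proof (induction C rule: finite_induct)
  case empty
  then show ?case
    using assms(1) by simp
next
  case (insert c C)
  have indep: "independent C" "c \<notin> span C"
    using insert.prems(1) insert.hyps(2) by (auto simp: independent_insert)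
  have sub: "span C \<subseteq> span (insert c C)"
    by (intro span_mono) auto
  then have "independent (A \<union> C)"
    using insert.IH indep insert.prems(2) by blast
  moreover have "c \<notin> span (A \<union> C)"
  proof
    assume "c \<in> span (A \<union> C)"
    then obtain x y where xy: "x \<in> span A" "y \<in> span C" "c = x + y"
      by (auto simp: span_Un)
    have "c \<in> span (insert c C)" "y \<in> span (insert c C)"
      using xy sub by (auto intro: span_base)
    then have "c - y \<in> span (insert c C)"
      by (rule span_diff)
    then have "x \<in> span A \<inter> span (insert c C)"
      using xy by simp
    then have "x = 0"
      using insert.prems(2) by blast
    then show False
      using xy indep by simp
  qed
  ultimately show ?case
    by (auto simp: independent_insert)
qed

lemma vanishing_on_span:
  assumes "\<And>x y. x \<in> span B \<Longrightarrow> y \<in> span B \<Longrightarrow> \<phi> (x + y) = \<phi> x + \<phi> y"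
    and "\<And>r x. x \<in> span B \<Longrightarrow> \<phi> (scale r x) = r * \<phi> x"
    and "\<And>b. b \<in> B \<Longrightarrow> \<phi> b = 0" "v \<in> span B"
  shows "\<phi> v = 0"
proof -
  have "v \<in> span B \<and> \<phi> v = 0"
    using assms(4)
  proof (induction rule: span_induct_alt)
    case base
    show ?case
      using assms(2)[of 0 0] by (simp add: span_zero)
  next
    case (step r x y)
    then have "x \<in> span B"
      by (auto intro: span_base)
    then show ?case
      using step assms(1)[of "scale r x" y] assms(2,3) by (auto intro: span_add span_scale)
  qed
  then show ?thesis
    by simp
qed

text \<open>Gaussian elimination with one functional at a time: a pivot b0 with
  \<open>\<phi> c b0\<close> nonzero allows the remaining vectors to be sheared into the kernel of
  \<open>\<phi> c\<close>, at the cost of one dimension. Linearity is asked only on the span in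
  question.\<close>

lemma common_kernel_nontrivial:
  assumes "finite C" "finite B" "independent B" "card C < card B"
    and "\<And>c x y. c \<in> C \<Longrightarrow> x \<in> span B \<Longrightarrow> y \<in> span B \<Longrightarrow> \<phi> c (x + y) = \<phi> c x + \<phi> c y"
    and "\<And>c r x. c \<in> C \<Longrightarrow> x \<in> span B \<Longrightarrow> \<phi> c (scale r x) = r * \<phi> c x"
  shows "\<exists>f\<in>span B. f \<noteq> 0 \<and> (\<forall>c\<in>C. \<phi> c f = 0)"
  using assms
proof (induction C arbitrary: B rule: finite_induct)
  case empty
  then obtain b where "b \<in> B"
    by fastforce
  then have "b \<in> span B" "b \<noteq> 0"
    using empty.prems dependent_zero span_base by auto
  then show ?case
    by auto
next
  case (insert c C)
  note add = insert.prems(4) and scal = insert.prems(5)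
  show ?case
  proof (cases "\<forall>b\<in>B. \<phi> c b = 0")
    case True
    have "\<exists>f\<in>span B. f \<noteq> 0 \<and> (\<forall>c\<in>C. \<phi> c f = 0)"
      using insert.prems insert.hyps by (intro insert.IH) auto
    then obtain f where f: "f \<in> span B" "f \<noteq> 0" "\<forall>c\<in>C. \<phi> c f = 0"
      by blast
    have "\<phi> c f = 0"
      using vanishing_on_span[OF add[OF insertI1] scal[OF insertI1] _ f(1)] True by blast
    then show ?thesis
      using f by blast
  next
    case False
    then obtain b0 where b0: "b0 \<in> B" "\<phi> c b0 \<noteq> 0"
      by blast
    define h where "h b = b + scale (- \<phi> c b / \<phi> c b0) b0" for b
    have h_span: "h b \<in> span B" if "b \<in> span B" for b
      unfolding h_def using that b0 by (intro span_add span_scale) (auto intro: span_base)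
    have h_zero: "\<phi> c (h b) = 0" if "b \<in> span B" for b
    proof -
      have b0s: "b0 \<in> span B"
        using b0 by (auto intro: span_base)
      have "\<phi> c (h b) = \<phi> c b + (- \<phi> c b / \<phi> c b0) * \<phi> c b0"
        unfolding h_def by (subst add[OF _ that span_scale[OF b0s]]) (simp_all only: scal[OF insertI1 b0s] insertI1)
      then show ?thesis
        using b0 by simp
    qed
    \<comment> \<open>The sheared vectors are not known to be independent, so a basis is extracted;
      together with b0 it still spans B, hence at most one dimension is lost.\<close>
    obtain B' where B': "B' \<subseteq> h ` (B - {b0})" "independent B'" "h ` (B - {b0}) \<subseteq> span B'"
      using maximal_independent_subset by blast
    have fin: "finite B'"
      using B'(1) insert.prems(1) finite_subset by blast
    have "B \<subseteq> span (insert b0 B')"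
    proof
      fix b
      assume b: "b \<in> B"
      show "b \<in> span (insert b0 B')"
      proof (cases "b = b0")
        case False
        then have "h b \<in> span (insert b0 B')"
          using B'(3) b span_mono[of B' "insert b0 B'"] by blast
        moreover have "scale (\<phi> c b / \<phi> c b0) b0 \<in> span (insert b0 B')"
          by (intro span_scale span_base) simp
        ultimately have "h b + scale (\<phi> c b / \<phi> c b0) b0 \<in> span (insert b0 B')"
          by (rule span_add)
        then show ?thesis
          by (simp add: h_def add.assoc flip: scale_left_distrib)
      qed (simp add: span_base)
    qed
    then have "card B \<le> card (insert b0 B')"
      using independent_span_bound[of "insert b0 B'" B] fin insert.prems(2) by simp
    also have "\<dots> \<le> Suc (card B')"
      by (simp add: card_insert_if fin)
    finally have "card C < card B'"
      using insert.prems(3) insert.hyps by simp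
    have sub: "span B' \<subseteq> span B"
      using B'(1) h_span by (intro span_minimal) (auto intro: span_base)
    have "\<exists>f\<in>span B'. f \<noteq> 0 \<and> (\<forall>c\<in>C. \<phi> c f = 0)"
      by (rule insert.IH[OF fin B'(2) \<open>card C < card B'\<close>
            add[OF insertI2 subsetD[OF sub] subsetD[OF sub]] scal[OF insertI2 subsetD[OF sub]]])
    then obtain f where f: "f \<in> span B'" "f \<noteq> 0" "\<forall>c\<in>C. \<phi> c f = 0"
      by blast
    have "\<phi> c b = 0" if "b \<in> B'" for b
      using that B'(1) h_zero by (auto intro: span_base)
    then have "\<phi> c f = 0"
      using vanishing_on_span[OF add[OF insertI1 subsetD[OF sub] subsetD[OF sub]]
          scal[OF insertI1 subsetD[OF sub]] _ f(1)] by blast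
    then show ?thesis
      using f sub by blast
  qed
qed

end

section \<open>Orthogonality to finitely many vectors\<close>

context sesq_form
begin

lemma vanish_on_span:
  assumes "u \<in> S" "B \<subseteq> S" "\<And>b. b \<in> B \<Longrightarrow> g u b = 0" "v \<in> span B"
  shows "g u v = 0"
proof -
  have "v \<in> S \<and> g u v = 0"
    using assms(4)
  proof (induction rule: span_induct_alt)
    case (step k x y)
    then have "x \<in> S"
      using assms by auto
    then show ?case
      using step assms by (auto simp: add_right scale_right)
  qed (use assms in simp)
  then show ?thesis
    by simp
qed

text \<open>Gram-Schmidt without normalisation: e is the new vector made orthogonal to the old ones,
  and u is corrected along e only, which leaves the old orthogonality relations intact.\<close>

lemma finite_projection:
  assumes "finite B" "B \<subseteq> S" "u \<in> S"
  shows "\<exists>p\<in>span B. \<forall>b\<in>B. g (u - p) b = 0"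
  using assms
proof (induction B arbitrary: u rule: finite_induct)
  case empty
  then show ?case
    by (auto intro: span_zero)
next
  case (insert b B)
  have sB: "span B \<subseteq> S" "span B \<subseteq> span (insert b B)"
    using span_minimal[OF _ subspace_carrier, of B] insert.prems(1) by (auto intro!: span_mono)
  obtain p where p: "p \<in> span B" "\<forall>b\<in>B. g (u - p) b = 0"
    using insert.IH[of u] insert.prems by auto
  obtain q where q: "q \<in> span B" "\<forall>c\<in>B. g (b - q) c = 0"
    using insert.IH[of b] insert.prems by auto
  define e where "e = b - q"
  \<comment> \<open>If \<open>g e e = 0\<close>, the quotient is 0 by convention and r = p; this is
    correct because e is then a null vector, orthogonal to everything.\<close>
  define r where "r = p + sc (g (u - p) e / g e e) e"
  have S: "b \<in> S" "p \<in> S" "q \<in> S" "e \<in> S" "u \<in> S"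
    using p q sB insert.prems by (auto simp: e_def)
  have "e \<in> span (insert b B)"
    unfolding e_def using q sB by (intro span_diff) (auto intro: span_base)
  then have r: "r \<in> span (insert b B)" "r \<in> S"
    unfolding r_def using p sB S by (auto intro!: span_add span_scale)
  have gB: "g (u - r) c = 0" if "c \<in> B" for c
  proof -
    have c: "c \<in> S"
      using that insert.prems by auto
    have "g (u - r) c = g (u - p) c - (g (u - p) e / g e e) * g e c"
      using S c by (simp add: r_def diff_left add_left scale_left)
    then show ?thesis
      using p q that by (simp add: e_def)
  qed
  have ge: "g (u - r) e = 0"
  proof (cases "g e e = 0")
    case True
    then have "quad g e = 0"
      by (simp add: quad_def)
    then show ?thesis
      using S r by (simp add: null_right)
  next
    case False
    have "g (u - r) e = g (u - p) e - (g (u - p) e / g e e) * g e e"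
      using S by (simp add: r_def diff_left add_left scale_left)
    then show ?thesis
      using False by simp
  qed
  have "g (u - r) q = 0"
    using vanish_on_span[OF _ _ gB q(1)] S r insert.prems by simp
  then have "g (u - r) b = 0"
    using ge S r by (simp add: e_def diff_right)
  then show ?case
    using r gB by blast
qed

lemma form_complete_orthogonal_complement:
  assumes "form_complete S g" "B \<subseteq> S"
  shows "form_complete {u \<in> S. \<forall>b\<in>B. g u b = 0} g"
  unfolding form_complete_def
proof (intro allI impI)
  fix x
  assume x: "(\<forall>n. x n \<in> {u \<in> S. \<forall>b\<in>B. g u b = 0}) \<and> form_Cauchy g x"
  then have xS: "x n \<in> S" for n
    by blast
  obtain l where l: "l \<in> S" "(\<lambda>n. form_norm g (x n - l)) \<longlonglongrightarrow> 0"
    using form_completeE[OF assms(1), of x] xS x by blast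
  have "g l b = 0" if "b \<in> B" for b
  proof -
    have "(\<lambda>n. g (x n) b) \<longlonglongrightarrow> g l b"
      using tendsto_form_left[OF xS l(1) _ l(2)] that assms(2) by blast
    moreover have "g (x n) b = 0" for n
      using x that by blast
    ultimately show ?thesis
      by (simp add: LIMSEQ_const_iff)
  qed
  then show "\<exists>l\<in>{u \<in> S. \<forall>b\<in>B. g u b = 0}. (\<lambda>n. form_norm g (x n - l)) \<longlonglongrightarrow> 0"
    using l by blast
qed

lemma subspace_orthogonal_complement:
  assumes "B \<subseteq> S"
  shows "subspace {u \<in> S. \<forall>b\<in>B. g u b = 0}"
  using assms by (intro subspaceI) (auto simp: add_left scale_left subset_iff)

end

section \<open>Variational theory of the problem t u = \<mu> d u\<close>

locale eigen_problem = t: sesq_form sc D t + d: sesq_form sc UNIV d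
  for sc :: "complex \<Rightarrow> 'a::ab_group_add \<Rightarrow> 'a" and D :: "'a set" and t d :: "'a form" +
  assumes complete: "form_complete D t"
    and definite: "\<And>u. quad d u = 0 \<Longrightarrow> u = 0"
    and dominated: "\<And>u. u \<in> D \<Longrightarrow> quad d u \<le> quad t u"
    and compact: "\<And>x. (\<And>n. x n \<in> D) \<Longrightarrow> (\<And>n. quad t (x n) \<le> 1)
                    \<Longrightarrow> \<exists>r::nat \<Rightarrow> nat. strict_mono r \<and> form_Cauchy d (x \<circ> r)"
begin

lemma quad_d_pos: "u \<noteq> 0 \<Longrightarrow> 0 < quad d u"
  using definite[of u] d.quad_nonneg[OF UNIV_I, of u] by (auto simp: less_le)

lemma quad_t_pos: "u \<in> D \<Longrightarrow> u \<noteq> 0 \<Longrightarrow> 0 < quad t u"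
  using quad_d_pos[of u] dominated[of u] by fastforce

lemma form_norm_dominated: "u \<in> D \<Longrightarrow> form_norm d u \<le> form_norm t u"
  by (simp add: form_norm_def dominated)

definition eig :: "complex \<Rightarrow> 'a \<Rightarrow> bool" where
  "eig \<mu> u \<longleftrightarrow> u \<in> D \<and> (\<forall>v\<in>D. t u v = \<mu> * d u v)"

lemma eig_pos:
  assumes "eig (complex_of_real \<mu>) u" "u \<noteq> 0"
  shows "\<mu> > 0"
proof -
  have "quad t u = \<mu> * quad d u"
    using assms by (auto simp: eig_def quad_def)
  then show ?thesis
    using assms quad_t_pos[of u] quad_d_pos[of u] by (auto simp: eig_def zero_less_mult_iff)
qed

lemma eig_orthogonal:
  assumes "eig (complex_of_real \<mu>) u" "eig (complex_of_real \<nu>) v" "\<mu> \<noteq> \<nu>"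
  shows "t u v = 0" "d u v = 0"
proof -
  have "t v u = complex_of_real \<nu> * d v u" and uv: "t u v = complex_of_real \<mu> * d u v"
    "u \<in> D" "v \<in> D"
    using assms by (auto simp: eig_def)
  then have "t u v = complex_of_real \<nu> * d u v"
    using t.hermitian[of v u] d.hermitian[of v u] by simp
  then show "d u v = 0"
    using uv assms(3) by simp
  then show "t u v = 0"
    using uv by simp
qed

text \<open>Defines the solution operator at an arbitrary f of the ambient space: by domination,
  \<open>d f\<close> is bounded in the norm of t.\<close>

lemma riesz_solution:
  obtains x where "x \<in> D" "\<And>y. y \<in> D \<Longrightarrow> t x y = d f y"
proof (rule t.riesz_representation[OF complete, of "d f" "form_norm d f"])
  show "cmod (d f u) \<le> form_norm d f * form_norm t u" if "u \<in> D" for u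
    using d.cauchy_schwarz[of f u] form_norm_dominated[OF that]
    by (meson UNIV_I d.form_norm_nonneg mult_left_mono order_trans)
qed (auto simp: d.add_right d.scale_right)

text \<open>The supremum s of d/t over P is attained. Compactness gives a d-Cauchy maximising
  subsequence only; comparing the parallelogram laws of the two forms upgrades it to a t-Cauchy one,
  so the limit has t-norm exactly 1.\<close>

lemma maximizer:
  assumes P: "t.subspace P" "P \<subseteq> D" "form_complete P t" and ne: "\<exists>u\<in>P. u \<noteq> 0"
  obtains u where "u \<in> P" "quad t u = 1" "\<And>v. v \<in> P \<Longrightarrow> quad d v \<le> quad d u * quad t v"
proof -
  interpret P: sesq_form sc P t
    using t.restrict P by blast
  define T where "T = {u \<in> P. quad t u = 1}"
  define s where "s = Sup (quad d ` T)"
  have normalize: "sc (complex_of_real (1 / sqrt (quad t u))) u \<in> T" if "u \<in> P" "u \<noteq> 0" for u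
  proof -
    have "quad t u > 0"
      using that P quad_t_pos by blast
    then show ?thesis
      using that by (simp add: T_def P.quad_scale norm_divide power_divide)
  qed
  have bdd: "bdd_above (quad d ` T)"
  proof (rule bdd_aboveI)
    show "r \<le> 1" if "r \<in> quad d ` T" for r
      using that dominated P(2) by (force simp: T_def)
  qed
  have T: "T \<noteq> {}"
    using ne normalize by blast
  have le_s: "quad d u \<le> s" if "u \<in> T" for u
    unfolding s_def using that bdd by (auto intro: cSUP_upper)
  have scaled: "quad d v \<le> s * quad t v" if "v \<in> P" for v
  proof (cases "v = 0")
    case False
    have pos: "quad t v > 0"
      using that False P quad_t_pos by blast
    have "quad d v / quad t v \<le> s"
      using le_s[OF normalize[OF that False]] pos
      by (simp add: d.quad_scale norm_divide power_divide)
    then show ?thesis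
      using pos by (simp add: field_simps)
  qed simp
  have s: "s > 0"
  proof -
    obtain u where "u \<in> T"
      using T by blast
    then have "u \<noteq> 0"
      by (auto simp: T_def)
    then show ?thesis
      using le_s[OF \<open>u \<in> T\<close>] quad_d_pos[of u] by linarith
  qed
  have "\<exists>u\<in>T. quad d u > s - 1 / Suc n" for n
    using less_cSupD[of "quad d ` T" "s - 1 / Suc n"] T unfolding s_def by fastforce
  then obtain x where x: "\<And>n. x n \<in> T" "\<And>n. quad d (x n) > s - 1 / Suc n"
    by metis
  obtain r :: "nat \<Rightarrow> nat" where r: "strict_mono r" "form_Cauchy d (x \<circ> r)"
    using compact[of x] x(1) P(2) by (auto simp: T_def subset_iff)
  define y where "y = x \<circ> r"
  have yP: "y n \<in> P" "quad t (y n) = 1" for n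
    using x(1) by (auto simp: y_def T_def)
  have yd: "quad d (y n) > s - 1 / Suc n" for n
  proof -
    have "1 / real (Suc (r n)) \<le> 1 / Suc n"
      using seq_suble[OF r(1), of n] by (simp add: frac_le)
    then show ?thesis
      using x(2)[of "r n"] by (simp add: y_def)
  qed
  \<comment> \<open>s t[y m + y n] is at least d[y m + y n]; both sums are rewritten as differences
    by the parallelogram law, and d[y m], d[y n] are almost s.\<close>
  have diff: "s * quad t (y m - y n) \<le> 2 / Suc m + 2 / Suc n + quad d (y m - y n)" for m n
  proof -
    have "quad d (y m + y n) \<le> s * quad t (y m + y n)"
      using scaled yP by simp
    moreover have "s * quad t (y m - y n) = s * (2 + 2 - quad t (y m + y n))"
      using P.parallelogram[of "y m" "y n"] yP by simp
    then have "s * quad t (y m - y n) = 4 * s - s * quad t (y m + y n)"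
      by (simp add: algebra_simps)
    ultimately show ?thesis
      using d.parallelogram[of "y m" "y n"] yd[of m] yd[of n] by simp
  qed
  have "form_Cauchy t y"
  proof (rule P.form_Cauchy_sq)
    fix e :: real
    assume e: "e > 0"
    \<comment> \<open>The cap 1 gives \<open>e'\<^sup>2 \<le> e'\<close>; the divisor 8 leaves room
      for the 2 + 2 + 1 copies of e' that \<open>diff\<close> produces.\<close>
    define e' where "e' = min 1 (s * e / 8)"
    have e': "e' > 0" "e' \<le> 1" "e' \<le> s * e / 8"
      using e s by (auto simp: e'_def)
    obtain N1 where N1: "1 / Suc N1 < e'"
      using nat_approx_posE[OF e'(1)] by blast
    obtain N2 where N2: "\<forall>m\<ge>N2. \<forall>n\<ge>N2. form_norm d (y m - y n) < e'"
      using r(2) e'(1) unfolding form_Cauchy_def y_def by blast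
    have "quad t (y m - y n) < e" if "m \<ge> max N1 N2" "n \<ge> max N1 N2" for m n
    proof -
      have "1 / real (Suc m) \<le> 1 / Suc N1" "1 / real (Suc n) \<le> 1 / Suc N1"
        using that by (simp_all add: frac_le)
      moreover have "quad d (y m - y n) \<le> e'"
      proof -
        have "form_norm d (y m - y n) < e'"
          using N2 that by simp
        then have "(form_norm d (y m - y n))\<^sup>2 \<le> e'\<^sup>2"
          by (intro power_mono) (auto)
        also have "e'\<^sup>2 \<le> e'"
          using e' by (simp add: power2_eq_square mult_left_le)
        finally show ?thesis
          by (simp add: d.form_norm_sq)
      qed
      ultimately have "s * quad t (y m - y n) < 5 * e'"
        using diff[of m n] N1 by simp
      also have "\<dots> < s * e"
        using e' e s by simp
      finally show ?thesis
        using s by simp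
    qed
    then show "\<exists>N. \<forall>m\<ge>N. \<forall>n\<ge>N. quad t (y m - y n) < e"
      by blast
  qed (use yP in blast)
  then obtain u where u: "u \<in> P" "(\<lambda>n. form_norm t (y n - u)) \<longlonglongrightarrow> 0"
    using form_completeE[OF P(3)] yP by blast
  have "(\<lambda>n. quad t (y n)) \<longlonglongrightarrow> quad t u"
    using P.tendsto_quad yP u by blast
  then have ut: "quad t u = 1"
    using yP by (simp add: LIMSEQ_const_iff)
  have "(\<lambda>n. form_norm d (y n - u)) \<longlonglongrightarrow> 0"
  proof (rule tendsto_0_le[OF u(2), of _ 1], intro always_eventually allI)
    show "norm (form_norm d (y n - u)) \<le> norm (form_norm t (y n - u)) * 1" for n
      using form_norm_dominated[of "y n - u"] P.carrier_closed(3)[OF yP(1) u(1), of n] P(2)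
        d.form_norm_nonneg[of "y n - u"] by (auto simp: subset_iff)
  qed
  then have lim: "(\<lambda>n. quad d (y n)) \<longlonglongrightarrow> quad d u"
    using d.tendsto_quad by blast
  have "(\<lambda>n. s - 1 / real (Suc n)) \<longlonglongrightarrow> s - 0"
    using LIMSEQ_Suc[OF lim_1_over_n] by (intro tendsto_intros) auto
  then have "s \<le> quad d u"
    using LIMSEQ_le[OF _ lim, of "\<lambda>n. s - 1 / real (Suc n)" s] yd by (auto intro: less_imp_le)
  then have "quad d v \<le> quad d u * quad t v" if "v \<in> P" for v
    using scaled[OF that] that by (meson P.quad_nonneg mult_right_mono order_trans)
  then show ?thesis
    using that u(1) ut by blast
qed

text \<open>If the maximum s of d/t on the t-complement of B were at least m, its maximiser would be
  an eigenvector for 1/s, hence in the span of B and orthogonal to itself. The inequality s < m is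
  strict because the maximum is attained.\<close>

lemma gap_on_complement:
  assumes B: "finite B" "\<And>b. b \<in> B \<Longrightarrow> \<exists>\<mu>. b \<noteq> 0 \<and> eig (complex_of_real \<mu>) b"
    and m: "m > 0" "\<And>\<mu> u. \<mu> \<le> 1 / m \<Longrightarrow> eig (complex_of_real \<mu>) u \<Longrightarrow> u \<in> t.span B"
  obtains s where "0 \<le> s" "s < m"
    "\<And>v. v \<in> D \<Longrightarrow> (\<And>b. b \<in> B \<Longrightarrow> t v b = 0) \<Longrightarrow> quad d v \<le> s * quad t v"
proof -
  define P where "P = {u \<in> D. \<forall>b\<in>B. t u b = 0}"
  have BD: "B \<subseteq> D"
    using B(2) by (auto simp: eig_def)
  have P: "t.subspace P" "P \<subseteq> D" "form_complete P t"
    using t.subspace_orthogonal_complement[OF BD]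
      t.form_complete_orthogonal_complement[OF complete BD] by (auto simp: P_def)
  show ?thesis
  proof (cases "\<exists>u\<in>P. u \<noteq> 0")
    case False
    show ?thesis
    proof (rule that[of 0])
      show "quad d v \<le> 0 * quad t v" if "v \<in> D" "\<And>b. b \<in> B \<Longrightarrow> t v b = 0" for v
        using False that by (auto simp: P_def)
    qed (use m in auto)
  next
    case True
    then obtain u where u: "u \<in> P" "quad t u = 1" "\<And>v. v \<in> P \<Longrightarrow> quad d v \<le> quad d u * quad t v"
      using maximizer[OF P] by blast
    define s where "s = quad d u"
    have uD: "u \<in> D" "\<And>b. b \<in> B \<Longrightarrow> t u b = 0" "u \<noteq> 0"
      using u by (auto simp: P_def)
    have s: "s > 0"
      unfolding s_def using uD quad_d_pos by blast
    \<comment> \<open>s t - d is non-negative on P and vanishes at the maximiser, so Cauchy-Schwarz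
      makes u a null vector of it: the Euler-Lagrange equation without differentiation.\<close>
    define q where "q v w = complex_of_real s * t v w - d v w" for v w
    interpret P: sesq_form sc P t
      using t.restrict P by blast
    have q_quad: "q v v = complex_of_real (s * quad t v - quad d v)" if "v \<in> P" for v
      using that by (simp add: q_def P.diag d.diag)
    interpret q: sesq_form sc P q
    proof
      show "nonneg_form sc P q"
        unfolding nonneg_form_def sesquilinear_on_def
      proof (intro conjI ballI allI)
        show "q v v \<in> \<real>\<^sub>\<ge>\<^sub>0" if "v \<in> P" for v
          using u(3)[OF that] unfolding q_quad[OF that]
          by (simp add: s_def complex_nonneg_Reals_iff)
      qed (auto simp: q_def P.add_left P.add_right P.scale_left P.scale_right
          d.add_left d.add_right d.scale_left d.scale_right algebra_simps)
    qed (fact P(1))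
    have "quad q u = 0"
      unfolding quad_def using q_quad[OF u(1)] u(2) by (simp add: s_def)
    then have on_P: "complex_of_real s * t u v = d u v" if "v \<in> P" for v
      using q.null_left[OF u(1) that] by (simp add: q_def)
    have d_B: "d u b = 0" if "b \<in> B" for b
    proof -
      obtain \<mu> where \<mu>: "b \<noteq> 0" "eig (complex_of_real \<mu>) b"
        using B(2)[OF \<open>b \<in> B\<close>] by blast
      have "t b u = 0"
        using uD(2)[OF that] t.hermitian[of u b] uD(1) BD that by auto
      moreover have "t b u = complex_of_real \<mu> * d b u" "\<mu> > 0"
        using \<mu> uD(1) eig_pos by (auto simp: eig_def)
      ultimately have "d b u = 0"
        by simp
      then show ?thesis
        using d.hermitian[of b u] by simp
    qed
    have "eig (complex_of_real (1 / s)) u"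
      unfolding eig_def
    proof (intro conjI ballI)
      fix v
      assume v: "v \<in> D"
      \<comment> \<open>The equation is known only for test vectors in P. A general v differs from P
        by some p in the span of B, and u is orthogonal to B in t and, B consisting of eigenvectors,
        also in d.\<close>
      obtain p where p: "p \<in> t.span B" "\<forall>b\<in>B. t (v - p) b = 0"
        using t.finite_projection[OF B(1) BD v] by blast
      have pD: "p \<in> D"
        using p t.span_minimal[OF BD t.subspace_carrier] by blast
      have "t u p = 0" "d u p = 0"
        using t.vanish_on_span[OF uD(1) BD uD(2) p(1)] d.vanish_on_span[OF _ _ d_B p(1)] by auto
      moreover have "complex_of_real s * t u (v - p) = d u (v - p)"
        using p pD v by (intro on_P) (auto simp: P_def)
      ultimately have "complex_of_real s * t u v = d u v"
        using pD v uD by (simp add: t.diff_right d.diff_right)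
      then show "t u v = complex_of_real (1 / s) * d u v"
        using s by (simp add: field_simps)
    qed (fact uD(1))
    then have not_le: "\<not> 1 / s \<le> 1 / m"
    proof (intro notI)
      assume "eig (complex_of_real (1 / s)) u" "1 / s \<le> 1 / m"
      then have "u \<in> t.span B"
        using m(2) by blast
      then have "t u u = 0"
        using t.vanish_on_span[OF uD(1) BD uD(2)] by blast
      then show False
        using u(2) by (simp add: quad_def)
    qed
    then have "s < m"
      using s m(1) by (simp add: field_simps)
    moreover have "quad d v \<le> s * quad t v" if "v \<in> D" "\<And>b. b \<in> B \<Longrightarrow> t v b = 0" for v
      unfolding s_def using that u(3) by (auto simp: P_def)
    ultimately show ?thesis
      using that[of s] s by simp
  qed
qed

text \<open>Turns the counting in \<open>lists_eigenvalues\<close> into actual vectors. Different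
  eigenspaces are orthogonal in both t and d, so bases can be joined one eigenvalue at a time and
  the Rayleigh bound of the last clause adds up. Numbers in M that are not eigenvalues contribute no
  vectors and no indices.\<close>

lemma eigenbasis:
  assumes lists: "lists_eigenvalues sc A I lam" and A: "\<And>\<mu>. eigenspace sc A \<mu> = {u. eig \<mu> u}"
    and "finite M"
  shows "\<exists>B. finite B \<and> \<not> module.dependent sc B \<and> finite {j \<in> I. lam j \<in> M} \<and>
    card B = card {j \<in> I. lam j \<in> M} \<and> (\<forall>b\<in>B. \<exists>\<mu>\<in>M. eig (complex_of_real \<mu>) b) \<and>
    (\<forall>\<mu>\<in>M. \<forall>u. eig (complex_of_real \<mu>) u \<longrightarrow> u \<in> t.span B) \<and>
    (\<forall>\<Lambda>. (\<forall>\<mu>\<in>M. \<mu> \<le> \<Lambda>) \<longrightarrow> (\<forall>f\<in>t.span B. quad t f \<le> \<Lambda> * quad d f))"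
  using assms(3)
proof (induction M rule: finite_induct)
  case empty
  show ?case
    by (intro exI[of _ "{}"]) (simp add: t.dependent_def)
next
  case (insert \<mu> M)
  then obtain B where B: "finite B" "\<not> module.dependent sc B" "finite {j \<in> I. lam j \<in> M}"
    "card B = card {j \<in> I. lam j \<in> M}" "\<forall>b\<in>B. \<exists>\<mu>\<in>M. eig (complex_of_real \<mu>) b"
    "\<forall>\<mu>\<in>M. \<forall>u. eig (complex_of_real \<mu>) u \<longrightarrow> u \<in> t.span B"
    "\<forall>\<Lambda>. (\<forall>\<mu>\<in>M. \<mu> \<le> \<Lambda>) \<longrightarrow> (\<forall>f\<in>t.span B. quad t f \<le> \<Lambda> * quad d f)"
    by blast
  define Q where "Q = {u. eig (complex_of_real \<mu>) u}"
  have eq: "{j \<in> I. complex_of_real (lam j) = complex_of_real \<mu>} = {j \<in> I. lam j = \<mu>}"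
    by auto
  have Q: "finite_dim sc Q" "finite {j \<in> I. lam j = \<mu>}" "card {j \<in> I. lam j = \<mu>} = vector_space.dim sc Q"
    using lists A[of "complex_of_real \<mu>"] unfolding lists_eigenvalues_def Q_def eq[symmetric] by metis+
  have subQ: "t.subspace Q"
    by (intro t.subspaceI)
      (auto simp: Q_def eig_def t.add_left t.scale_left d.add_left d.scale_left algebra_simps)
  obtain C where C: "C \<subseteq> Q" "\<not> module.dependent sc C" "Q \<subseteq> t.span C" "card C = vector_space.dim sc Q"
    using t.basis_exists by blast
  obtain F where F: "finite F" "Q \<subseteq> t.span F"
    using Q(1) by (auto simp: finite_dim_def)
  have finC: "finite C"
    using t.independent_span_bound[OF F(1) C(2)] C(1) F(2) by blast
  have spanC: "t.span C = Q"
    using C subQ t.span_minimal by blast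
  have BD: "B \<subseteq> D" and QD: "Q \<subseteq> D"
    using B(5) by (auto simp: Q_def eig_def)
  have spB: "t.span B \<subseteq> D"
    using t.span_minimal[OF BD t.subspace_carrier] .
  have orth: "t u v = 0" "d u v = 0" if uv: "u \<in> Q" "v \<in> t.span B" for u v
  proof -
    have z: "t u b = 0 \<and> d u b = 0" if "b \<in> B" for b
    proof -
      obtain \<nu> where "\<nu> \<in> M" "eig (complex_of_real \<nu>) b"
        using B(5) \<open>b \<in> B\<close> by blast
      then show ?thesis
        using eig_orthogonal[of \<mu> u \<nu> b] \<open>u \<in> Q\<close> insert.hyps by (auto simp: Q_def)
    qed
    show "t u v = 0"
      using t.vanish_on_span[OF _ BD _ uv(2), of u] uv QD z by blast
    show "d u v = 0"
      using d.vanish_on_span[OF _ _ _ uv(2), of u] z by blast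
  qed
  have disj: "t.span B \<inter> t.span C \<subseteq> {0}"
  proof
    fix u
    assume u: "u \<in> t.span B \<inter> t.span C"
    then have "d u u = 0"
      using orth(2) spanC by blast
    then show "u \<in> {0}"
      using definite by (simp add: quad_def)
  qed
  have indep: "\<not> module.dependent sc (B \<union> C)"
    using t.independent_Un[OF B(2) C(2) finC disj] .
  have "B \<inter> C = {}"
  proof (rule ccontr)
    assume "B \<inter> C \<noteq> {}"
    then obtain b where "b \<in> B" "b \<in> C"
      by blast
    then have "b = 0"
      using disj t.span_base by blast
    then show False
      using \<open>b \<in> B\<close> B(2) t.dependent_zero by blast
  qed
  have split: "{j \<in> I. lam j \<in> insert \<mu> M} = {j \<in> I. lam j \<in> M} \<union> {j \<in> I. lam j = \<mu>}"
    by auto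
  have card: "card (B \<union> C) = card {j \<in> I. lam j \<in> insert \<mu> M}"
  proof -
    have "card (B \<union> C) = card B + card C"
      using B(1) finC \<open>B \<inter> C = {}\<close> by (rule card_Un_disjoint)
    moreover have "card {j \<in> I. lam j \<in> insert \<mu> M}
        = card {j \<in> I. lam j \<in> M} + card {j \<in> I. lam j = \<mu>}"
      unfolding split using B(3) Q(2) insert.hyps by (intro card_Un_disjoint) auto
    ultimately show ?thesis
      using B(4) C(4) Q(3) by simp
  qed
  have subs: "t.span B \<subseteq> t.span (B \<union> C)" "t.span C \<subseteq> t.span (B \<union> C)"
    by (auto intro!: t.span_mono)
  have Rayleigh: "quad t f \<le> \<Lambda> * quad d f" if hyp: "\<forall>\<nu>\<in>insert \<mu> M. \<nu> \<le> \<Lambda>" "f \<in> t.span (B \<union> C)" for \<Lambda> f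
  proof -
    obtain x y where f: "f = x + y" "x \<in> t.span B" "y \<in> Q"
      using hyp(2) spanC by (auto simp: t.span_Un)
    have D: "x \<in> D" "y \<in> D"
      using f spB QD by auto
    have "t x y = 0" "d x y = 0"
      using orth[OF f(3,2)] t.hermitian[of y x] d.hermitian[of y x] D by auto
    then have "quad t f = quad t x + quad t y" "quad d f = quad d x + quad d y"
      using f D by (auto simp: t.quad_add d.quad_add)
    moreover have "quad t x \<le> \<Lambda> * quad d x"
      using B(7) that(1) f(2) by blast
    moreover have "quad t y = \<mu> * quad d y"
      using f(3) by (auto simp: Q_def eig_def quad_def)
    moreover have "\<mu> * quad d y \<le> \<Lambda> * quad d y"
      using that(1) by (intro mult_right_mono) auto
    ultimately show ?thesis
      by (simp add: algebra_simps)
  qed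
  show ?case
  proof (intro exI[of _ "B \<union> C"] conjI)
    show "finite {j \<in> I. lam j \<in> insert \<mu> M}"
      unfolding split using B(3) Q(2) by blast
    show "\<forall>b\<in>B \<union> C. \<exists>\<mu>\<in>insert \<mu> M. eig (complex_of_real \<mu>) b"
      using B(5) C(1) by (auto simp: Q_def)
    show "\<forall>\<nu>\<in>insert \<mu> M. \<forall>u. eig (complex_of_real \<nu>) u \<longrightarrow> u \<in> t.span (B \<union> C)"
      using B(6) C(3) subs by (auto simp: Q_def)
    show "\<forall>\<Lambda>. (\<forall>\<mu>\<in>insert \<mu> M. \<mu> \<le> \<Lambda>) \<longrightarrow> (\<forall>f\<in>t.span (B \<union> C). quad t f \<le> \<Lambda> * quad d f)"
      using Rayleigh by blast
  qed (use B(1) finC indep card in auto)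
qed

text \<open>An index in the list forces a non-zero eigenvector, and non-zero eigenvectors have
  positive eigenvalue.\<close>

lemma listed_eigenvalue_pos:
  assumes "lists_eigenvalues sc A I lam" "\<And>\<mu>. eigenspace sc A \<mu> = {u. eig \<mu> u}" "k \<in> I"
  shows "lam k > 0"
proof -
  let ?M = "{lam k}"
  obtain B where B: "finite B" "\<not> module.dependent sc B" "finite {j \<in> I. lam j \<in> ?M}"
    "card B = card {j \<in> I. lam j \<in> ?M}" "\<forall>b\<in>B. \<exists>\<mu>\<in>?M. eig (complex_of_real \<mu>) b"
    using eigenbasis[OF assms(1,2), of ?M] by auto
  have "card B \<noteq> 0"
    using B(3,4) assms(3) by auto
  then obtain b where "b \<in> B"
    by fastforce
  then show ?thesis
    using B(2,5) t.dependent_zero eig_pos by blast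
qed

end

text \<open>Writing \<open>T\<close> for the solution operators, the transfer hypothesis says that
  \<open>(T\<^sub>2 U f, U f) \<ge> (T\<^sub>1 f, f) - \<delta> |f|\<^sup>2\<close>, the left-hand side being expressed
  through its variational characterisation so that only a trial vector is needed.\<close>

lemma eigenvalue_comparison:
  assumes "eigen_problem sc D1 t1 d1" "eigen_problem sc D2 t2 d2"
    and U: "\<And>x y. d2 (U x) (U y) = d1 x y"
    and transfer: "\<And>f x. x \<in> D1 \<Longrightarrow> (\<And>y. y \<in> D1 \<Longrightarrow> t1 x y = d1 f y) \<Longrightarrow>
          \<exists>w\<in>D2. quad t1 x - \<delta> * quad d1 f \<le> 2 * Re (d2 (U f) w) - quad t2 w"
    and lists1: "lists_eigenvalues sc A1 I1 lam1"
      "\<And>\<mu>. eigenspace sc A1 \<mu> = {u. eigen_problem.eig D1 t1 d1 \<mu> u}"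
    and lists2: "lists_eigenvalues sc A2 I2 lam2"
      "\<And>\<mu>. eigenspace sc A2 \<mu> = {u. eigen_problem.eig D2 t2 d2 \<mu> u}"
    and k: "1 \<le> k" "{1..k} \<subseteq> I1"
    and I2: "I2 \<subseteq> {1..}"
  shows "k \<in> I2 \<Longrightarrow> 1 / lam1 k - 1 / lam2 k \<le> \<delta>"
    and "I2 \<subseteq> {1..<k} \<Longrightarrow> 1 / lam1 k \<le> \<delta>"
proof -
  interpret p1: eigen_problem sc D1 t1 d1 by fact
  interpret p2: eigen_problem sc D2 t2 d2 by fact
  \<comment> \<open>Both conclusions follow from this count: if m = 1/lam1 k - \<delta> is positive,
    then at least k listed eigenvalues of the second problem must be at most 1/m.\<close>
  have contra: False if m: "0 < 1 / lam1 k - \<delta>"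
    and count: "{j \<in> I2. lam2 j \<le> 1 / (1 / lam1 k - \<delta>)} \<subseteq> {1..<k}"
  proof -
    define m where "m = 1 / lam1 k - \<delta>"
    have m0: "m > 0"
      using m by (simp add: m_def)
    have kI: "k \<in> I1"
      using k by auto
    have lam1: "lam1 k > 0"
      using p1.listed_eigenvalue_pos[OF lists1 kI] .
    let ?M1 = "lam1 ` {1..k}"
    obtain B1 where B1: "finite B1" "\<not> module.dependent sc B1" "finite {j \<in> I1. lam1 j \<in> ?M1}"
      "card B1 = card {j \<in> I1. lam1 j \<in> ?M1}"
      "\<forall>\<Lambda>. (\<forall>\<mu>\<in>?M1. \<mu> \<le> \<Lambda>) \<longrightarrow> (\<forall>f\<in>p1.t.span B1. quad t1 f \<le> \<Lambda> * quad d1 f)"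
      "\<forall>b\<in>B1. \<exists>\<mu>\<in>?M1. p1.eig (complex_of_real \<mu>) b"
      using p1.eigenbasis[OF lists1, of ?M1] by auto
    have B1D: "p1.t.span B1 \<subseteq> D1"
      using B1(6) p1.t.span_minimal[OF _ p1.t.subspace_carrier] by (auto simp: p1.eig_def subset_iff)
    have mono: "mono_on I1 lam1"
      using lists1(1) by (simp add: lists_eigenvalues_def)
    have "\<forall>\<mu>\<in>?M1. \<mu> \<le> lam1 k"
      using mono k kI by (auto intro!: mono_onD[OF mono])
    then have R1: "quad t1 f \<le> lam1 k * quad d1 f" if "f \<in> p1.t.span B1" for f
      using B1(5) that by blast
    have "card {1..k} \<le> card {j \<in> I1. lam1 j \<in> ?M1}"
      using B1(3) k by (intro card_mono) auto
    then have cB1: "k \<le> card B1"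
      using B1(4) by simp
    let ?J = "{j \<in> I2. lam2 j \<le> 1 / m}"
    have J: "?J \<subseteq> {1..<k}"
      using count by (simp add: m_def)
    then have finJ: "finite ?J"
      by (rule finite_subset) simp
    let ?M2 = "lam2 ` ?J"
    obtain B2 where B2: "finite B2" "\<not> module.dependent sc B2"
      "card B2 = card {j \<in> I2. lam2 j \<in> ?M2}" "\<forall>b\<in>B2. \<exists>\<mu>\<in>?M2. p2.eig (complex_of_real \<mu>) b"
      "\<forall>\<mu>\<in>?M2. \<forall>u. p2.eig (complex_of_real \<mu>) u \<longrightarrow> u \<in> p1.t.span B2"
      using p2.eigenbasis[OF lists2, of ?M2] finJ by auto
    have "{j \<in> I2. lam2 j \<in> ?M2} = ?J"
      by auto
    moreover have "card ?J \<le> card {1..<k}"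
      using J by (intro card_mono) auto
    ultimately have cB2: "card B2 < k"
      using B2(3) k(1) by auto
    \<comment> \<open>An eigenvalue at most 1/m outside \<open>?M2\<close> carries no index of the
      list, so its eigenspace has dimension 0.\<close>
    have listed: "u \<in> p1.t.span B2" if "\<mu> \<le> 1 / m" "p2.eig (complex_of_real \<mu>) u" for \<mu> u
    proof (cases "\<mu> \<in> ?M2")
      case False
      let ?E = "{\<mu>}"
      obtain C where C: "finite C" "finite {j \<in> I2. lam2 j \<in> ?E}" "card C = card {j \<in> I2. lam2 j \<in> ?E}"
        "\<forall>\<mu>\<in>?E. \<forall>u. p2.eig (complex_of_real \<mu>) u \<longrightarrow> u \<in> p1.t.span C"
        using p2.eigenbasis[OF lists2, of ?E] by auto
      have "{j \<in> I2. lam2 j \<in> ?E} = {}"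
        using False that(1) by auto
      then have "C = {}"
        using C(1,3) by (metis card.empty card_0_eq)
      then have "u = 0"
        using C(4) that(2) by auto
      then show ?thesis
        by (simp add: p1.t.span_zero)
    qed (use B2(5) that in blast)
    have B2D: "B2 \<subseteq> D2"
      using B2(4) by (auto simp: p2.eig_def)
    have "\<exists>\<mu>. b \<noteq> 0 \<and> p2.eig (complex_of_real \<mu>) b" if "b \<in> B2" for b
      using that B2(2,4) p1.t.dependent_zero by blast
    then obtain s where s: "0 \<le> s" "s < m"
      "\<And>v. v \<in> D2 \<Longrightarrow> (\<And>b. b \<in> B2 \<Longrightarrow> t2 v b = 0) \<Longrightarrow> quad d2 v \<le> s * quad t2 v"
      using p2.gap_on_complement[OF B2(1) _ m0, of thesis] listed by blast
    \<comment> \<open>Linearity of U is not assumed but follows from isometry: the defect U (x + y)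
      - (U x + U y) has d2-norm 0.\<close>
    have Uadd: "d2 (U (x + y)) b = d2 (U x) b + d2 (U y) b" for x y b
    proof -
      have "quad d2 (U (x + y) - (U x + U y)) = 0"
        by (simp add: quad_def p2.d.diff_left p2.d.diff_right p2.d.add_left p2.d.add_right U
            p1.d.add_left p1.d.add_right)
      then have "U (x + y) = U x + U y"
        using p2.definite by fastforce
      then show ?thesis
        by (simp add: p2.d.add_left)
    qed
    have Uscale: "d2 (U (sc r x)) b = r * d2 (U x) b" for r x b
    proof -
      have "quad d2 (U (sc r x) - sc r (U x)) = 0"
        by (simp add: quad_def p2.d.diff_left p2.d.diff_right p2.d.scale_left p2.d.scale_right U
            p1.d.scale_left p1.d.scale_right)
      then have "U (sc r x) = sc r (U x)"
        using p2.definite by fastforce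
      then show ?thesis
        by (simp add: p2.d.scale_left)
    qed
    \<comment> \<open>At least k dimensions from the first problem against fewer than k
      orthogonality conditions from the second.\<close>
    obtain f where f: "f \<in> p1.t.span B1" "f \<noteq> 0" "\<forall>b\<in>B2. d2 (U f) b = 0"
      using p1.t.common_kernel_nontrivial[OF B2(1) B1(1,2), of "\<lambda>b x. d2 (U x) b"] cB1 cB2 Uadd Uscale
      by auto
    have fD: "f \<in> D1"
      using f B1D by blast
    obtain x where x: "x \<in> D1" "\<And>y. y \<in> D1 \<Longrightarrow> t1 x y = d1 f y"
      using p1.riesz_solution by blast
    have F: "quad d1 f > 0" "quad d2 (U f) = quad d1 f"
      using f(2) p1.quad_d_pos U by (auto simp: quad_def)
    \<comment> \<open>With t1 x f = d1[f], Cauchy-Schwarz in t1 and the Rayleigh bound t1[f] \<le>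
      lam1 k d1[f] bound the solution energy from below.\<close>
    have x_lower: "quad d1 f / lam1 k \<le> quad t1 x"
    proof -
      have "(cmod (t1 x f))\<^sup>2 \<le> quad t1 x * quad t1 f"
        using p1.t.cauchy_schwarz_sq x fD by blast
      also have "\<dots> \<le> quad t1 x * (lam1 k * quad d1 f)"
        using R1[OF f(1)] x by (intro mult_left_mono) auto
      finally have "quad d1 f * quad d1 f \<le> quad t1 x * lam1 k * quad d1 f"
        using x(2)[OF fD] F(1) by (simp add: p1.d.diag power2_eq_square)
      then show ?thesis
        using F(1) lam1 by (simp add: field_simps)
    qed
    obtain w where w: "w \<in> D2" "quad t1 x - \<delta> * quad d1 f \<le> 2 * Re (d2 (U f) w) - quad t2 w"
      using transfer x by blast
    have lower: "m * quad d1 f \<le> 2 * Re (d2 (U f) w) - quad t2 w"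
      using w(2) x_lower by (simp add: m_def algebra_simps)
    obtain p where p: "p \<in> p1.t.span B2" "\<forall>b\<in>B2. t2 (w - p) b = 0"
      using p2.t.finite_projection[OF B2(1) B2D w(1)] by blast
    \<comment> \<open>Removing the B2 part of the trial vector leaves the pairing with U f unchanged
      and can only decrease t2, so the trial vector may be taken in the complement where the gap
      holds.\<close>
    define v where "v = w - p"
    have pD: "p \<in> D2" "v \<in> D2"
      using p w p1.t.span_minimal[OF B2D p2.t.subspace_carrier] by (auto simp: v_def)
    have "d2 (U f) p = 0" "t2 v p = 0"
      using p2.d.vanish_on_span[OF _ _ _ p(1), of "U f"] f(3)
        p2.t.vanish_on_span[OF pD(2) B2D _ p(1)] p by (auto simp: v_def)
    moreover have "w = v + p"
      by (simp add: v_def)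
    ultimately have "Re (d2 (U f) w) = Re (d2 (U f) v)" "quad t2 w = quad t2 v + quad t2 p"
      using pD by (auto simp: p2.d.add_right p2.t.quad_add)
    then have lower': "m * quad d1 f \<le> 2 * Re (d2 (U f) v) - quad t2 v"
      using lower p2.t.quad_nonneg[OF pD(1)] by linarith
    \<comment> \<open>s may be 0, whereas the following Young inequality divides by its parameter;
      the midpoint is positive and still below m.\<close>
    define m' where "m' = (s + m) / 2"
    have m': "0 < m'" "s \<le> m'" "m' < m"
      using s m0 by (auto simp: m'_def)
    have "quad d2 v \<le> s * quad t2 v"
      using s(3) pD p by (auto simp: v_def)
    also have "\<dots> \<le> m' * quad t2 v"
      using m' pD by (intro mult_right_mono) auto
    finally have dv: "quad d2 v / m' \<le> quad t2 v"
      using m' by (simp add: field_simps)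
    have "0 \<le> quad d2 (sc (complex_of_real m') (U f) - v)"
      by simp
    also have "\<dots> = m'\<^sup>2 * quad d1 f + quad d2 v - 2 * (m' * Re (d2 (U f) v))"
      using F(2) by (simp add: p2.d.quad_diff p2.d.quad_scale p2.d.scale_left)
    finally have "2 * Re (d2 (U f) v) \<le> m' * quad d1 f + quad d2 v / m'"
      using m' by (simp add: field_simps power2_eq_square)
    then have "m * quad d1 f \<le> m' * quad d1 f"
      using lower' dv by linarith
    then show False
      using m' F(1) by simp
  qed
  have mono2: "mono_on I2 lam2"
    using lists2(1) by (simp add: lists_eigenvalues_def)
  show "1 / lam1 k - 1 / lam2 k \<le> \<delta>" if kI2: "k \<in> I2"
  proof (rule ccontr)
    assume "\<not> ?thesis"
    then have gt: "1 / lam2 k < 1 / lam1 k - \<delta>"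
      by simp
    have pos: "lam2 k > 0"
      using p2.listed_eigenvalue_pos[OF lists2 kI2] .
    then have "0 < 1 / lam2 k"
      by simp
    then have m: "0 < 1 / lam1 k - \<delta>"
      using gt by linarith
    have less: "1 / (1 / lam1 k - \<delta>) < lam2 k"
      using gt m pos by (simp add: divide_less_eq mult.commute)
    \<comment> \<open>The list is ascending and its k-th entry already exceeds the
      threshold.\<close>
    have "{j \<in> I2. lam2 j \<le> 1 / (1 / lam1 k - \<delta>)} \<subseteq> {1..<k}"
    proof safe
      fix j
      assume j: "j \<in> I2" "lam2 j \<le> 1 / (1 / lam1 k - \<delta>)"
      have "\<not> k \<le> j"
        using mono_onD[OF mono2 kI2 j(1)] j(2) less by linarith
      then show "j \<in> {1..<k}"
        using j(1) I2 by auto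
    qed
    then show False
      using contra m by blast
  qed
  show "1 / lam1 k \<le> \<delta>" if "I2 \<subseteq> {1..<k}"
  proof (rule ccontr)
    assume "\<not> ?thesis"
    then have "0 < 1 / lam1 k - \<delta>"
      by simp
    moreover have "{j \<in> I2. lam2 j \<le> 1 / (1 / lam1 k - \<delta>)} \<subseteq> {1..<k}"
      using that by auto
    ultimately show False
      using contra by blast
  qed
qed

section \<open>The corrector and the homogenised form\<close>

lemma cdot_scaleR: "cdot x (s *\<^sub>R \<theta>) = complex_of_real s * cdot x \<theta>"
  by (simp add: cdot_def sum_distrib_left mult_ac)

lemma cquad_eq_sum:
  "cquad A \<theta> = (\<Sum>i\<in>UNIV. \<Sum>j\<in>UNIV. A $ i $ j * complex_of_real (\<theta> $ j) * complex_of_real (\<theta> $ i))"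
  by (simp add: cquad_def cdot_def matrix_vector_mult_def sum_distrib_right)

lemma cquad_scaleR: "cquad A (s *\<^sub>R \<theta>) = complex_of_real (s\<^sup>2) * cquad A \<theta>"
  by (simp add: cquad_eq_sum sum_distrib_left power2_eq_square mult_ac)

lemma sesquilinear_on_cdot:
  assumes "\<forall>i. sesquilinear_on sc S T (\<lambda>v u. h v u $ i)"
  shows "sesquilinear_on sc S T (\<lambda>v u. cdot (h v u) \<theta>)"
  using assms unfolding sesquilinear_on_def cdot_def
  by (simp add: sum.distrib sum_distrib_left distrib_right mult.assoc)

lemma sesquilinear_on_cquad:
  assumes "\<forall>i j. sesquilinear_on sc S T (\<lambda>v u. h v u $ i $ j)"
  shows "sesquilinear_on sc S T (\<lambda>v u. cquad (h v u) \<theta>)"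
  using assms unfolding sesquilinear_on_def cquad_eq_sum
  by (simp add: sum.distrib sum_distrib_left distrib_right mult.assoc)

text \<open>Packages the limit s to 0 along s \<theta>, where the hypotheses are available only for
  s up to some s0.\<close>

lemma real_le_zero_of_linear_bound:
  fixes x C s0 :: real
  assumes "s0 > 0" "\<And>s. 0 < s \<Longrightarrow> s \<le> s0 \<Longrightarrow> x \<le> C * s"
  shows "x \<le> 0"
proof (rule ccontr)
  assume "\<not> x \<le> 0"
  define s where "s = min s0 (x / (2 * (\<bar>C\<bar> + 1)))"
  have s: "0 < s" "s \<le> s0" "s \<le> x / (2 * (\<bar>C\<bar> + 1))"
    using assms(1) \<open>\<not> x \<le> 0\<close> by (auto simp: s_def)
  have "x \<le> C * s"
    using assms(2) s by blast
  also have "\<dots> \<le> (\<bar>C\<bar> + 1) * s"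
    using s by (intro mult_right_mono) auto
  also have "\<dots> \<le> (\<bar>C\<bar> + 1) * (x / (2 * (\<bar>C\<bar> + 1)))"
    using s by (intro mult_left_mono) auto
  also have "\<dots> = x / 2"
    by (simp add: field_simps)
  finally show False
    using \<open>\<not> x \<le> 0\<close> by simp
qed

lemma le_of_sq_le_mult:
  fixes x y c :: real
  assumes "c > 0" "x \<ge> 0" "y \<ge> 0" "c * x\<^sup>2 \<le> y * x"
  shows "x \<le> y / c"
proof (cases "x = 0")
  case False
  then have "c * x \<le> y"
    using assms by (simp add: power2_eq_square flip: mult.assoc)
  then show ?thesis
    using assms by (simp add: field_simps)
qed (use assms in simp)

text \<open>One constant \<open>M\<close> serves as upper bound for all the Lipschitz-type constants, and \<open>\<rho>\<close> is
  the radius of a ball around the origin inside \<open>\<Theta>\<close>.\<close>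

locale degenerate_family = vector_space sc
  for sc :: "complex \<Rightarrow> 'a::ab_group_add \<Rightarrow> 'a" +
  fixes H Vs Z :: "'a set" and \<Theta> :: "(real^'n) set" and a b :: "real^'n \<Rightarrow> 'a form"
    and a' :: "'a \<Rightarrow> 'a \<Rightarrow> complex^'n" and a'' :: "'a \<Rightarrow> 'a \<Rightarrow> complex^'n^'n"
    and M \<nu> \<gamma> \<kappa> \<rho> :: real
  assumes M: "M \<ge> 1" and \<rho>: "\<rho> > 0" and \<nu>: "\<nu> > 0" and \<gamma>: "\<gamma> > 0" and \<kappa>: "0 \<le> \<kappa>" "\<kappa> < 1"
    and ball: "\<And>\<theta>. norm \<theta> \<le> \<rho> \<Longrightarrow> \<theta> \<in> \<Theta>"
    and bounded: "\<And>\<theta>. \<theta> \<in> \<Theta> \<Longrightarrow> norm \<theta> \<le> M"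
    and subspace_H: "subspace H"
    and nonneg_a: "\<And>\<theta>. \<theta> \<in> \<Theta> \<Longrightarrow> nonneg_form sc H (a \<theta>)"
    and nonneg_b: "\<And>\<theta>. \<theta> \<in> \<Theta> \<Longrightarrow> nonneg_form sc H (b \<theta>)"
    and definite_ab: "\<And>\<theta> u. \<theta> \<in> \<Theta> \<Longrightarrow> u \<in> H \<Longrightarrow> quad (ab a b \<theta>) u = 0 \<Longrightarrow> u = 0"
    and complete_ab: "\<And>\<theta>. \<theta> \<in> \<Theta> \<Longrightarrow> form_complete H (ab a b \<theta>)"
    and norm_comparable: "\<And>\<theta>1 \<theta>2 u. \<theta>1 \<in> \<Theta> \<Longrightarrow> \<theta>2 \<in> \<Theta> \<Longrightarrow> u \<in> H \<Longrightarrow>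
          form_norm (ab a b \<theta>1) u \<le> M * form_norm (ab a b \<theta>2) u"
    and a_lipschitz: "\<And>\<theta> u v. \<theta> \<in> \<Theta> \<Longrightarrow> u \<in> H \<Longrightarrow> v \<in> H \<Longrightarrow>
          cmod (a \<theta> u v - a 0 u v)
            \<le> M * norm \<theta> * form_norm (ab a b 0) u * form_norm (ab a b 0) v"
    and gap: "\<And>w. w \<in> Wsp H a b 0 \<Longrightarrow> \<nu> * (form_norm (ab a b 0) w)\<^sup>2 \<le> quad (a 0) w"
    and degeneracy: "\<And>\<theta> w. \<theta> \<in> \<Theta> \<Longrightarrow> w \<in> Wsp H a b \<theta> \<Longrightarrow>
          \<gamma> * (norm \<theta>)\<^sup>2 * (form_norm (ab a b \<theta>) w)\<^sup>2 \<le> quad (a \<theta>) w"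
    and Vstar_close: "\<And>\<theta>1 \<theta>2 v. \<theta>1 \<in> \<Theta> \<Longrightarrow> \<theta>2 \<in> \<Theta> \<Longrightarrow> v \<in> Vstar H a Vs \<theta>1 \<Longrightarrow>
          \<exists>w\<in>Vstar H a Vs \<theta>2.
            form_norm (ab a b \<theta>2) (v - w) \<le> M * norm (\<theta>1 - \<theta>2) * form_norm (ab a b \<theta>1) v"
    and subspace_Vs: "subspace Vs" and subspace_Z: "subspace Z"
    and V0_decomp: "Vsp H a 0 = direct_sum Vs Z" "Vs \<inter> Z = {0}"
    and angle: "\<And>v z. v \<in> Vs \<Longrightarrow> z \<in> Z \<Longrightarrow>
          cmod (ab a b 0 v z) \<le> \<kappa> * form_norm (ab a b 0) v * form_norm (ab a b 0) z"
    and a'_sesquilinear: "\<forall>i. sesquilinear_on sc (Vsp H a 0) H (\<lambda>v u. a' v u $ i)"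
    and a''_sesquilinear:
      "\<forall>i j. sesquilinear_on sc (Vsp H a 0) (Vsp H a 0) (\<lambda>v u. a'' v u $ i $ j)"
    and a'_expansion: "\<And>v u \<theta>. v \<in> Vsp H a 0 \<Longrightarrow> u \<in> H \<Longrightarrow> \<theta> \<in> \<Theta> \<Longrightarrow>
        cmod (a \<theta> v u - cdot (a' v u) \<theta>)
          \<le> M * (norm \<theta>)\<^sup>2 * form_norm (ab a b 0) v * form_norm (ab a b 0) u"
    and a''_expansion: "\<And>v u \<theta>. v \<in> Vsp H a 0 \<Longrightarrow> u \<in> Vsp H a 0 \<Longrightarrow> \<theta> \<in> \<Theta> \<Longrightarrow>
        cmod (a \<theta> v u - cquad (a'' v u) \<theta>)
          \<le> M * norm \<theta> ^ 3 * form_norm (ab a b 0) v * form_norm (ab a b 0) u"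
begin

abbreviation "V \<equiv> Vsp H a"
abbreviation "W \<equiv> Wsp H a b"
abbreviation "Vst \<equiv> Vstar H a Vs"
abbreviation "nrm \<theta> \<equiv> form_norm (ab a b \<theta>)"
abbreviation "N \<equiv> corrector H a b a'"
abbreviation "ah \<equiv> hom_form H a b a' a''"

lemma zero_in: "0 \<in> \<Theta>"
  using ball[of 0] \<rho> by simp

lemma form_a: "\<theta> \<in> \<Theta> \<Longrightarrow> sesq_form sc H (a \<theta>)"
  and form_b: "\<theta> \<in> \<Theta> \<Longrightarrow> sesq_form sc H (b \<theta>)"
  using nonneg_a nonneg_b subspace_H by (unfold_locales, auto)

lemma form_ab: "\<theta> \<in> \<Theta> \<Longrightarrow> sesq_form sc H (ab a b \<theta>)"
proof -
  assume \<theta>: "\<theta> \<in> \<Theta>"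
  interpret a: sesq_form sc H "a \<theta>" using form_a \<theta> .
  interpret b: sesq_form sc H "b \<theta>" using form_b \<theta> .
  show ?thesis
  proof
    show "nonneg_form sc H (ab a b \<theta>)"
      unfolding nonneg_form_def sesquilinear_on_def ab_def
    proof (intro conjI ballI allI)
      show "a \<theta> u u + b \<theta> u u \<in> \<real>\<^sub>\<ge>\<^sub>0" if "u \<in> H" for u
        using that by (simp add: a.diag b.diag complex_nonneg_Reals_iff)
    qed (auto simp: a.add_left a.add_right a.scale_left a.scale_right
          b.add_left b.add_right b.scale_left b.scale_right algebra_simps)
  qed (fact subspace_H)
qed

sublocale a0: sesq_form sc H "a 0" using form_a zero_in .
sublocale b0: sesq_form sc H "b 0" using form_b zero_in .
sublocale n0: sesq_form sc H "ab a b 0" using form_ab zero_in .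

lemma quad_ab: "quad (ab a b \<theta>) u = quad (a \<theta>) u + quad (b \<theta>) u"
  by (simp add: quad_def ab_def)

lemma form_norm_a_le: "\<theta> \<in> \<Theta> \<Longrightarrow> u \<in> H \<Longrightarrow> form_norm (a \<theta>) u \<le> nrm \<theta> u"
  and form_norm_b_le: "\<theta> \<in> \<Theta> \<Longrightarrow> u \<in> H \<Longrightarrow> form_norm (b \<theta>) u \<le> nrm \<theta> u"
  using sesq_form.quad_nonneg[OF form_a] sesq_form.quad_nonneg[OF form_b]
  by (auto simp: form_norm_def quad_ab)

lemma nrm_le: "\<theta> \<in> \<Theta> \<Longrightarrow> u \<in> H \<Longrightarrow> nrm \<theta> u \<le> M * nrm 0 u"
  and nrm_ge: "\<theta> \<in> \<Theta> \<Longrightarrow> u \<in> H \<Longrightarrow> nrm 0 u \<le> M * nrm \<theta> u"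
  using norm_comparable zero_in by auto

lemma V_subset: "V \<theta> \<subseteq> H"
  by (auto simp: Vsp_def)

lemma V_null:
  assumes "\<theta> \<in> \<Theta>" "v \<in> V \<theta>" "u \<in> H"
  shows "a \<theta> v u = 0" "a \<theta> u v = 0"
proof -
  have "v \<in> H" "quad (a \<theta>) v = 0"
    using assms by (auto simp: Vsp_def quad_def)
  then show "a \<theta> v u = 0" "a \<theta> u v = 0"
    using sesq_form.null_left[OF form_a] sesq_form.null_right[OF form_a] assms by blast+
qed

lemma V_iff: "\<theta> \<in> \<Theta> \<Longrightarrow> v \<in> V \<theta> \<longleftrightarrow> v \<in> H \<and> quad (a \<theta>) v = 0"
  using sesq_form.diag[OF form_a, of \<theta> v] by (auto simp: Vsp_def quad_def complex_eq_iff)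

text \<open>The zero set of the quadratic form is linear because the form is non-negative: by
  Cauchy-Schwarz it coincides with the radical.\<close>

lemma subspace_V: "\<theta> \<in> \<Theta> \<Longrightarrow> subspace (V \<theta>)"
proof -
  assume \<theta>: "\<theta> \<in> \<Theta>"
  interpret a: sesq_form sc H "a \<theta>" using form_a \<theta> .
  have "V \<theta> = {u \<in> H. \<forall>w\<in>H. a \<theta> u w = 0}"
    using V_null(1)[OF \<theta>] by (auto simp: Vsp_def)
  then show ?thesis
    using a.subspace_orthogonal_complement[of H] by simp
qed

lemma Vst_subset_V: "Vst \<theta> \<subseteq> V \<theta>"
proof -
  have "Vs \<subseteq> V 0"
    using V0_decomp(1) subspace_0[OF subspace_Z] by (force simp: direct_sum_def)
  then show ?thesis
    by (auto simp: Vstar_def)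
qed

lemma Vs_subset: "Vs \<subseteq> V 0"
  using Vst_subset_V[of 0] by (simp add: Vstar_def)

lemma Z_subset: "Z \<subseteq> V 0"
  using V0_decomp(1) subspace_0[OF subspace_Vs] by (force simp: direct_sum_def)

lemma Vs_H: "v \<in> Vs \<Longrightarrow> v \<in> H" and Z_H: "z \<in> Z \<Longrightarrow> z \<in> H" and V_H: "u \<in> V \<theta> \<Longrightarrow> u \<in> H"
  using Vs_subset Z_subset V_subset by blast+

lemma subspace_Vst: "\<theta> \<in> \<Theta> \<Longrightarrow> subspace (Vst \<theta>)"
  using subspace_V subspace_Vs by (simp add: Vstar_def)

lemma complete_V:
  assumes \<theta>: "\<theta> \<in> \<Theta>"
  shows "form_complete (V \<theta>) (ab a b \<theta>)"
  unfolding form_complete_def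
proof (intro allI impI)
  interpret a: sesq_form sc H "a \<theta>" using form_a \<theta> .
  interpret n: sesq_form sc H "ab a b \<theta>" using form_ab \<theta> .
  fix x
  assume x: "(\<forall>n. x n \<in> V \<theta>) \<and> form_Cauchy (ab a b \<theta>) x"
  then have xH: "x n \<in> H" for n
    using V_H by blast
  obtain l where l: "l \<in> H" "(\<lambda>n. nrm \<theta> (x n - l)) \<longlonglongrightarrow> 0"
    using form_completeE[OF complete_ab[OF \<theta>], of x] xH x by blast
  have "(\<lambda>n. form_norm (a \<theta>) (x n - l)) \<longlonglongrightarrow> 0"
  proof (rule tendsto_0_le[OF l(2), of _ 1], intro always_eventually allI)
    show "norm (form_norm (a \<theta>) (x n - l)) \<le> norm (nrm \<theta> (x n - l)) * 1" for n
      using form_norm_a_le[OF \<theta>, of "x n - l"] xH[of n] l(1) by simp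
  qed
  then have "(\<lambda>n. quad (a \<theta>) (x n)) \<longlonglongrightarrow> quad (a \<theta>) l"
    using a.tendsto_quad xH l(1) by blast
  moreover have "quad (a \<theta>) (x n) = 0" for n
    using x V_iff[OF \<theta>] by blast
  ultimately have "l \<in> V \<theta>"
    using V_iff[OF \<theta>] l(1) by (simp add: LIMSEQ_const_iff)
  then show "\<exists>l\<in>V \<theta>. (\<lambda>n. nrm \<theta> (x n - l)) \<longlonglongrightarrow> 0"
    using l by blast
qed

lemma V_W_decomposition:
  assumes "\<theta> \<in> \<Theta>" "u \<in> H"
  obtains p q where "p \<in> V \<theta>" "q \<in> W \<theta>" "u = p + q"
proof -
  interpret n: sesq_form sc H "ab a b \<theta>" using form_ab assms(1) .
  obtain p where p: "p \<in> V \<theta>" "\<And>v. v \<in> V \<theta> \<Longrightarrow> ab a b \<theta> (u - p) v = 0"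
    using n.orthogonal_decomposition[OF subspace_V V_subset complete_V] assms by blast
  then have "u - p \<in> W \<theta>"
    using assms V_H by (auto simp: Wsp_def)
  then show ?thesis
    using that[of p "u - p"] p by simp
qed

lemma W_H: "w \<in> W \<theta> \<Longrightarrow> w \<in> H"
  by (simp add: Wsp_def)

lemma subspace_W: "\<theta> \<in> \<Theta> \<Longrightarrow> subspace (W \<theta>)"
  unfolding Wsp_def using sesq_form.subspace_orthogonal_complement[OF form_ab V_subset] .

lemma form_a0_W0: "sesq_form sc (W 0) (a 0)"
  using a0.restrict subspace_W[OF zero_in] W_H by blast

lemma W0_norm_le:
  assumes "u \<in> W 0"
  shows "nrm 0 u \<le> (1 / sqrt \<nu>) * form_norm (a 0) u"
proof -
  have "sqrt \<nu> * nrm 0 u \<le> form_norm (a 0) u"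
    unfolding form_norm_def[of "a 0"] using gap[OF assms] \<nu> W_H[OF assms]
    by (intro real_le_rsqrt) (simp add: power_mult_distrib)
  then show ?thesis
    using \<nu> by (simp add: field_simps)
qed

text \<open>On W 0 the spectral gap makes the \<open>a 0\<close>-norm equivalent to the full norm,
  so that the equation for the corrector can be solved by Riesz representation in
  \<open>a 0\<close>.\<close>

lemma complete_W0: "form_complete (W 0) (a 0)"
proof (rule form_complete_equivalent)
  show "form_complete (W 0) (ab a b 0)"
    unfolding Wsp_def
    using n0.form_complete_orthogonal_complement[OF complete_ab[OF zero_in] V_subset] .
  show "nrm 0 u \<le> (1 / sqrt \<nu>) * form_norm (a 0) u" if "u \<in> W 0" for u
    using W0_norm_le[OF that] .
  show "form_norm (a 0) u \<le> 1 * nrm 0 u" if "u \<in> W 0" for u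
    using form_norm_a_le[OF zero_in] W_H that by auto
qed (use \<nu> form_a0_W0 in auto)

lemma form_a': "sesquilinear_on sc (V 0) H (\<lambda>v u. cdot (a' v u) \<theta>)"
  using sesquilinear_on_cdot a'_sesquilinear .

text \<open>Boundedness of a' is derived, not assumed: \<open>a 0\<close> vanishes on V 0, so the
  Lipschitz condition makes a_\<theta>(v, u) of first order, and the expansion error is of second
  order with one factor |\<theta>| bounded by M.\<close>

lemma a'_bound_local:
  assumes v: "v \<in> V 0" and u: "u \<in> H" and \<theta>: "\<theta> \<in> \<Theta>"
  shows "cmod (cdot (a' v u) \<theta>) \<le> (M\<^sup>2 + M) * norm \<theta> * nrm 0 v * nrm 0 u"
proof -
  have vH: "v \<in> H"
    using v V_H by blast
  have n: "0 \<le> nrm 0 v * nrm 0 u"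
    using vH u by simp
  have "a 0 v u = 0"
    using V_null(1)[OF zero_in v u] .
  then have "cmod (a \<theta> v u) \<le> M * norm \<theta> * (nrm 0 v * nrm 0 u)"
    using a_lipschitz[OF \<theta> vH u] by (simp add: mult.assoc)
  moreover have "cmod (a \<theta> v u - cdot (a' v u) \<theta>) \<le> M * (norm \<theta>)\<^sup>2 * (nrm 0 v * nrm 0 u)"
    using a'_expansion[OF v u \<theta>] by (simp add: mult.assoc)
  moreover have "M * (norm \<theta>)\<^sup>2 * (nrm 0 v * nrm 0 u) \<le> M\<^sup>2 * norm \<theta> * (nrm 0 v * nrm 0 u)"
    using bounded[OF \<theta>] M n
    by (intro mult_right_mono) (auto simp: power2_eq_square mult_right_mono)
  moreover have "cmod (cdot (a' v u) \<theta>) \<le> cmod (a \<theta> v u) + cmod (a \<theta> v u - cdot (a' v u) \<theta>)"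
    by (metis norm_minus_commute norm_triangle_sub)
  ultimately show ?thesis
    by (simp add: algebra_simps)
qed

lemma radius_pos: "\<rho> / (norm (\<theta> :: real^'n) + 1) > 0"
  using \<rho> by (simp add: add_nonneg_pos)

text \<open>Every vector has a positive multiple in \<Theta>; the added 1 keeps the radius defined
  at \<theta> = 0.\<close>

lemma scale_into_domain:
  fixes \<theta> :: "real^'n"
  assumes "0 < s" "s \<le> \<rho> / (norm \<theta> + 1)"
  shows "s *\<^sub>R \<theta> \<in> \<Theta>"
proof (rule ball)
  have pos: "norm \<theta> + 1 > 0"
    by (simp add: add_nonneg_pos)
  have "norm (s *\<^sub>R \<theta>) \<le> s * (norm \<theta> + 1)"
    using assms(1) by simp
  also have "\<dots> \<le> \<rho>"
    using assms(2) pos by (simp add: pos_le_divide_eq)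
  finally show "norm (s *\<^sub>R \<theta>) \<le> \<rho>" .
qed

lemma a'_bound:
  assumes v: "v \<in> V 0" and u: "u \<in> H"
  shows "cmod (cdot (a' v u) \<theta>) \<le> (M\<^sup>2 + M) * norm \<theta> * nrm 0 v * nrm 0 u"
proof -
  define s where "s = \<rho> / (norm \<theta> + 1)"
  have s: "s > 0" "s *\<^sub>R \<theta> \<in> \<Theta>"
    unfolding s_def using radius_pos scale_into_domain[of "\<rho> / (norm \<theta> + 1)" \<theta>] by auto
  have "s * cmod (cdot (a' v u) \<theta>) \<le> s * ((M\<^sup>2 + M) * norm \<theta> * nrm 0 v * nrm 0 u)"
    using a'_bound_local[OF v u s(2)] s(1) by (simp add: cdot_scaleR norm_mult mult_ac)
  then show ?thesis
    using s(1) by simp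
qed

text \<open>On V 0 x V 0 the form a_\<theta> has both a first-order and a second-order expansion. At
  s \<theta> the first-order term must be of order s^2; dividing by s and letting s tend to 0
  removes it.\<close>

lemma a'_vanishes:
  assumes v: "v \<in> V 0" "w \<in> V 0"
  shows "cdot (a' v w) \<theta> = 0"
proof -
  define s0 where "s0 = min 1 (\<rho> / (norm \<theta> + 1))"
  have s0: "s0 > 0" "s0 \<le> 1" "s0 \<le> \<rho> / (norm \<theta> + 1)"
    unfolding s0_def using radius_pos[of \<theta>] by auto
  define P where "P = nrm 0 v * nrm 0 w"
  have P: "P \<ge> 0"
    using v V_H by (simp add: P_def)
  have "cmod (cdot (a' v w) \<theta>)
      \<le> (cmod (cquad (a'' v w) \<theta>) + M * (norm \<theta>)\<^sup>2 * P + M * norm \<theta> ^ 3 * P) * s"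
    if s: "0 < s" "s \<le> s0" for s
  proof -
    have in_dom: "s *\<^sub>R \<theta> \<in> \<Theta>"
      using scale_into_domain s s0 by simp
    have "cmod (a (s *\<^sub>R \<theta>) v w - cdot (a' v w) (s *\<^sub>R \<theta>)) \<le> M * (norm (s *\<^sub>R \<theta>))\<^sup>2 * P"
      using a'_expansion[OF v(1) _ in_dom, of w] v V_H by (simp add: P_def mult.assoc)
    moreover have "cmod (a (s *\<^sub>R \<theta>) v w - cquad (a'' v w) (s *\<^sub>R \<theta>)) \<le> M * norm (s *\<^sub>R \<theta>) ^ 3 * P"
      using a''_expansion[OF v in_dom] by (simp add: P_def mult.assoc)
    moreover have "cmod (cdot (a' v w) (s *\<^sub>R \<theta>)) \<le> cmod (cquad (a'' v w) (s *\<^sub>R \<theta>)) +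
      cmod (a (s *\<^sub>R \<theta>) v w - cdot (a' v w) (s *\<^sub>R \<theta>)) +
      cmod (a (s *\<^sub>R \<theta>) v w - cquad (a'' v w) (s *\<^sub>R \<theta>))"
      using norm_triangle_ineq4[of "a (s *\<^sub>R \<theta>) v w - cquad (a'' v w) (s *\<^sub>R \<theta>)"
          "a (s *\<^sub>R \<theta>) v w - cdot (a' v w) (s *\<^sub>R \<theta>)"]
        norm_triangle_ineq[of "cquad (a'' v w) (s *\<^sub>R \<theta>)"
          "cdot (a' v w) (s *\<^sub>R \<theta>) - cquad (a'' v w) (s *\<^sub>R \<theta>)"]
      by simp
    ultimately have "cmod (cdot (a' v w) (s *\<^sub>R \<theta>)) \<le> cmod (cquad (a'' v w) (s *\<^sub>R \<theta>)) +
        M * (norm (s *\<^sub>R \<theta>))\<^sup>2 * P + M * norm (s *\<^sub>R \<theta>) ^ 3 * P"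
      by linarith
    also have "\<dots> = s\<^sup>2 * (cmod (cquad (a'' v w) \<theta>) + M * (norm \<theta>)\<^sup>2 * P + s * (M * norm \<theta> ^ 3 * P))"
      using s by (simp add: cquad_scaleR norm_mult power_mult_distrib norm_power
          algebra_simps power2_eq_square power3_eq_cube)
    also have "\<dots> \<le> s\<^sup>2 * (cmod (cquad (a'' v w) \<theta>) + M * (norm \<theta>)\<^sup>2 * P + 1 * (M * norm \<theta> ^ 3 * P))"
      using s s0 M P by (intro mult_left_mono add_mono mult_right_mono) auto
    finally have "s * cmod (cdot (a' v w) \<theta>)
      \<le> s * ((cmod (cquad (a'' v w) \<theta>) + M * (norm \<theta>)\<^sup>2 * P + M * norm \<theta> ^ 3 * P) * s)"
      using s by (simp add: cdot_scaleR norm_mult power2_eq_square mult_ac)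
    then show ?thesis
      using s by simp
  qed
  then have "cmod (cdot (a' v w) \<theta>) \<le> 0"
    by (rule real_le_zero_of_linear_bound[OF s0(1)])
  then show ?thesis
    by simp
qed

lemma corrector_unique:
  assumes "w1 \<in> W 0" "w2 \<in> W 0" "\<And>w. w \<in> W 0 \<Longrightarrow> a 0 w1 w = a 0 w2 w"
  shows "w1 = w2"
proof -
  have w: "w1 - w2 \<in> W 0"
    using subspace_diff[OF subspace_W[OF zero_in]] assms by blast
  then have "a 0 (w1 - w2) (w1 - w2) = 0"
    using assms W_H by (simp add: a0.diff_left)
  then have "\<nu> * (nrm 0 (w1 - w2))\<^sup>2 \<le> 0"
    using gap[OF w] by (simp add: quad_def)
  then have "quad (ab a b 0) (w1 - w2) = 0"
    using \<nu> W_H[OF w] n0.form_norm_sq[OF W_H[OF w]] n0.quad_nonneg[OF W_H[OF w]]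
    by (simp add: mult_le_0_iff)
  then show ?thesis
    using definite_ab[OF zero_in W_H[OF w]] by simp
qed

text \<open>Justifies the definite description in \<open>corrector\<close>: Riesz representation on
  W 0 gives existence, the spectral gap gives uniqueness.\<close>

lemma corrector_ex1:
  assumes v: "v \<in> V 0"
  shows "\<exists>!w. w \<in> W 0 \<and> (\<forall>w0\<in>W 0. a 0 w w0 = - cdot (a' v w0) \<theta>)"
proof -
  interpret w: sesq_form sc "W 0" "a 0" by (rule form_a0_W0)
  obtain w where "w \<in> W 0" "\<And>u. u \<in> W 0 \<Longrightarrow> a 0 w u = - cdot (a' v u) \<theta>"
  proof (rule w.riesz_representation[OF complete_W0, of "\<lambda>u. - cdot (a' v u) \<theta>"
        "(M\<^sup>2 + M) * norm \<theta> * nrm 0 v * (1 / sqrt \<nu>)"])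
    show "- cdot (a' v (x + y)) \<theta> = - cdot (a' v x) \<theta> + - cdot (a' v y) \<theta>"
      if "x \<in> W 0" "y \<in> W 0" for x y
      using form_a'[of \<theta>] v W_H that by (auto simp: sesquilinear_on_def)
    show "- cdot (a' v (sc c x)) \<theta> = cnj c * - cdot (a' v x) \<theta>" if "x \<in> W 0" for c x
      using form_a'[of \<theta>] v W_H that by (auto simp: sesquilinear_on_def)
    show "cmod (- cdot (a' v u) \<theta>)
        \<le> (M\<^sup>2 + M) * norm \<theta> * nrm 0 v * (1 / sqrt \<nu>) * form_norm (a 0) u" if "u \<in> W 0" for u
    proof -
      have "cmod (- cdot (a' v u) \<theta>) \<le> (M\<^sup>2 + M) * norm \<theta> * nrm 0 v * nrm 0 u"
        using a'_bound[OF v W_H[OF that]] by simp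
      also have "\<dots> \<le> (M\<^sup>2 + M) * norm \<theta> * nrm 0 v * ((1 / sqrt \<nu>) * form_norm (a 0) u)"
        using W0_norm_le[OF that] M V_H[OF v] by (intro mult_left_mono) auto
      finally show ?thesis
        by (simp add: mult.assoc)
    qed
  qed (use that in blast)
  then show ?thesis
    using corrector_unique by (intro ex1I[of _ w]) auto
qed

lemma corrector_W: "v \<in> V 0 \<Longrightarrow> N \<theta> v \<in> W 0"
  and corrector_eq_W: "v \<in> V 0 \<Longrightarrow> w \<in> W 0 \<Longrightarrow> a 0 (N \<theta> v) w = - cdot (a' v w) \<theta>"
  using theI'[OF corrector_ex1, of v \<theta>] unfolding corrector_def by blast+

lemma corrector_H: "v \<in> V 0 \<Longrightarrow> N \<theta> v \<in> H"
  using corrector_W W_H by blast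

text \<open>The test space enlarges from \<open>W 0\<close> to \<open>H\<close> because \<open>a'\<close> vanishes on \<open>V 0\<close>.\<close>

lemma corrector_eq:
  assumes "v \<in> V 0" "u \<in> H"
  shows "a 0 (N \<theta> v) u = - cdot (a' v u) \<theta>"
proof -
  obtain p q where pq: "p \<in> V 0" "q \<in> W 0" "u = p + q"
    using V_W_decomposition[OF zero_in assms(2)] .
  have H: "p \<in> H" "q \<in> H"
    using pq V_H W_H by auto
  have "a 0 (N \<theta> v) u = a 0 (N \<theta> v) q"
    using V_null(2)[OF zero_in pq(1)] corrector_H[OF assms(1)] H pq(3) by (simp add: a0.add_right)
  moreover have "cdot (a' v u) \<theta> = cdot (a' v q) \<theta>"
    using form_a'[of \<theta>] a'_vanishes[OF assms(1) pq(1)] H pq(3) assms(1)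
    by (simp add: sesquilinear_on_def)
  ultimately show ?thesis
    using corrector_eq_W[OF assms(1) pq(2)] by simp
qed

lemma correctorI:
  assumes "v \<in> V 0" "w \<in> W 0" "\<And>w0. w0 \<in> W 0 \<Longrightarrow> a 0 w w0 = - cdot (a' v w0) \<theta>"
  shows "N \<theta> v = w"
  using corrector_unique[OF corrector_W[OF assms(1)] assms(2)] corrector_eq_W[OF assms(1)] assms(3)
  by simp

lemma corrector_add:
  assumes "v \<in> V 0" "w \<in> V 0"
  shows "N \<theta> (v + w) = N \<theta> v + N \<theta> w"
proof (rule correctorI)
  show "v + w \<in> V 0" "N \<theta> v + N \<theta> w \<in> W 0"
    using assms subspace_add subspace_V subspace_W zero_in corrector_W by blast+
  show "a 0 (N \<theta> v + N \<theta> w) w0 = - cdot (a' (v + w) w0) \<theta>" if "w0 \<in> W 0" for w0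
    using form_a'[of \<theta>] assms that W_H corrector_H
    by (simp add: a0.add_left corrector_eq sesquilinear_on_def)
qed

lemma corrector_scale:
  assumes "v \<in> V 0"
  shows "N \<theta> (sc c v) = sc c (N \<theta> v)"
proof (rule correctorI)
  show "sc c v \<in> V 0" "sc c (N \<theta> v) \<in> W 0"
    using assms subspace_scale subspace_V subspace_W zero_in corrector_W by blast+
  show "a 0 (sc c (N \<theta> v)) w0 = - cdot (a' (sc c v) w0) \<theta>" if "w0 \<in> W 0" for w0
    using form_a'[of \<theta>] assms that W_H corrector_H
    by (simp add: a0.scale_left corrector_eq sesquilinear_on_def)
qed

lemma corrector_scaleR:
  assumes "v \<in> V 0"
  shows "N (s *\<^sub>R \<theta>) v = sc (complex_of_real s) (N \<theta> v)"
proof (rule correctorI[OF assms])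
  show "sc (complex_of_real s) (N \<theta> v) \<in> W 0"
    using assms subspace_scale subspace_W zero_in corrector_W by blast
  show "a 0 (sc (complex_of_real s) (N \<theta> v)) w0 = - cdot (a' v w0) (s *\<^sub>R \<theta>)" if "w0 \<in> W 0" for w0
    using assms that W_H corrector_H by (simp add: a0.scale_left corrector_eq cdot_scaleR)
qed

text \<open>The corrector equation is tested with the corrector itself, and the gap absorbs one
  factor.\<close>

lemma corrector_bound:
  assumes "v \<in> V 0"
  shows "nrm 0 (N \<theta> v) \<le> (M\<^sup>2 + M) / \<nu> * norm \<theta> * nrm 0 v"
proof -
  have H: "v \<in> H" "N \<theta> v \<in> H"
    using assms V_H corrector_H by auto
  have "\<nu> * (nrm 0 (N \<theta> v))\<^sup>2 \<le> quad (a 0) (N \<theta> v)"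
    using gap corrector_W assms by blast
  also have "\<dots> \<le> cmod (a 0 (N \<theta> v) (N \<theta> v))"
    unfolding quad_def using complex_Re_le_cmod .
  also have "\<dots> \<le> (M\<^sup>2 + M) * norm \<theta> * nrm 0 v * nrm 0 (N \<theta> v)"
    using corrector_eq[OF assms H(2)] a'_bound[OF assms H(2)] by simp
  finally show ?thesis
    using le_of_sq_le_mult[OF \<nu>, of "nrm 0 (N \<theta> v)" "(M\<^sup>2 + M) * norm \<theta> * nrm 0 v"] H M by simp
qed

definition K1 :: real where "K1 = (M\<^sup>2 + M) / \<nu>"

lemma K1_nonneg: "0 \<le> K1"
  using M \<nu> by (simp add: K1_def)

text \<open>The first-order terms cancel: a_\<theta>(z, u) is close to a' \<theta>, which equals -
  a_0(N z, u), and a_\<theta>(N z, u) is close to a_0(N z, u). Since N z is itself O(|\<theta>|),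
  both errors are quadratic.\<close>

lemma corrected_residual:
  assumes "z \<in> V 0" "u \<in> H" "\<theta> \<in> \<Theta>"
  shows "cmod (a \<theta> (z + N \<theta> z) u) \<le> (M + M * K1) * (norm \<theta>)\<^sup>2 * nrm 0 z * nrm 0 u"
proof -
  interpret a: sesq_form sc H "a \<theta>" using form_a assms(3) .
  have H: "z \<in> H" "N \<theta> z \<in> H"
    using assms V_H corrector_H by auto
  have "a \<theta> (z + N \<theta> z) u = (a \<theta> z u - cdot (a' z u) \<theta>) + (a \<theta> (N \<theta> z) u - a 0 (N \<theta> z) u)"
    using H assms by (simp add: a.add_left corrector_eq)
  then have "cmod (a \<theta> (z + N \<theta> z) u)
      \<le> cmod (a \<theta> z u - cdot (a' z u) \<theta>) + cmod (a \<theta> (N \<theta> z) u - a 0 (N \<theta> z) u)"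
    using norm_triangle_ineq by metis
  also have "\<dots> \<le> M * (norm \<theta>)\<^sup>2 * nrm 0 z * nrm 0 u + M * norm \<theta> * nrm 0 (N \<theta> z) * nrm 0 u"
    using a'_expansion assms a_lipschitz H by (intro add_mono) auto
  also have "M * norm \<theta> * nrm 0 (N \<theta> z) * nrm 0 u
      \<le> M * norm \<theta> * (K1 * norm \<theta> * nrm 0 z) * nrm 0 u"
    using corrector_bound[OF assms(1), of \<theta>] M assms
    by (intro mult_right_mono mult_left_mono) (auto simp: K1_def)
  finally show ?thesis
    by (simp add: algebra_simps power2_eq_square)
qed

definition K2 :: real where "K2 = (M + M * K1) * K1 + 2 * M + M * K1"

lemma K2_nonneg: "0 \<le> K2"
  using M K1_nonneg by (simp add: K2_def)

text \<open>The energy is one order more accurate than the residual, because the residual enters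
  only tested against the corrector, which supplies another factor |\<theta>|.\<close>

lemma corrected_energy:
  assumes "z \<in> V 0" "\<theta> \<in> \<Theta>"
  shows "cmod (a \<theta> (z + N \<theta> z) (z + N \<theta> z) - ah \<theta> z z) \<le> K2 * norm \<theta> ^ 3 * (nrm 0 z)\<^sup>2"
proof -
  interpret a: sesq_form sc H "a \<theta>" using form_a assms(2) .
  have H: "z \<in> H" "N \<theta> z \<in> H"
    using assms V_H corrector_H by auto
  let ?t = "norm \<theta>" and ?n = "nrm 0 z"
  let ?e1 = "a \<theta> z z - cquad (a'' z z) \<theta>"
    and ?e2 = "a \<theta> z (N \<theta> z) - cdot (a' z (N \<theta> z)) \<theta>"
    and ?e3 = "a \<theta> (z + N \<theta> z) (N \<theta> z)"
  have Nn: "nrm 0 (N \<theta> z) \<le> K1 * ?t * ?n"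
    using corrector_bound[OF assms(1)] by (simp add: K1_def)
  have "cdot (a' z (N \<theta> z)) \<theta> = - a 0 (N \<theta> z) (N \<theta> z)"
    using corrector_eq[OF assms(1) H(2)] by simp
  \<comment> \<open>By the corrector equation, the remaining cross term together with the corrector
    energy from \<open>hom_form\<close> is the conjugate of an expansion error.\<close>
  then have "cnj ?e2 = a \<theta> (N \<theta> z) z + a 0 (N \<theta> z) (N \<theta> z)"
    using a.hermitian[OF H] a0.hermitian[OF H(2) H(2)] by simp
  then have "a \<theta> (z + N \<theta> z) (z + N \<theta> z) - ah \<theta> z z = ?e1 + cnj ?e2 + ?e3"
    using H by (simp add: hom_form_def a.add_left a.add_right)
  then have "cmod (a \<theta> (z + N \<theta> z) (z + N \<theta> z) - ah \<theta> z z) \<le> cmod ?e1 + cmod ?e2 + cmod ?e3"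
    using norm_triangle_ineq[of "?e1 + cnj ?e2" ?e3] norm_triangle_ineq[of ?e1 "cnj ?e2"]
      complex_mod_cnj[of ?e2] by (simp only:)
  moreover have "cmod ?e1 \<le> M * ?t ^ 3 * ?n * ?n"
    using a''_expansion assms by blast
  moreover have "cmod ?e2 \<le> M * ?t\<^sup>2 * ?n * nrm 0 (N \<theta> z)"
    using a'_expansion assms H by blast
  moreover have "M * ?t\<^sup>2 * ?n * nrm 0 (N \<theta> z) \<le> M * ?t\<^sup>2 * ?n * (K1 * ?t * ?n)"
    using Nn M H by (intro mult_left_mono) auto
  moreover have "cmod ?e3 \<le> (M + M * K1) * ?t\<^sup>2 * ?n * nrm 0 (N \<theta> z)"
    using corrected_residual assms H by blast
  moreover have "(M + M * K1) * ?t\<^sup>2 * ?n * nrm 0 (N \<theta> z) \<le> (M + M * K1) * ?t\<^sup>2 * ?n * (K1 * ?t * ?n)"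
    using Nn M H K1_nonneg by (intro mult_left_mono) auto
  ultimately have "cmod (a \<theta> (z + N \<theta> z) (z + N \<theta> z) - ah \<theta> z z)
    \<le> M * ?t ^ 3 * ?n * ?n + M * ?t\<^sup>2 * ?n * (K1 * ?t * ?n) + (M + M * K1) * ?t\<^sup>2 * ?n * (K1 * ?t * ?n)"
    by linarith
  also have "\<dots> = (M + M * K1 + (M + M * K1) * K1) * ?t ^ 3 * ?n\<^sup>2"
    by (simp add: algebra_simps power2_eq_square power3_eq_cube)
  also have "\<dots> \<le> K2 * ?t ^ 3 * ?n\<^sup>2"
    using M unfolding K2_def by (intro mult_right_mono) auto
  finally show ?thesis .
qed

lemma hom_form_scaleR:
  assumes "v \<in> V 0" "w \<in> V 0"
  shows "ah (s *\<^sub>R \<theta>) v w = complex_of_real (s\<^sup>2) * ah \<theta> v w"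
  using assms corrector_H
  by (simp add: hom_form_def cquad_scaleR corrector_scaleR a0.scale_left a0.scale_right
      algebra_simps power2_eq_square)

lemma sesquilinear_hom_form: "sesquilinear_on sc (V 0) (V 0) (ah \<theta>)"
proof -
  have "sesquilinear_on sc (V 0) (V 0) (\<lambda>v u. cquad (a'' v u) \<theta>)"
    using sesquilinear_on_cquad a''_sesquilinear .
  then show ?thesis
    using corrector_H
    by (simp add: sesquilinear_on_def hom_form_def corrector_add corrector_scale
        a0.add_left a0.add_right a0.scale_left a0.scale_right algebra_simps)
qed

text \<open>Reality and sign are inherited from \<open>a\<close>: at s \<theta> the non-negative
  energy of the corrected vector equals s^2 times the homogenised one up to O(s^3), and s tends to
  0.\<close>

lemma hom_form_nonneg:
  assumes v: "v \<in> V 0"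
  shows "ah \<theta> v v \<in> \<real>\<^sub>\<ge>\<^sub>0"
proof -
  define s0 where "s0 = \<rho> / (norm \<theta> + 1)"
  have s0: "s0 > 0"
    unfolding s0_def using radius_pos .
  define C where "C = K2 * norm \<theta> ^ 3 * (nrm 0 v)\<^sup>2"
  have *: "\<bar>Im (ah \<theta> v v)\<bar> \<le> C * s" "- Re (ah \<theta> v v) \<le> C * s" if s: "0 < s" "s \<le> s0" for s
  proof -
    have in_dom: "s *\<^sub>R \<theta> \<in> \<Theta>"
      using scale_into_domain s unfolding s0_def by simp
    define y where "y = v + N (s *\<^sub>R \<theta>) v"
    have y: "y \<in> H"
      using v V_H corrector_H by (simp add: y_def)
    interpret a: sesq_form sc H "a (s *\<^sub>R \<theta>)" using form_a in_dom .
    let ?e = "a (s *\<^sub>R \<theta>) y y - complex_of_real (s\<^sup>2) * ah \<theta> v v"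
    have "cmod ?e \<le> K2 * norm (s *\<^sub>R \<theta>) ^ 3 * (nrm 0 v)\<^sup>2"
      using corrected_energy[OF v in_dom] by (simp add: y_def hom_form_scaleR[OF v v])
    also have "\<dots> = s\<^sup>2 * (C * s)"
      using s by (simp add: C_def power_mult_distrib power2_eq_square power3_eq_cube)
    finally have e: "cmod ?e \<le> s\<^sup>2 * (C * s)" .
    have "\<bar>Im ?e\<bar> = s\<^sup>2 * \<bar>Im (ah \<theta> v v)\<bar>"
      using y by (simp add: a.diag abs_mult)
    then have "s\<^sup>2 * \<bar>Im (ah \<theta> v v)\<bar> \<le> s\<^sup>2 * (C * s)"
      using e abs_Im_le_cmod[of ?e] by linarith
    then show "\<bar>Im (ah \<theta> v v)\<bar> \<le> C * s"
      using s by simp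
    have "Re ?e = quad (a (s *\<^sub>R \<theta>)) y - s\<^sup>2 * Re (ah \<theta> v v)"
      using y by (simp add: a.diag)
    then have "s\<^sup>2 * - Re (ah \<theta> v v) \<le> s\<^sup>2 * (C * s)"
      using e complex_Re_le_cmod[of ?e] a.quad_nonneg[OF y] by simp
    then show "- Re (ah \<theta> v v) \<le> C * s"
      using s by (simp only: mult_le_cancel_left_pos zero_less_power)
  qed
  have "\<bar>Im (ah \<theta> v v)\<bar> \<le> 0" "- Re (ah \<theta> v v) \<le> 0"
    using real_le_zero_of_linear_bound[OF s0] * by blast+
  then show ?thesis
    by (simp add: complex_nonneg_Reals_iff)
qed

lemma form_hom: "sesq_form sc (V 0) (ah \<theta>)"
  using subspace_V[OF zero_in] sesquilinear_hom_form hom_form_nonneg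
  by unfold_locales (auto simp: nonneg_form_def)

section \<open>Separation of Vs and Z, and coercivity on Z\<close>

lemma angle_bounds:
  assumes "v \<in> Vs" "z \<in> Z"
  shows "(1 - \<kappa>) * ((nrm 0 v)\<^sup>2 + (nrm 0 z)\<^sup>2) \<le> (nrm 0 (v + z))\<^sup>2"
proof -
  have H: "v \<in> H" "z \<in> H"
    using assms Vs_H Z_H by auto
  have "cmod (ab a b 0 v z) \<le> \<kappa> * (nrm 0 v * nrm 0 z)"
    using angle[OF assms] by (simp add: mult.assoc)
  then have "- (\<kappa> * (nrm 0 v * nrm 0 z)) \<le> Re (ab a b 0 v z)"
    using abs_Re_le_cmod[of "ab a b 0 v z"] by linarith
  moreover have "2 * (nrm 0 v * nrm 0 z) \<le> (nrm 0 v)\<^sup>2 + (nrm 0 z)\<^sup>2"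
    using sum_squares_bound[of "nrm 0 v" "nrm 0 z"] by (simp add: mult.assoc)
  then have "\<kappa> * (2 * (nrm 0 v * nrm 0 z)) \<le> \<kappa> * ((nrm 0 v)\<^sup>2 + (nrm 0 z)\<^sup>2)"
    using \<kappa> by (intro mult_left_mono) auto
  moreover have "(nrm 0 (v + z))\<^sup>2 = (nrm 0 v)\<^sup>2 + (nrm 0 z)\<^sup>2 + 2 * Re (ab a b 0 v z)"
    using H by (simp add: n0.form_norm_sq n0.quad_add)
  ultimately show ?thesis
    by (simp add: algebra_simps)
qed

text \<open>Bound for the oblique projections of V 0 onto Vs and onto Z.\<close>

definition c\<kappa> :: real where "c\<kappa> = 1 / sqrt (1 - \<kappa>)"

lemma c\<kappa>: "c\<kappa> \<ge> 1"
  using \<kappa> by (simp add: c\<kappa>_def)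

lemma component_bounds:
  assumes "v \<in> Vs" "z \<in> Z"
  shows "nrm 0 v \<le> c\<kappa> * nrm 0 (v + z)" "nrm 0 z \<le> c\<kappa> * nrm 0 (v + z)"
proof -
  have H: "v \<in> H" "z \<in> H" "v + z \<in> H"
    using assms Vs_H Z_H by auto
  have sq: "(1 - \<kappa>) * (nrm 0 x)\<^sup>2 \<le> (nrm 0 (v + z))\<^sup>2" if "x = v \<or> x = z" for x
  proof -
    have "(1 - \<kappa>) * (nrm 0 x)\<^sup>2 \<le> (1 - \<kappa>) * ((nrm 0 v)\<^sup>2 + (nrm 0 z)\<^sup>2)"
      using that \<kappa> by (intro mult_left_mono) auto
    then show ?thesis
      using angle_bounds[OF assms] by linarith
  qed
  have "sqrt (1 - \<kappa>) * nrm 0 x \<le> nrm 0 (v + z)" if "x = v \<or> x = z" for x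
  proof (rule power2_le_imp_le)
    show "(sqrt (1 - \<kappa>) * nrm 0 x)\<^sup>2 \<le> (nrm 0 (v + z))\<^sup>2"
      using sq[OF that] \<kappa> by (simp add: power_mult_distrib)
  qed (use H in simp)
  then have *: "sqrt (1 - \<kappa>) * nrm 0 v \<le> nrm 0 (v + z)" "sqrt (1 - \<kappa>) * nrm 0 z \<le> nrm 0 (v + z)"
    by blast+
  have "sqrt (1 - \<kappa>) > 0"
    using \<kappa> by simp
  with * show "nrm 0 v \<le> c\<kappa> * nrm 0 (v + z)" "nrm 0 z \<le> c\<kappa> * nrm 0 (v + z)"
    unfolding c\<kappa>_def by (simp_all add: pos_le_divide_eq mult.commute)
qed

definition K3 :: real where "K3 = c\<kappa> * (M + M\<^sup>2)"

lemma K3_ge1: "1 \<le> K3"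
proof -
  have "1 \<le> M + M\<^sup>2"
    using M by (simp add: add_increasing2)
  then have "1 * 1 \<le> c\<kappa> * (M + M\<^sup>2)"
    using c\<kappa> by (intro mult_mono) auto
  then show ?thesis
    by (simp add: K3_def)
qed

text \<open>p is close to some v in Vs by the removable singularity condition, and the angle
  condition keeps z away from v. The term with |\<theta>| on the right is absorbed later for small
  \<theta>.\<close>

lemma Z_distance:
  assumes z: "z \<in> Z" and \<theta>: "\<theta> \<in> \<Theta>" and p: "p \<in> Vst \<theta>"
  shows "nrm 0 z \<le> K3 * nrm \<theta> (z - p) + K3 * norm \<theta> * nrm 0 z"
proof -
  interpret n: sesq_form sc H "ab a b \<theta>" using form_ab \<theta> .
  let ?t = "norm \<theta>" and ?d = "nrm \<theta> (z - p)"
  obtain v where v: "v \<in> Vs" "nrm 0 (p - v) \<le> M * ?t * nrm \<theta> p"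
    using Vstar_close[OF \<theta> zero_in p] by (auto simp: Vstar_def)
  have H: "z \<in> H" "p \<in> H" "v \<in> H"
    using z p v Z_H Vs_H Vst_subset_V V_H by blast+
  have "nrm \<theta> p \<le> nrm \<theta> z + nrm \<theta> (p - z)"
    using n.form_norm_triangle_sub H by blast
  then have np: "nrm \<theta> p \<le> M * nrm 0 z + ?d"
    using n.form_norm_minus_commute[of p z] nrm_le[OF \<theta>, of z] H by simp
  have "nrm 0 z \<le> c\<kappa> * nrm 0 (- v + z)"
    using component_bounds(2)[of "- v" z] v z subspace_neg[OF subspace_Vs] by blast
  also have "nrm 0 (- v + z) \<le> nrm 0 (z - p) + nrm 0 (p - v)"
    using n0.form_norm_triangle[of "z - p" "p - v"] H by simp
  also have "nrm 0 (z - p) \<le> M * ?d"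
    using nrm_ge[OF \<theta>, of "z - p"] H by simp
  also have "nrm 0 (p - v) \<le> M * ?t * (M * nrm 0 z + ?d)"
    using v(2) np M by (meson mult_left_mono mult_nonneg_nonneg norm_ge_zero order_trans zero_le_one)
  also have "M * ?t * (M * nrm 0 z + ?d) = M * ?t * ?d + M\<^sup>2 * ?t * nrm 0 z"
    by (simp add: algebra_simps power2_eq_square)
  also have "M * ?t * ?d \<le> M * M * ?d"
    using bounded[OF \<theta>] M n.form_norm_nonneg[of "z - p"] H by (intro mult_right_mono mult_left_mono) auto
  also have "M\<^sup>2 * ?t * nrm 0 z \<le> (M + M\<^sup>2) * ?t * nrm 0 z"
    using M H by (intro mult_right_mono) auto
  finally show ?thesis
    using c\<kappa> by (simp add: K3_def algebra_simps power2_eq_square)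
qed

text \<open>Half of \<gamma> / (4 K3^2), the constant that degeneracy yields for the corrected
  energy; the other half pays for the cubic error in \<open>corrected_energy\<close>.\<close>

definition c_Z :: real where "c_Z = \<gamma> / (8 * K3\<^sup>2)"

lemma c_Z_pos: "c_Z > 0"
  using \<gamma> K3_ge1 by (simp add: c_Z_def)

text \<open>In the splitting p + q of z + N z only q carries a_\<theta>-energy, and degeneracy
  bounds that energy below. q cannot be small, for otherwise z would be close to p up to the
  corrector, against \<open>Z_distance\<close>; this needs V \<theta> = Vst \<theta>, hence \<theta>
  nonzero.\<close>

lemma hom_form_coercive_local:
  assumes z: "z \<in> Z" and \<theta>: "\<theta> \<in> \<Theta>" "\<theta> \<noteq> 0"
    and small1: "(K3 * M * K1 + K3) * norm \<theta> \<le> 1/2" and small2: "K2 * norm \<theta> \<le> c_Z"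
  shows "c_Z * (norm \<theta>)\<^sup>2 * (nrm 0 z)\<^sup>2 \<le> Re (ah \<theta> z z)"
proof -
  interpret a: sesq_form sc H "a \<theta>" using form_a \<theta>(1) .
  interpret n: sesq_form sc H "ab a b \<theta>" using form_ab \<theta>(1) .
  let ?t = "norm \<theta>" and ?n = "nrm 0 z"
  have zV: "z \<in> V 0"
    using z Z_subset by blast
  have H: "z \<in> H" "N \<theta> z \<in> H"
    using zV V_H corrector_H by auto
  obtain p q where pq: "p \<in> V \<theta>" "q \<in> W \<theta>" "z + N \<theta> z = p + q"
    using V_W_decomposition[OF \<theta>(1), of "z + N \<theta> z"] H by auto
  have pqH: "p \<in> H" "q \<in> H"
    using pq V_H W_H by auto
  have "quad (a \<theta>) (z + N \<theta> z) = quad (a \<theta>) q"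
    using V_null(1)[OF \<theta>(1) pq(1) pqH(2)] V_iff[OF \<theta>(1), of p] pq(1) pqH
    unfolding pq(3) by (simp add: a.quad_add)
  then have lower: "\<gamma> * ?t\<^sup>2 * (nrm \<theta> q)\<^sup>2 \<le> quad (a \<theta>) (z + N \<theta> z)"
    using degeneracy[OF \<theta>(1) pq(2)] by simp
  have "cmod (a \<theta> (z + N \<theta> z) (z + N \<theta> z) - ah \<theta> z z) \<le> K2 * ?t ^ 3 * ?n\<^sup>2"
    using corrected_energy zV \<theta> by blast
  then have "Re (a \<theta> (z + N \<theta> z) (z + N \<theta> z) - ah \<theta> z z) \<le> K2 * ?t ^ 3 * ?n\<^sup>2"
    using complex_Re_le_cmod order_trans by blast
  then have upper: "quad (a \<theta>) (z + N \<theta> z) \<le> Re (ah \<theta> z z) + (K2 * ?t) * ?t\<^sup>2 * ?n\<^sup>2"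
    by (simp add: quad_def power3_eq_cube power2_eq_square mult_ac)
  have "p \<in> Vst \<theta>"
    using pq(1) \<theta>(2) by (simp add: Vstar_def)
  then have dist: "?n \<le> K3 * nrm \<theta> (z - p) + K3 * ?t * ?n"
    using Z_distance z \<theta> by blast
  have "z - p = q - N \<theta> z"
    using pq(3) by (simp add: algebra_simps)
  then have "nrm \<theta> (z - p) \<le> nrm \<theta> q + nrm \<theta> (N \<theta> z)"
    using n.form_norm_triangle_diff[of q "N \<theta> z"] pqH H by simp
  also have "nrm \<theta> (N \<theta> z) \<le> M * nrm 0 (N \<theta> z)"
    using nrm_le \<theta> H by blast
  also have "\<dots> \<le> M * (K1 * ?t * ?n)"
    using corrector_bound[OF zV, of \<theta>] M by (intro mult_left_mono) (auto simp: K1_def)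
  finally have "K3 * nrm \<theta> (z - p) \<le> K3 * (nrm \<theta> q + M * (K1 * ?t * ?n))"
    using K3_ge1 by (intro mult_left_mono) auto
  then have "?n \<le> K3 * nrm \<theta> q + ((K3 * M * K1 + K3) * ?t) * ?n"
    using dist by (simp add: algebra_simps)
  also have "((K3 * M * K1 + K3) * ?t) * ?n \<le> 1/2 * ?n"
    using small1 H by (intro mult_right_mono) auto
  finally have "?n \<le> 2 * K3 * nrm \<theta> q"
    by simp
  then have "?n\<^sup>2 \<le> (2 * K3 * nrm \<theta> q)\<^sup>2"
    using H by (intro power_mono) auto
  then have "2 * c_Z * ?n\<^sup>2 \<le> \<gamma> * (nrm \<theta> q)\<^sup>2"
    using \<gamma> K3_ge1 unfolding c_Z_def by (simp add: power_mult_distrib field_simps)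
  then have "?t\<^sup>2 * (2 * c_Z * ?n\<^sup>2) \<le> ?t\<^sup>2 * (\<gamma> * (nrm \<theta> q)\<^sup>2)"
    by (intro mult_left_mono) auto
  moreover have "(K2 * ?t) * ?t\<^sup>2 * ?n\<^sup>2 \<le> c_Z * ?t\<^sup>2 * ?n\<^sup>2"
    using small2 by (intro mult_right_mono) auto
  ultimately show ?thesis
    using lower upper by (simp add: algebra_simps)
qed

text \<open>Both sides are quadratic in \<theta>, so the local bound at a small multiple of \<theta>
  suffices.\<close>

lemma hom_form_coercive:
  assumes z: "z \<in> Z"
  shows "c_Z * (norm \<theta>)\<^sup>2 * (nrm 0 z)\<^sup>2 \<le> Re (ah \<theta> z z)"
proof (cases "\<theta> = 0")
  case True
  have "z \<in> V 0"
    using z Z_subset by blast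
  then have "0 \<le> Re (ah \<theta> z z)"
    using hom_form_nonneg by (auto simp: complex_nonneg_Reals_iff)
  then show ?thesis
    using True by simp
next
  case False
  define c where "c = K3 * M * K1 + K3"
  have pos: "c > 0" "K2 + 1 > 0" "norm \<theta> > 0"
    using K3_ge1 M K1_nonneg K2_nonneg False by (auto simp: c_def intro: add_nonneg_pos)
  \<comment> \<open>The three entries place s \<theta> in \<Theta> and enforce the two smallness
    conditions; K2 + 1 replaces K2 because K2 is only known to be non-negative.\<close>
  define s where
    "s = min (\<rho> / (norm \<theta> + 1)) (min (1 / (2 * c * norm \<theta>)) (c_Z / ((K2 + 1) * norm \<theta>)))"
  have s: "s > 0" "s \<le> \<rho> / (norm \<theta> + 1)" "s \<le> 1 / (2 * c * norm \<theta>)" "s \<le> c_Z / ((K2 + 1) * norm \<theta>)"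
    unfolding s_def using radius_pos[of \<theta>] pos c_Z_pos by simp_all
  have "(K3 * M * K1 + K3) * norm (s *\<^sub>R \<theta>) \<le> 1/2"
    unfolding c_def[symmetric] using s(1,3) pos by (simp add: field_simps)
  moreover have "(K2 + 1) * norm (s *\<^sub>R \<theta>) \<le> c_Z"
    using s(1,4) pos by (simp add: pos_le_divide_eq mult_ac)
  then have "K2 * norm (s *\<^sub>R \<theta>) \<le> c_Z"
    by (simp only: distrib_right) (use norm_ge_zero[of "s *\<^sub>R \<theta>"] in linarith)
  moreover have "s *\<^sub>R \<theta> \<noteq> 0"
    using s False by simp
  ultimately have "c_Z * (norm (s *\<^sub>R \<theta>))\<^sup>2 * (nrm 0 z)\<^sup>2 \<le> Re (ah (s *\<^sub>R \<theta>) z z)"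
    using hom_form_coercive_local[OF z scale_into_domain[OF s(1,2)]] by blast
  moreover have "z \<in> V 0"
    using z Z_subset by blast
  ultimately have "s\<^sup>2 * (c_Z * (norm \<theta>)\<^sup>2 * (nrm 0 z)\<^sup>2) \<le> s\<^sup>2 * Re (ah \<theta> z z)"
    using s(1) by (simp add: hom_form_scaleR power_mult_distrib mult_ac)
  then show ?thesis
    using s(1) by simp
qed

text \<open>Serves only the completeness of the form domain under \<open>S\<close>, so the
  dependence of C on \<theta> is harmless for the uniform estimates.\<close>

lemma hom_form_bounded: "\<exists>C\<ge>0. \<forall>z\<in>V 0. Re (ah \<theta> z z) \<le> C * (nrm 0 z)\<^sup>2"
proof -
  define s where "s = \<rho> / (norm \<theta> + 1)"
  have s: "s > 0" "s *\<^sub>R \<theta> \<in> \<Theta>"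
    unfolding s_def using radius_pos scale_into_domain[of "\<rho> / (norm \<theta> + 1)" \<theta>] by auto
  let ?\<theta> = "s *\<^sub>R \<theta>"
  let ?t = "norm ?\<theta>"
  define C where "C = (M + M * K1) * ?t\<^sup>2 * (1 + K1 * ?t) + K2 * ?t ^ 3"
  have C: "C \<ge> 0"
    unfolding C_def using M K1_nonneg K2_nonneg by (intro add_nonneg_nonneg mult_nonneg_nonneg) auto
  have "Re (ah \<theta> z z) \<le> C / s\<^sup>2 * (nrm 0 z)\<^sup>2" if z: "z \<in> V 0" for z
  proof -
    have H: "z \<in> H" "N ?\<theta> z \<in> H"
      using z V_H corrector_H by auto
    let ?y = "z + N ?\<theta> z"
    have y: "nrm 0 ?y \<le> (1 + K1 * ?t) * nrm 0 z"
      using n0.form_norm_triangle[OF H] corrector_bound[OF z, of ?\<theta>]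
      by (simp add: K1_def algebra_simps)
    have "cmod (a ?\<theta> ?y ?y) \<le> (M + M * K1) * ?t\<^sup>2 * nrm 0 z * nrm 0 ?y"
      using corrected_residual[OF z _ s(2)] H by simp
    also have "\<dots> \<le> (M + M * K1) * ?t\<^sup>2 * nrm 0 z * ((1 + K1 * ?t) * nrm 0 z)"
      using y M K1_nonneg H by (intro mult_left_mono) auto
    finally have e1: "cmod (a ?\<theta> ?y ?y) \<le> (M + M * K1) * ?t\<^sup>2 * (1 + K1 * ?t) * (nrm 0 z)\<^sup>2"
      by (simp add: power2_eq_square mult_ac)
    have e2: "cmod (a ?\<theta> ?y ?y - ah ?\<theta> z z) \<le> K2 * ?t ^ 3 * (nrm 0 z)\<^sup>2"
      using corrected_energy[OF z s(2)] .
    have "cmod (ah ?\<theta> z z) \<le> cmod (a ?\<theta> ?y ?y) + cmod (a ?\<theta> ?y ?y - ah ?\<theta> z z)"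
      by (metis norm_minus_commute norm_triangle_sub)
    then have "cmod (ah ?\<theta> z z) \<le> C * (nrm 0 z)\<^sup>2"
      using e1 e2 unfolding C_def distrib_right by linarith
    then have "Re (ah ?\<theta> z z) \<le> C * (nrm 0 z)\<^sup>2"
      using complex_Re_le_cmod order_trans by blast
    then have "s\<^sup>2 * Re (ah \<theta> z z) \<le> C * (nrm 0 z)\<^sup>2"
      using z by (simp add: hom_form_scaleR)
    then show ?thesis
      using s(1) by (simp add: field_simps)
  qed
  then show ?thesis
    using C by (intro exI[of _ "C / s\<^sup>2"]) auto
qed

section \<open>The form of the homogenised problem on V 0\<close>

abbreviation "S \<equiv> S_form H a b a' a'' Vs Z"

lemma Z_component_eq:
  assumes "v \<in> Vs" "z \<in> Z"
  shows "Z_component Vs Z (v + z) = z"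
  unfolding Z_component_def
proof (rule the_equality)
  fix z'
  assume z': "z' \<in> Z \<and> v + z - z' \<in> Vs"
  then have "(v + z - z') - v \<in> Vs"
    using assms subspace_diff[OF subspace_Vs] by blast
  then have "z - z' \<in> Vs"
    by (simp add: algebra_simps)
  moreover have "z - z' \<in> Z"
    using assms z' subspace_diff[OF subspace_Z] by blast
  ultimately have "z - z' \<in> Vs \<inter> Z"
    by (rule IntI)
  then have "z - z' = 0"
    unfolding V0_decomp(2) by simp
  then show "z' = z"
    by simp
qed (use assms in simp)

lemma V0_E:
  assumes "x \<in> V 0"
  obtains v z where "v \<in> Vs" "z \<in> Z" "x = v + z"
  using assms V0_decomp(1) by (auto simp: direct_sum_def)

lemma V0_I: "v \<in> Vs \<Longrightarrow> z \<in> Z \<Longrightarrow> v + z \<in> V 0"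
  using V0_decomp(1) by (auto simp: direct_sum_def)

lemma S_form_eq:
  assumes "v \<in> Vs" "z \<in> Z" "v' \<in> Vs" "z' \<in> Z"
  shows "S \<xi> (v + z) (v' + z') = ah \<xi> z z' + b 0 (v + z) (v' + z')"
  using assms by (simp add: S_form_def Z_component_eq)

lemma quad_S:
  assumes "v \<in> Vs" "z \<in> Z"
  shows "quad (S \<xi>) (v + z) = Re (ah \<xi> z z) + quad (b 0) (v + z)"
  using assms by (simp add: quad_def S_form_eq)

lemma quad_b0_V0: "x \<in> V 0 \<Longrightarrow> quad (b 0) x = (nrm 0 x)\<^sup>2"
  using V_iff[OF zero_in] n0.form_norm_sq by (simp add: quad_ab)

lemma quad_b0_le_S:
  assumes "x \<in> V 0"
  shows "quad (b 0) x \<le> quad (S \<xi>) x"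
proof -
  obtain v z where x: "v \<in> Vs" "z \<in> Z" "x = v + z"
    using V0_E[OF assms] .
  then have "0 \<le> Re (ah \<xi> z z)"
    using hom_form_nonneg[of z \<xi>] Z_subset by (auto simp: complex_nonneg_Reals_iff)
  then show ?thesis
    using x by (simp add: quad_S)
qed

lemma Z_component_V0: "x \<in> V 0 \<Longrightarrow> Z_component Vs Z x \<in> V 0"
  using Z_subset by (metis V0_E Z_component_eq subsetD)

lemma Z_component_add:
  assumes "x \<in> V 0" "y \<in> V 0"
  shows "Z_component Vs Z (x + y) = Z_component Vs Z x + Z_component Vs Z y"
proof -
  obtain v z v' z' where x: "v \<in> Vs" "z \<in> Z" "x = v + z" and y: "v' \<in> Vs" "z' \<in> Z" "y = v' + z'"
    using assms by (metis V0_E)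
  have "x + y = (v + v') + (z + z')"
    by (simp add: x y algebra_simps)
  also have "Z_component Vs Z \<dots> = z + z'"
    using x y subspace_add[OF subspace_Vs] subspace_add[OF subspace_Z] by (intro Z_component_eq) auto
  finally show ?thesis
    using x y by (simp add: Z_component_eq)
qed

lemma Z_component_scale:
  assumes "x \<in> V 0"
  shows "Z_component Vs Z (sc c x) = sc c (Z_component Vs Z x)"
proof -
  obtain v z where x: "v \<in> Vs" "z \<in> Z" "x = v + z"
    using V0_E[OF assms] .
  then show ?thesis
    using Z_component_eq subspace_scale[OF subspace_Vs] subspace_scale[OF subspace_Z]
    by (simp add: scale_right_distrib)
qed

lemma form_S: "sesq_form sc (V 0) (S \<xi>)"
proof
  interpret h: sesq_form sc "V 0" "ah \<xi>" by (rule form_hom)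
  show "nonneg_form sc (V 0) (S \<xi>)"
    unfolding nonneg_form_def sesquilinear_on_def
  proof (intro conjI ballI allI)
    show "S \<xi> x x \<in> \<real>\<^sub>\<ge>\<^sub>0" if "x \<in> V 0" for x
      using h.diag[OF Z_component_V0[OF that]] h.quad_nonneg[OF Z_component_V0[OF that]]
        b0.diag[OF V_H[OF that]] b0.quad_nonneg[OF V_H[OF that]]
      by (simp add: S_form_def complex_nonneg_Reals_iff)
  qed (simp_all add: S_form_def Z_component_V0 Z_component_add Z_component_scale V_H
      h.add_left h.add_right h.scale_left h.scale_right
      b0.add_left b0.add_right b0.scale_left b0.scale_right algebra_simps)
qed (fact subspace_V[OF zero_in])

lemma S_bounded: "\<exists>C>0. \<forall>x\<in>V 0. form_norm (S \<xi>) x \<le> C * nrm 0 x"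
proof -
  obtain C where C: "C \<ge> 0" "\<forall>z\<in>V 0. Re (ah \<xi> z z) \<le> C * (nrm 0 z)\<^sup>2"
    using hom_form_bounded by blast
  have "form_norm (S \<xi>) x \<le> sqrt (C * c\<kappa>\<^sup>2 + 1) * nrm 0 x" if x0: "x \<in> V 0" for x
  proof -
    obtain v z where x: "v \<in> Vs" "z \<in> Z" "x = v + z"
      using V0_E[OF x0] .
    have "nrm 0 z \<le> c\<kappa> * nrm 0 x"
      using component_bounds(2) x by blast
    then have "(nrm 0 z)\<^sup>2 \<le> (c\<kappa> * nrm 0 x)\<^sup>2"
      using x Z_H by (intro power_mono) auto
    then have "C * (nrm 0 z)\<^sup>2 \<le> C * (c\<kappa> * nrm 0 x)\<^sup>2"
      using C(1) by (rule mult_left_mono)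
    moreover have "Re (ah \<xi> z z) \<le> C * (nrm 0 z)\<^sup>2"
      using C(2) x Z_subset by blast
    ultimately have "quad (S \<xi>) x \<le> (C * c\<kappa>\<^sup>2 + 1) * (nrm 0 x)\<^sup>2"
      using quad_S[OF x(1,2)] quad_b0_V0[OF x0] x(3) by (simp add: power_mult_distrib algebra_simps)
    then have "form_norm (S \<xi>) x \<le> sqrt ((C * c\<kappa>\<^sup>2 + 1) * (nrm 0 x)\<^sup>2)"
      unfolding form_norm_def[of "S \<xi>"] by (rule real_sqrt_le_mono)
    then show ?thesis
      using V_H[OF x0] by (simp add: real_sqrt_mult)
  qed
  moreover have "sqrt (C * c\<kappa>\<^sup>2 + 1) > 0"
    using C(1) by (simp add: add_nonneg_pos)
  ultimately show ?thesis
    by blast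
qed

section \<open>The scaled form of the original problem\<close>

definition A :: "real \<Rightarrow> real^'n \<Rightarrow> 'a form" where
  "A \<epsilon> \<theta> u v = complex_of_real (1 / \<epsilon>\<^sup>2) * a \<theta> u v + b \<theta> u v"

lemma quad_A: "quad (A \<epsilon> \<theta>) u = 1 / \<epsilon>\<^sup>2 * quad (a \<theta>) u + quad (b \<theta>) u"
  by (simp add: quad_def A_def)

lemma form_A: "\<theta> \<in> \<Theta> \<Longrightarrow> sesq_form sc H (A \<epsilon> \<theta>)"
proof -
  assume \<theta>: "\<theta> \<in> \<Theta>"
  interpret a: sesq_form sc H "a \<theta>" using form_a \<theta> .
  interpret b: sesq_form sc H "b \<theta>" using form_b \<theta> .
  show ?thesis
  proof
    show "nonneg_form sc H (A \<epsilon> \<theta>)"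
      unfolding nonneg_form_def sesquilinear_on_def
    proof (intro conjI ballI allI)
      show "A \<epsilon> \<theta> u u \<in> \<real>\<^sub>\<ge>\<^sub>0" if "u \<in> H" for u
        using that a.diag[of u] b.diag[of u] by (simp add: A_def complex_nonneg_Reals_iff)
    qed (auto simp: A_def a.add_left a.add_right a.scale_left a.scale_right
          b.add_left b.add_right b.scale_left b.scale_right algebra_simps)
  qed (fact subspace_H)
qed

lemma A_lower:
  assumes "\<theta> \<in> \<Theta>" "0 < \<epsilon>" "\<epsilon> < 1" "u \<in> H"
  shows "nrm \<theta> u \<le> form_norm (A \<epsilon> \<theta>) u"
proof -
  have "1 * quad (a \<theta>) u \<le> 1 / \<epsilon>\<^sup>2 * quad (a \<theta>) u"
    using assms sesq_form.quad_nonneg[OF form_a, of \<theta> u]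
    by (intro mult_right_mono) (auto simp: power_le_one)
  then show ?thesis
    by (simp add: form_norm_def quad_ab quad_A)
qed

text \<open>Degenerates as \<epsilon> tends to 0, but is used only for completeness at fixed
  \<epsilon>.\<close>

lemma A_upper:
  assumes "\<theta> \<in> \<Theta>" "0 < \<epsilon>" "\<epsilon> < 1" "u \<in> H"
  shows "form_norm (A \<epsilon> \<theta>) u \<le> 1 / \<epsilon> * nrm \<theta> u"
proof -
  have "1 * quad (b \<theta>) u \<le> 1 / \<epsilon>\<^sup>2 * quad (b \<theta>) u"
    using assms sesq_form.quad_nonneg[OF form_b, of \<theta> u]
    by (intro mult_right_mono) (auto simp: power_le_one)
  then have "quad (A \<epsilon> \<theta>) u \<le> 1 / \<epsilon>\<^sup>2 * quad (ab a b \<theta>) u"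
    by (simp add: quad_ab quad_A algebra_simps add_divide_distrib)
  then have "form_norm (A \<epsilon> \<theta>) u \<le> sqrt (1 / \<epsilon>\<^sup>2 * quad (ab a b \<theta>) u)"
    unfolding form_norm_def[of "A \<epsilon> \<theta>"] by (rule real_sqrt_le_mono)
  then show ?thesis
    using assms by (simp add: form_norm_def real_sqrt_mult real_sqrt_divide)
qed

end

section \<open>Comparison of the two problems\<close>

text \<open>\<open>compact_d\<close> is stated for \<open>nrm 0\<close> with radius M so that it
  serves both problems at once, and \<open>b_lipschitz\<close> measures both arguments in
  \<open>nrm 0\<close>, the comparison of norms being absorbed into M.\<close>

locale transfer_family = degenerate_family sc H Vs Z \<Theta> a b a' a'' M \<nu> \<gamma> \<kappa> \<rho>
  for sc :: "complex \<Rightarrow> 'a::ab_group_add \<Rightarrow> 'a"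
    and H Vs Z :: "'a set" and \<Theta> :: "(real^'n) set" and a b :: "real^'n \<Rightarrow> 'a form"
    and a' :: "'a \<Rightarrow> 'a \<Rightarrow> complex^'n" and a'' :: "'a \<Rightarrow> 'a \<Rightarrow> complex^'n^'n"
    and M \<nu> \<gamma> \<kappa> \<rho> :: real +
  fixes d :: "real^'n \<Rightarrow> 'a form" and E :: "real^'n \<Rightarrow> 'a \<Rightarrow> 'a"
  assumes nonneg_d: "\<And>\<theta>. \<theta> \<in> \<Theta> \<Longrightarrow> nonneg_form sc UNIV (d \<theta>)"
    and definite_d: "\<And>\<theta> u. \<theta> \<in> \<Theta> \<Longrightarrow> quad (d \<theta>) u = 0 \<Longrightarrow> u = 0"
    and d_le_b: "\<And>\<theta> u. \<theta> \<in> \<Theta> \<Longrightarrow> u \<in> H \<Longrightarrow> quad (d \<theta>) u \<le> quad (b \<theta>) u"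
    and compact_d: "\<And>\<theta> x. \<theta> \<in> \<Theta> \<Longrightarrow> (\<And>n. x n \<in> H) \<Longrightarrow> (\<And>n. form_norm (ab a b 0) (x n) \<le> M)
        \<Longrightarrow> \<exists>r::nat \<Rightarrow> nat. strict_mono r \<and> form_Cauchy (d \<theta>) (x \<circ> r)"
    and b_lipschitz: "\<And>\<theta> v w. \<theta> \<in> \<Theta> \<Longrightarrow> v \<in> Vsp H a 0 \<Longrightarrow> w \<in> Vsp H a 0 \<Longrightarrow>
        cmod (b \<theta> v w - b 0 v w)
          \<le> M * norm \<theta> * form_norm (ab a b 0) v * form_norm (ab a b 0) w"
    and E_Vs: "\<And>\<theta>. \<theta> \<in> \<Theta> \<Longrightarrow> E \<theta> ` Vs = Vstar H a Vs \<theta>"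
    and E_unitary_b: "\<And>\<theta> v w. \<theta> \<in> \<Theta> \<Longrightarrow> v \<in> Vs \<Longrightarrow> w \<in> Vs \<Longrightarrow> b \<theta> (E \<theta> v) (E \<theta> w) = b 0 v w"
    and E_Z: "\<And>\<theta> v z. \<theta> \<in> \<Theta> \<Longrightarrow> v \<in> Vs \<Longrightarrow> z \<in> Z \<Longrightarrow>
        cmod (b \<theta> (E \<theta> v) z - b 0 v z)
          \<le> M * norm \<theta> * form_norm (ab a b 0) v * form_norm (ab a b 0) z"
    and E_unitary: "\<And>\<theta> u w. \<theta> \<in> \<Theta> \<Longrightarrow> d \<theta> (E \<theta> u) (E \<theta> w) = d 0 u w"
    and E_surj: "\<And>\<theta>. \<theta> \<in> \<Theta> \<Longrightarrow> surj (E \<theta>)"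
    and E_close: "\<And>\<theta> u. \<theta> \<in> \<Theta> \<Longrightarrow> form_norm (d \<theta>) (E \<theta> u - u) \<le> M * norm \<theta> * form_norm (d 0) u"
begin

lemma form_d: "\<theta> \<in> \<Theta> \<Longrightarrow> sesq_form sc UNIV (d \<theta>)"
  using nonneg_d by unfold_locales auto

sublocale d0: sesq_form sc UNIV "d 0" using form_d zero_in .

lemma form_norm_d_le: "\<theta> \<in> \<Theta> \<Longrightarrow> u \<in> H \<Longrightarrow> form_norm (d \<theta>) u \<le> nrm \<theta> u"
  using d_le_b form_norm_b_le[of \<theta> u] by (force simp: form_norm_def)

lemma form_norm_E: "\<theta> \<in> \<Theta> \<Longrightarrow> form_norm (d \<theta>) (E \<theta> u) = form_norm (d 0) u"
  by (simp add: form_norm_def quad_def E_unitary)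

lemma E_Vs_V:
  assumes "\<theta> \<in> \<Theta>" "v \<in> Vs"
  shows "E \<theta> v \<in> V \<theta>" "E \<theta> v \<in> H"
  using E_Vs[OF assms(1)] Vst_subset_V assms(2) V_H by blast+

lemma nrm_V: "\<theta> \<in> \<Theta> \<Longrightarrow> v \<in> V \<theta> \<Longrightarrow> nrm \<theta> v = form_norm (b \<theta>) v"
  using V_iff by (simp add: form_norm_def quad_ab)

lemma nrm_E: "\<theta> \<in> \<Theta> \<Longrightarrow> v \<in> Vs \<Longrightarrow> nrm \<theta> (E \<theta> v) = nrm 0 v"
  using nrm_V[of \<theta> "E \<theta> v"] nrm_V[OF zero_in, of v] E_Vs_V Vs_subset
  by (auto simp: form_norm_def quad_def E_unitary_b)

text \<open>Only v is moved by \<open>E \<theta>\<close>: the image of z under it is controlled in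
  the ambient norm alone and is not known to lie in H.\<close>

definition J :: "real^'n \<Rightarrow> 'a \<Rightarrow> 'a \<Rightarrow> 'a" where
  "J \<theta> v z = E \<theta> v + (z + N \<theta> z)"

lemma J_H: "\<theta> \<in> \<Theta> \<Longrightarrow> v \<in> Vs \<Longrightarrow> z \<in> Z \<Longrightarrow> J \<theta> v z \<in> H"
  using E_Vs_V(2) Z_H corrector_H Z_subset by (auto simp: J_def)

definition K4 :: real where
  "K4 = K2 + 2 * (M + M * K1) + (M + M ^ 3 * K1\<^sup>2 + 2 * M\<^sup>2 * K1)"

lemma K4_nonneg: "0 \<le> K4"
  unfolding K4_def using M K1_nonneg K2_nonneg by simp

text \<open>E v is a null vector of a_\<theta> and has the b-energy of v, so the pure v terms match
  exactly. The a-part has cubic error, and |\<theta>|^3 divided by the square of \<epsilon> is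
  |\<theta>| |\<xi>|^2; the b-part has errors linear in |\<theta>|.\<close>

lemma J_energy:
  assumes v: "v \<in> Vs" and z: "z \<in> Z" and \<theta>: "\<theta> \<in> \<Theta>" and \<epsilon>: "0 < \<epsilon>"
  shows "\<bar>quad (A \<epsilon> \<theta>) (J \<theta> v z) - quad (S (\<theta> /\<^sub>R \<epsilon>)) (v + z)\<bar>
    \<le> K4 * norm \<theta> * nrm 0 z * (nrm 0 v + (1 + (norm \<theta> / \<epsilon>)\<^sup>2) * nrm 0 z)"
proof -
  interpret a: sesq_form sc H "a \<theta>" using form_a \<theta> .
  interpret b: sesq_form sc H "b \<theta>" using form_b \<theta> .
  let ?t = "norm \<theta>" and ?nv = "nrm 0 v" and ?nz = "nrm 0 z"
  define e where "e = E \<theta> v"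
  define c where "c = N \<theta> z"
  have zV: "z \<in> V 0" and vV: "v \<in> V 0"
    using z v Z_subset Vs_subset by auto
  have H: "e \<in> H" "z \<in> H" "c \<in> H" "v \<in> H" "z + c \<in> H"
    using E_Vs_V[OF \<theta> v] zV vV V_H corrector_H by (auto simp: e_def c_def)
  have eV: "e \<in> V \<theta>"
    using E_Vs_V[OF \<theta> v] by (simp add: e_def)
  have nc: "nrm 0 c \<le> K1 * ?t * ?nz"
    using corrector_bound[OF zV, of \<theta>] by (simp add: c_def K1_def)
  have n0: "0 \<le> ?nv" "0 \<le> ?nz" "0 \<le> nrm 0 c"
    using H by auto
  have "quad (a \<theta>) (e + (z + c)) = quad (a \<theta>) (z + c)"
    using V_null(1)[OF \<theta> eV H(5)] V_iff[OF \<theta>, of e] eV H by (simp add: a.quad_add)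
  then have aJ: "1 / \<epsilon>\<^sup>2 * quad (a \<theta>) (J \<theta> v z) = 1 / \<epsilon>\<^sup>2 * quad (a \<theta>) (z + c)"
    by (simp add: J_def e_def c_def)
  have "cmod (a \<theta> (z + c) (z + c) - ah \<theta> z z) \<le> K2 * ?t ^ 3 * ?nz\<^sup>2"
    using corrected_energy[OF zV \<theta>] by (simp add: c_def)
  then have "\<bar>Re (a \<theta> (z + c) (z + c) - ah \<theta> z z)\<bar> \<le> K2 * ?t ^ 3 * ?nz\<^sup>2"
    using abs_Re_le_cmod order_trans by blast
  then have "\<bar>quad (a \<theta>) (z + c) - Re (ah \<theta> z z)\<bar> \<le> K2 * ?t ^ 3 * ?nz\<^sup>2"
    by (simp add: quad_def)
  then have "1 / \<epsilon>\<^sup>2 * \<bar>quad (a \<theta>) (z + c) - Re (ah \<theta> z z)\<bar> \<le> 1 / \<epsilon>\<^sup>2 * (K2 * ?t ^ 3 * ?nz\<^sup>2)"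
    by (intro mult_left_mono) auto
  moreover have "Re (ah (\<theta> /\<^sub>R \<epsilon>) z z) = 1 / \<epsilon>\<^sup>2 * Re (ah \<theta> z z)"
    using hom_form_scaleR[OF zV zV, of "inverse \<epsilon>" \<theta>] by (simp add: field_simps)
  ultimately have part_a: "\<bar>1 / \<epsilon>\<^sup>2 * quad (a \<theta>) (J \<theta> v z) - Re (ah (\<theta> /\<^sub>R \<epsilon>) z z)\<bar>
      \<le> K2 * ?t * (?t / \<epsilon>)\<^sup>2 * ?nz\<^sup>2"
    unfolding aJ using \<epsilon>
    by (simp add: power_divide power2_eq_square power3_eq_cube abs_mult flip: right_diff_distrib)
       (simp add: field_simps)
  have bee: "quad (b \<theta>) e = quad (b 0) v"
    by (simp add: quad_def e_def E_unitary_b \<theta> v)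
  have be: "form_norm (b \<theta>) e \<le> ?nv"
    using form_norm_b_le[OF zero_in H(4)] bee by (simp add: form_norm_def)
  have bc: "form_norm (b \<theta>) c \<le> M * (K1 * ?t * ?nz)"
  proof -
    have "form_norm (b \<theta>) c \<le> M * nrm 0 c"
      using form_norm_b_le[OF \<theta> H(3)] nrm_le[OF \<theta> H(3)] by linarith
    also have "\<dots> \<le> M * (K1 * ?t * ?nz)"
      using nc M by (intro mult_left_mono) auto
    finally show ?thesis .
  qed
  have bz: "form_norm (b \<theta>) z \<le> M * ?nz"
    using form_norm_b_le[OF \<theta> H(2)] nrm_le[OF \<theta> H(2)] by linarith
  have e1: "\<bar>Re (b \<theta> e z) - Re (b 0 v z)\<bar> \<le> M * ?t * ?nv * ?nz"
    using E_Z[OF \<theta> v z] abs_Re_le_cmod[of "b \<theta> e z - b 0 v z"] by (simp add: e_def)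
  have e2: "\<bar>Re (b \<theta> e c)\<bar> \<le> M * K1 * ?t * ?nv * ?nz"
  proof -
    have "\<bar>Re (b \<theta> e c)\<bar> \<le> form_norm (b \<theta>) e * form_norm (b \<theta>) c"
      using abs_Re_le_cmod[of "b \<theta> e c"] b.cauchy_schwarz[OF H(1,3)] by linarith
    also have "\<dots> \<le> ?nv * (M * (K1 * ?t * ?nz))"
      using be bc n0 H by (intro mult_mono) auto
    finally show ?thesis
      by (simp add: mult_ac)
  qed
  have e3: "\<bar>quad (b \<theta>) z - quad (b 0) z\<bar> \<le> M * ?t * ?nz\<^sup>2"
    using b_lipschitz[OF \<theta> zV zV] abs_Re_le_cmod[of "b \<theta> z z - b 0 z z"]
    by (simp add: quad_def power2_eq_square mult_ac)
  \<comment> \<open>The corrector energy is quadratic in |\<theta>|; one factor is traded for M so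
    that all b-errors have the same order.\<close>
  have tM: "?t\<^sup>2 \<le> M * ?t"
    using bounded[OF \<theta>] by (simp add: power2_eq_square mult_right_mono)
  have e4: "\<bar>quad (b \<theta>) c\<bar> \<le> M ^ 3 * K1\<^sup>2 * ?t * ?nz\<^sup>2"
  proof -
    have "quad (b \<theta>) c = (form_norm (b \<theta>) c)\<^sup>2"
      using H by (simp add: b.form_norm_sq)
    also have "\<dots> \<le> (M * (K1 * ?t * ?nz))\<^sup>2"
      using bc H by (intro power_mono) auto
    also have "\<dots> = (M\<^sup>2 * K1\<^sup>2 * ?nz\<^sup>2) * ?t\<^sup>2"
      by (simp add: power_mult_distrib)
    also have "\<dots> \<le> (M\<^sup>2 * K1\<^sup>2 * ?nz\<^sup>2) * (M * ?t)"
      using tM by (intro mult_left_mono) auto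
    finally show ?thesis
      using H by (simp add: power2_eq_square power3_eq_cube mult_ac)
  qed
  have e5: "\<bar>Re (b \<theta> z c)\<bar> \<le> M\<^sup>2 * K1 * ?t * ?nz\<^sup>2"
  proof -
    have "\<bar>Re (b \<theta> z c)\<bar> \<le> form_norm (b \<theta>) z * form_norm (b \<theta>) c"
      using abs_Re_le_cmod[of "b \<theta> z c"] b.cauchy_schwarz[OF H(2,3)] by linarith
    also have "\<dots> \<le> (M * ?nz) * (M * (K1 * ?t * ?nz))"
      using bz bc n0 M H by (intro mult_mono) auto
    finally show ?thesis
      by (simp add: power2_eq_square mult_ac)
  qed
  have bJ: "quad (b \<theta>) (J \<theta> v z) = quad (b 0) v + quad (b \<theta>) z + quad (b \<theta>) c
      + 2 * Re (b \<theta> z c) + 2 * Re (b \<theta> e z) + 2 * Re (b \<theta> e c)"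
    using H by (simp add: J_def flip: e_def c_def) (simp add: b.quad_add b.add_right bee)
  have bx: "quad (b 0) (v + z) = quad (b 0) v + quad (b 0) z + 2 * Re (b 0 v z)"
    using H by (simp add: b0.quad_add)
  have part_b: "\<bar>quad (b \<theta>) (J \<theta> v z) - quad (b 0) (v + z)\<bar>
      \<le> 2 * (M * ?t * ?nv * ?nz) + 2 * (M * K1 * ?t * ?nv * ?nz)
        + M * ?t * ?nz\<^sup>2 + M ^ 3 * K1\<^sup>2 * ?t * ?nz\<^sup>2 + 2 * (M\<^sup>2 * K1 * ?t * ?nz\<^sup>2)"
    unfolding bJ bx using e1 e2 e3 e4 e5 by linarith
  let ?P = "?t * ?nz * ?nv" and ?Q = "?t * ?nz * ?nz" and ?R = "?t * ?nz * ((?t / \<epsilon>)\<^sup>2 * ?nz)"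
  have PQR: "?P \<ge> 0" "?Q \<ge> 0" "?R \<ge> 0"
    using n0 by auto
  have "\<bar>quad (A \<epsilon> \<theta>) (J \<theta> v z) - quad (S (\<theta> /\<^sub>R \<epsilon>)) (v + z)\<bar>
      \<le> \<bar>1 / \<epsilon>\<^sup>2 * quad (a \<theta>) (J \<theta> v z) - Re (ah (\<theta> /\<^sub>R \<epsilon>) z z)\<bar>
        + \<bar>quad (b \<theta>) (J \<theta> v z) - quad (b 0) (v + z)\<bar>"
    unfolding quad_A quad_S[OF v z] by linarith
  also have "\<dots> \<le> K2 * ?R + 2 * (M + M * K1) * ?P + (M + M ^ 3 * K1\<^sup>2 + 2 * M\<^sup>2 * K1) * ?Q"
    using part_a part_b by (simp add: algebra_simps power2_eq_square)
  also have "\<dots> \<le> K4 * ?R + K4 * ?P + K4 * ?Q"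
  proof -
    have "0 \<le> M" "0 \<le> M * K1" "0 \<le> M ^ 3 * K1\<^sup>2" "0 \<le> M\<^sup>2 * K1"
      using M K1_nonneg by simp_all
    then have "K2 \<le> K4" "2 * (M + M * K1) \<le> K4" "M + M ^ 3 * K1\<^sup>2 + 2 * M\<^sup>2 * K1 \<le> K4"
      unfolding K4_def using K2_nonneg M by (simp_all add: mult.assoc)
    then show ?thesis
      using PQR by (meson add_mono mult_right_mono)
  qed
  finally show ?thesis
    by (simp add: algebra_simps)
qed

definition K5 :: real where "K5 = M + M * K1"

lemma K5_nonneg: "0 \<le> K5"
  unfolding K5_def using M K1_nonneg by simp

text \<open>With E (v + z) in place of the trial vector the pairings would agree exactly. The
  discrepancy consists of E z - z and the corrector, both O(|\<theta>| |z|) in the d-norm.\<close>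

lemma J_pairing:
  assumes v: "v \<in> Vs" and z: "z \<in> Z" and \<theta>: "\<theta> \<in> \<Theta>"
  shows "\<bar>Re (d \<theta> (E \<theta> f) (J \<theta> v z)) - Re (d 0 f (v + z))\<bar>
    \<le> K5 * norm \<theta> * nrm 0 z * form_norm (d 0) f"
proof -
  interpret d: sesq_form sc UNIV "d \<theta>" using form_d \<theta> .
  let ?c = "N \<theta> z" and ?F = "form_norm (d 0) f" and ?t = "norm \<theta>" and ?nz = "nrm 0 z"
  have zV: "z \<in> V 0"
    using z Z_subset by blast
  have H: "z \<in> H" "?c \<in> H"
    using zV V_H corrector_H by auto
  have "d \<theta> (E \<theta> f) (J \<theta> v z) - d 0 f (v + z) = d \<theta> (E \<theta> f) ?c - d \<theta> (E \<theta> f) (E \<theta> z - z)"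
    using E_unitary[OF \<theta>] by (simp add: J_def d.add_right d.diff_right d0.add_right)
  then have "cmod (d \<theta> (E \<theta> f) (J \<theta> v z) - d 0 f (v + z))
      \<le> cmod (d \<theta> (E \<theta> f) ?c) + cmod (d \<theta> (E \<theta> f) (E \<theta> z - z))"
    by (simp add: norm_triangle_ineq4)
  moreover have "cmod (d \<theta> (E \<theta> f) ?c) \<le> ?F * (M * (K1 * ?t * ?nz))"
  proof -
    have "form_norm (d \<theta>) ?c \<le> M * nrm 0 ?c"
      using form_norm_d_le[OF \<theta> H(2)] nrm_le[OF \<theta> H(2)] by linarith
    also have "\<dots> \<le> M * (K1 * ?t * ?nz)"
      using corrector_bound[OF zV, of \<theta>] M by (intro mult_left_mono) (auto simp: K1_def)
    finally have "?F * form_norm (d \<theta>) ?c \<le> ?F * (M * (K1 * ?t * ?nz))"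
      by (intro mult_left_mono) auto
    then show ?thesis
      using d.cauchy_schwarz[of "E \<theta> f" ?c] form_norm_E[OF \<theta>, of f] by simp
  qed
  moreover have "cmod (d \<theta> (E \<theta> f) (E \<theta> z - z)) \<le> ?F * (M * ?t * ?nz)"
  proof -
    have "form_norm (d \<theta>) (E \<theta> z - z) \<le> M * ?t * form_norm (d 0) z"
      using E_close \<theta> by blast
    also have "\<dots> \<le> M * ?t * ?nz"
      using form_norm_d_le[OF zero_in H(1)] M by (intro mult_left_mono) auto
    finally have "?F * form_norm (d \<theta>) (E \<theta> z - z) \<le> ?F * (M * ?t * ?nz)"
      by (intro mult_left_mono) auto
    then show ?thesis
      using d.cauchy_schwarz[of "E \<theta> f" "E \<theta> z - z"] form_norm_E[OF \<theta>, of f] by simp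
  qed
  moreover have "\<bar>Re (d \<theta> (E \<theta> f) (J \<theta> v z)) - Re (d 0 f (v + z))\<bar>
      \<le> cmod (d \<theta> (E \<theta> f) (J \<theta> v z) - d 0 f (v + z))"
    using abs_Re_le_cmod[of "d \<theta> (E \<theta> f) (J \<theta> v z) - d 0 f (v + z)"] by simp
  ultimately show ?thesis
    by (simp add: K5_def algebra_simps)
qed

lemma le_one_plus_sq: "(x::real) \<le> 1 + x\<^sup>2"
  using sum_squares_bound[of x 1] by (cases "x \<ge> 0") (auto intro: order_trans[of _ 0])

text \<open>Two-sided and independent of where v and z come from: each direction of the comparison
  supplies its own B, from the homogenised or from the scaled solution.\<close>

lemma transfer_error:
  assumes v: "v \<in> Vs" and z: "z \<in> Z" and \<theta>: "\<theta> \<in> \<Theta>" and \<epsilon>: "0 < \<epsilon>"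
    and bounds: "nrm 0 v \<le> B * form_norm (d 0) f"
      "(1 + (norm \<theta> / \<epsilon>)\<^sup>2) * nrm 0 z \<le> B * form_norm (d 0) f"
  shows "\<bar>(2 * Re (d \<theta> (E \<theta> f) (J \<theta> v z)) - quad (A \<epsilon> \<theta>) (J \<theta> v z))
      - (2 * Re (d 0 f (v + z)) - quad (S (\<theta> /\<^sub>R \<epsilon>)) (v + z))\<bar>
    \<le> (2 * K5 * B + 2 * K4 * B\<^sup>2) * \<epsilon> * quad (d 0) f"
proof -
  let ?F = "form_norm (d 0) f" and ?t = "norm \<theta>" and ?nz = "nrm 0 z"
  have n0: "0 \<le> ?nz" "0 \<le> nrm 0 v" "0 \<le> ?F"
    using v z Vs_H Z_H by auto
  have "?t * ?nz = \<epsilon> * ((?t / \<epsilon>) * ?nz)"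
    using \<epsilon> by simp
  also have "\<dots> \<le> \<epsilon> * ((1 + (?t / \<epsilon>)\<^sup>2) * ?nz)"
    using \<epsilon> n0 le_one_plus_sq by (intro mult_left_mono mult_right_mono) auto
  also have "\<dots> \<le> \<epsilon> * (B * ?F)"
    using bounds(2) \<epsilon> by (intro mult_left_mono) auto
  finally have tz: "?t * ?nz \<le> \<epsilon> * (B * ?F)" .
  have sum: "nrm 0 v + (1 + (?t / \<epsilon>)\<^sup>2) * ?nz \<le> 2 * (B * ?F)"
    using bounds by linarith
  have "(?t * ?nz) * (nrm 0 v + (1 + (?t / \<epsilon>)\<^sup>2) * ?nz) \<le> (\<epsilon> * (B * ?F)) * (2 * (B * ?F))"
  proof (rule mult_mono[OF tz sum])
    show "0 \<le> \<epsilon> * (B * ?F)"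
      using n0 by (intro order_trans[OF _ tz]) simp
  qed (use n0 in simp)
  then have "K4 * ((?t * ?nz) * (nrm 0 v + (1 + (?t / \<epsilon>)\<^sup>2) * ?nz))
      \<le> K4 * ((\<epsilon> * (B * ?F)) * (2 * (B * ?F)))"
    using K4_nonneg by (rule mult_left_mono)
  then have energy: "\<bar>quad (A \<epsilon> \<theta>) (J \<theta> v z) - quad (S (\<theta> /\<^sub>R \<epsilon>)) (v + z)\<bar>
      \<le> 2 * K4 * B\<^sup>2 * \<epsilon> * ?F\<^sup>2"
    using J_energy[OF v z \<theta> \<epsilon>] by (simp add: power2_eq_square mult_ac)
  have "K5 * ((?t * ?nz) * ?F) \<le> K5 * ((\<epsilon> * (B * ?F)) * ?F)"
    using tz n0 K5_nonneg by (intro mult_left_mono mult_right_mono) auto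
  then have "\<bar>Re (d \<theta> (E \<theta> f) (J \<theta> v z)) - Re (d 0 f (v + z))\<bar> \<le> K5 * B * \<epsilon> * ?F\<^sup>2"
    using J_pairing[OF v z \<theta>, of f] by (simp add: power2_eq_square mult_ac)
  then have "\<bar>(2 * Re (d \<theta> (E \<theta> f) (J \<theta> v z)) - quad (A \<epsilon> \<theta>) (J \<theta> v z))
      - (2 * Re (d 0 f (v + z)) - quad (S (\<theta> /\<^sub>R \<epsilon>)) (v + z))\<bar>
    \<le> 2 * (K5 * B * \<epsilon> * ?F\<^sup>2) + 2 * K4 * B\<^sup>2 * \<epsilon> * ?F\<^sup>2"
    using energy by linarith
  then show ?thesis
    by (simp add: d0.form_norm_sq algebra_simps)
qed

text \<open>At its solution x the homogenised functional equals \<open>quad S x\<close>, so it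
  remains to bound the components of x. The full test bounds the norm of x, and the test with z
  alone exposes the coercive form on Z.\<close>

lemma transfer_from_homogenised:
  "\<exists>C\<ge>0. \<forall>\<epsilon> \<theta> f x. 0 < \<epsilon> \<and> \<theta> \<in> \<Theta> \<and> x \<in> V 0 \<and> (\<forall>y\<in>V 0. S (\<theta> /\<^sub>R \<epsilon>) x y = d 0 f y) \<longrightarrow>
     (\<exists>w\<in>H. quad (S (\<theta> /\<^sub>R \<epsilon>)) x - C * \<epsilon> * quad (d 0) f
        \<le> 2 * Re (d \<theta> (E \<theta> f) w) - quad (A \<epsilon> \<theta>) w)"
proof -
  \<comment> \<open>\<open>c\<kappa>\<close> bounds the components v and z themselves; 2 / c_Z
    bounds |\<xi>|^2 |z| by coercivity.\<close>
  define B where "B = c\<kappa> + 2 / c_Z"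
  have B: "B \<ge> 0" "c\<kappa> \<le> B"
    using c\<kappa> c_Z_pos by (auto simp: B_def)
  have "\<exists>w\<in>H. quad (S (\<theta> /\<^sub>R \<epsilon>)) x - (2 * K5 * B + 2 * K4 * B\<^sup>2) * \<epsilon> * quad (d 0) f
      \<le> 2 * Re (d \<theta> (E \<theta> f) w) - quad (A \<epsilon> \<theta>) w"
    if \<epsilon>: "0 < \<epsilon>" and \<theta>: "\<theta> \<in> \<Theta>" and x: "x \<in> V 0"
      and sol: "\<And>y. y \<in> V 0 \<Longrightarrow> S (\<theta> /\<^sub>R \<epsilon>) x y = d 0 f y" for \<epsilon> \<theta> f x
  proof -
    let ?F = "form_norm (d 0) f"
    let ?\<xi> = "\<theta> /\<^sub>R \<epsilon>"
    obtain v z where vz: "v \<in> Vs" "z \<in> Z" "x = v + z"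
      using V0_E[OF x] .
    have zV: "z \<in> V 0"
      using vz Z_subset by blast
    have H: "x \<in> H" "v \<in> H" "z \<in> H"
      using x vz V_H Vs_H Z_H by auto
    have pair: "Re (d 0 f y) \<le> ?F * nrm 0 y" if "y \<in> H" for y
    proof -
      have "Re (d 0 f y) \<le> ?F * form_norm (d 0) y"
        using d0.cauchy_schwarz[of f y] complex_Re_le_cmod[of "d 0 f y"] by simp
      also have "\<dots> \<le> ?F * nrm 0 y"
        using form_norm_d_le[OF zero_in that] by (intro mult_left_mono) auto
      finally show ?thesis .
    qed
    have Sx: "quad (S ?\<xi>) x = Re (d 0 f x)"
      using sol[OF x] by (simp add: quad_def)
    have "1 * (nrm 0 x)\<^sup>2 \<le> ?F * nrm 0 x"
      using quad_b0_le_S[OF x, of ?\<xi>] quad_b0_V0[OF x] Sx pair[OF H(1)] by simp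
    then have nx: "nrm 0 x \<le> ?F"
      using le_of_sq_le_mult[of 1 "nrm 0 x" ?F] H by simp
    have comp: "nrm 0 v \<le> c\<kappa> * ?F" "nrm 0 z \<le> c\<kappa> * ?F"
      using component_bounds[OF vz(1,2)] nx c\<kappa> vz(3)
      by (meson mult_left_mono order_trans zero_le_one)+
    \<comment> \<open>The test vector z = 0 + z has Z-component z.\<close>
    have "ah ?\<xi> z z + b 0 x z = d 0 f z"
      using sol[OF zV] S_form_eq[OF vz(1,2) _ vz(2), of 0 ?\<xi>] subspace_0[OF subspace_Vs] vz(3)
      by simp
    then have "Re (ah ?\<xi> z z) = Re (d 0 f z) - Re (b 0 x z)"
      by (metis add_diff_cancel_right' minus_complex.sel(1))
    moreover have "- Re (b 0 x z) \<le> nrm 0 x * nrm 0 z"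
    proof -
      have "form_norm (b 0) x * form_norm (b 0) z \<le> nrm 0 x * nrm 0 z"
        using form_norm_b_le zero_in H by (intro mult_mono) auto
      then show ?thesis
        using b0.cauchy_schwarz[OF H(1,3)] abs_Re_le_cmod[of "b 0 x z"] by linarith
    qed
    moreover have "nrm 0 x * nrm 0 z \<le> ?F * nrm 0 z"
      using nx H by (intro mult_right_mono) auto
    ultimately have "Re (ah ?\<xi> z z) \<le> 2 * ?F * nrm 0 z"
      using pair[OF H(3)] by linarith
    then have "c_Z * (norm ?\<xi>)\<^sup>2 * (nrm 0 z)\<^sup>2 \<le> 2 * ?F * nrm 0 z"
      using hom_form_coercive[OF vz(2), of ?\<xi>] by linarith
    then have "c_Z * ((norm ?\<xi>)\<^sup>2 * (nrm 0 z)) * nrm 0 z \<le> 2 * ?F * nrm 0 z"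
      by (simp add: power2_eq_square mult_ac)
    then have "(norm ?\<xi>)\<^sup>2 * nrm 0 z \<le> 2 * ?F / c_Z"
    proof (cases "nrm 0 z = 0")
      case False
      assume *: "c_Z * ((norm ?\<xi>)\<^sup>2 * (nrm 0 z)) * nrm 0 z \<le> 2 * ?F * nrm 0 z"
      have "nrm 0 z > 0"
        using False n0.form_norm_nonneg[OF H(3)] by linarith
      then have "c_Z * ((norm ?\<xi>)\<^sup>2 * (nrm 0 z)) \<le> 2 * ?F"
        using * by (simp only: mult_le_cancel_right_pos)
      then show ?thesis
        using c_Z_pos by (simp add: pos_le_divide_eq mult_ac)
    qed (use c_Z_pos in simp)
    moreover have "norm ?\<xi> = norm \<theta> / \<epsilon>"
      using \<epsilon> by (simp add: divide_inverse)
    ultimately have "(norm \<theta> / \<epsilon>)\<^sup>2 * nrm 0 z \<le> 2 * ?F / c_Z"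
      by (simp only:)
    then have "(1 + (norm \<theta> / \<epsilon>)\<^sup>2) * nrm 0 z \<le> B * ?F"
      using comp(2) by (simp add: B_def algebra_simps)
    moreover have "nrm 0 v \<le> B * ?F"
      using comp(1) B(2) by (meson mult_right_mono order_trans d0.form_norm_nonneg UNIV_I)
    ultimately have "\<bar>(2 * Re (d \<theta> (E \<theta> f) (J \<theta> v z)) - quad (A \<epsilon> \<theta>) (J \<theta> v z))
        - (2 * Re (d 0 f (v + z)) - quad (S ?\<xi>) (v + z))\<bar>
      \<le> (2 * K5 * B + 2 * K4 * B\<^sup>2) * \<epsilon> * quad (d 0) f"
      using transfer_error[OF vz(1,2) \<theta> \<epsilon>] by blast
    then show ?thesis
      using J_H[OF \<theta> vz(1,2)] Sx vz(3) by (intro bexI[of _ "J \<theta> v z"]) auto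
  qed
  then show ?thesis
    using B K4_nonneg K5_nonneg by (intro exI[of _ "2 * K5 * B + 2 * K4 * B\<^sup>2"]) simp
qed

text \<open>At \<open>\<theta> = 0\<close> the trivial splitting \<open>p = 0\<close> is used: there \<open>V\<^sub>0\<close> is larger than
  \<open>Vst 0 = Vs\<close>.\<close>

lemma splitting:
  assumes \<theta>: "\<theta> \<in> \<Theta>" and \<epsilon>: "0 < \<epsilon>" and u: "u \<in> H" and G: "0 \<le> G"
    and nu: "nrm \<theta> u \<le> 2 * G"
    and small: "\<And>y. y \<in> H \<Longrightarrow> cmod (a \<theta> u y) \<le> 2 * \<epsilon>\<^sup>2 * G * nrm \<theta> y"
  obtains p q where "p \<in> Vst \<theta>" "q \<in> H" "u = p + q"
    "(1 + (norm \<theta> / \<epsilon>)\<^sup>2) * nrm \<theta> q \<le> (2 + 2 / \<gamma>) * G"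
proof (cases "\<theta> = 0")
  case True
  have "0 \<le> 2 / \<gamma> * G"
    using \<gamma> G by simp
  then show ?thesis
    using that[of 0 u] True u nu subspace_0[OF subspace_Vs] by (simp add: Vstar_def algebra_simps)
next
  case False
  interpret a: sesq_form sc H "a \<theta>" using form_a \<theta> .
  interpret n: sesq_form sc H "ab a b \<theta>" using form_ab \<theta> .
  obtain p q where pq: "p \<in> V \<theta>" "q \<in> W \<theta>" "u = p + q"
    using V_W_decomposition[OF \<theta> u] .
  have H: "p \<in> H" "q \<in> H"
    using pq V_H W_H by auto
  have "ab a b \<theta> q p = 0"
    using pq by (simp add: Wsp_def)
  then have "ab a b \<theta> p q = 0"
    using n.hermitian[OF H(2,1)] by simp
  then have "quad (ab a b \<theta>) q \<le> quad (ab a b \<theta>) u"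
    using H n.quad_nonneg[OF H(1)] by (simp add: pq(3) n.quad_add)
  then have nq: "nrm \<theta> q \<le> 2 * G"
    using nu unfolding form_norm_def by (meson order_trans real_sqrt_le_mono)
  \<comment> \<open>p is null for a_\<theta>, so smallness of a_\<theta>(u, q) is smallness of the
    energy of q; against degeneracy this bounds |\<xi>|^2 |q|.\<close>
  have "a \<theta> u q = a \<theta> q q"
    using V_null(1)[OF \<theta> pq(1) H(2)] H by (simp add: pq(3) a.add_left)
  then have "quad (a \<theta>) q \<le> 2 * \<epsilon>\<^sup>2 * G * nrm \<theta> q"
    using small[OF H(2)] complex_Re_le_cmod[of "a \<theta> q q"] by (simp add: quad_def)
  then have "\<gamma> * (norm \<theta>)\<^sup>2 * (nrm \<theta> q)\<^sup>2 \<le> 2 * \<epsilon>\<^sup>2 * G * nrm \<theta> q"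
    using degeneracy[OF \<theta> pq(2)] by linarith
  moreover have "0 < \<gamma> * (norm \<theta>)\<^sup>2"
    using \<gamma> False by simp
  ultimately have "nrm \<theta> q \<le> 2 * \<epsilon>\<^sup>2 * G / (\<gamma> * (norm \<theta>)\<^sup>2)"
    using le_of_sq_le_mult G H by simp
  then have "(norm \<theta> / \<epsilon>)\<^sup>2 * nrm \<theta> q \<le> (norm \<theta> / \<epsilon>)\<^sup>2 * (2 * \<epsilon>\<^sup>2 * G / (\<gamma> * (norm \<theta>)\<^sup>2))"
    by (intro mult_left_mono) auto
  also have "\<dots> = 2 / \<gamma> * G"
    using \<epsilon> False \<gamma> by (simp add: power_divide field_simps)
  finally have "(1 + (norm \<theta> / \<epsilon>)\<^sup>2) * nrm \<theta> q \<le> (2 + 2 / \<gamma>) * G"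
    using nq by (simp add: algebra_simps)
  then show ?thesis
    using that[of p q] pq H False by (simp add: Vstar_def)
qed

text \<open>With G the d-norm of the right-hand side, the chain in
  \<open>solution_approximation\<close> is: C1 bounds q; C2 and C3 bound the W 0 part w and the
  residual r, with a factor \<epsilon>; \<open>C4 * \<epsilon>\<^sup>2 * G\<close> times the norm of
  r bounds a_\<theta>[r]; C5 bounds the scaled energy of r, and C6 the sizes of v and z asked for by
  \<open>transfer_error\<close>.\<close>

definition C1 :: real where "C1 = 2 + 2 / \<gamma>"
definition C2 :: real where "C2 = (2 * M + M\<^sup>2 * C1) / \<nu>"
definition C3 :: real where "C3 = M ^ 3 * c\<kappa> * C1 + C2 + K1 * c\<kappa> * M * C1"
definition C4 :: real where "C4 = 2 * M + (M + M * K1) * c\<kappa> * M * C1"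
definition C5 :: real where "C5 = C4 * C3 + M\<^sup>2 * C3\<^sup>2"
definition C6 :: real where "C6 = 2 + M * C3 + M * (1 + K1 * M) * c\<kappa> * M * C1 + c\<kappa> * M * C1"

lemma C_nonneg: "0 \<le> C1" "0 \<le> C2" "0 \<le> C3" "0 \<le> C4" "0 \<le> C5" "0 \<le> C6"
proof -
  show C1: "0 \<le> C1"
    using \<gamma> by (simp add: C1_def)
  then show C2: "0 \<le> C2"
    using M \<nu> by (simp add: C2_def)
  show C3: "0 \<le> C3"
    unfolding C3_def using M C1 C2 c\<kappa> K1_nonneg by (intro add_nonneg_nonneg mult_nonneg_nonneg) auto
  show C4: "0 \<le> C4"
    unfolding C4_def using M C1 c\<kappa> K1_nonneg by (intro add_nonneg_nonneg mult_nonneg_nonneg) auto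
  show "0 \<le> C5"
    unfolding C5_def using C3 C4 by simp
  show "0 \<le> C6"
    unfolding C6_def using M C1 C3 c\<kappa> K1_nonneg
    by (intro add_nonneg_nonneg mult_nonneg_nonneg) auto
qed

text \<open>The first bound tests the equation with its solution. The second is the equation
  multiplied by the square of \<epsilon>: a_\<theta>(u, y) is that square times d(g, y) - b(u,
  y).\<close>

lemma solution_bounds:
  assumes \<theta>: "\<theta> \<in> \<Theta>" and \<epsilon>: "0 < \<epsilon>" "\<epsilon> < 1" and u: "u \<in> H"
    and sol: "\<And>y. y \<in> H \<Longrightarrow> A \<epsilon> \<theta> u y = d \<theta> g y"
  shows "nrm \<theta> u \<le> 2 * form_norm (d \<theta>) g"
    "\<And>y. y \<in> H \<Longrightarrow> cmod (a \<theta> u y) \<le> 2 * \<epsilon>\<^sup>2 * form_norm (d \<theta>) g * nrm \<theta> y"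
proof -
  interpret a: sesq_form sc H "a \<theta>" using form_a \<theta> .
  interpret b: sesq_form sc H "b \<theta>" using form_b \<theta> .
  interpret d: sesq_form sc UNIV "d \<theta>" using form_d \<theta> .
  interpret A: sesq_form sc H "A \<epsilon> \<theta>" using form_A \<theta> .
  let ?G = "form_norm (d \<theta>) g"
  have G: "0 \<le> ?G"
    by simp
  have bA: "form_norm (b \<theta>) u \<le> form_norm (A \<epsilon> \<theta>) u"
    using a.quad_nonneg[OF u] by (simp add: form_norm_def quad_A)
  have "1 * (form_norm (A \<epsilon> \<theta>) u)\<^sup>2 = Re (d \<theta> g u)"
    using sol[OF u] u by (simp add: A.form_norm_sq quad_def)
  also have "\<dots> \<le> ?G * form_norm (d \<theta>) u"
    using d.cauchy_schwarz[of g u] complex_Re_le_cmod[of "d \<theta> g u"] by simp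
  also have "\<dots> \<le> ?G * form_norm (A \<epsilon> \<theta>) u"
    using d_le_b[OF \<theta> u] bA G by (intro mult_left_mono) (auto simp: form_norm_def intro: order_trans)
  finally have A: "form_norm (A \<epsilon> \<theta>) u \<le> ?G"
    using le_of_sq_le_mult[of 1 "form_norm (A \<epsilon> \<theta>) u" ?G] u by simp
  then show "nrm \<theta> u \<le> 2 * ?G"
    using A_lower[OF \<theta> \<epsilon> u] G by linarith
  fix y
  assume y: "y \<in> H"
  have "a \<theta> u y = complex_of_real (\<epsilon>\<^sup>2) * (d \<theta> g y - b \<theta> u y)"
    using sol[OF y] \<epsilon> by (simp add: A_def field_simps)
  then have "cmod (a \<theta> u y) \<le> \<epsilon>\<^sup>2 * (cmod (d \<theta> g y) + cmod (b \<theta> u y))"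
    using norm_triangle_ineq4[of "d \<theta> g y" "b \<theta> u y"] by (simp add: norm_mult norm_power mult_left_mono)
  also have "\<dots> \<le> \<epsilon>\<^sup>2 * (?G * nrm \<theta> y + ?G * nrm \<theta> y)"
  proof (intro mult_left_mono add_mono)
    show "cmod (d \<theta> g y) \<le> ?G * nrm \<theta> y"
      using d.cauchy_schwarz[of g y] form_norm_d_le[OF \<theta> y] G
      by (meson UNIV_I mult_left_mono order_trans)
    have "form_norm (b \<theta>) u * form_norm (b \<theta>) y \<le> ?G * nrm \<theta> y"
      using bA A form_norm_b_le[OF \<theta> y] G y u by (intro mult_mono) auto
    then show "cmod (b \<theta> u y) \<le> ?G * nrm \<theta> y"
      using b.cauchy_schwarz[OF u y] by linarith
  qed simp
  finally show "cmod (a \<theta> u y) \<le> 2 * \<epsilon>\<^sup>2 * ?G * nrm \<theta> y"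
    by (simp add: algebra_simps)
qed

text \<open>The splitting u = p + q is refined at the origin: q = vs + z + w with w in W 0. The
  component vs is replaced by a neighbour v2 in Vst \<theta>, so that p + v2 has a preimage v under
  E; w is small by the gap at the origin. What is left, r, consists of vs - v2, w and the
  corrector.\<close>

lemma solution_approximation:
  assumes \<theta>: "\<theta> \<in> \<Theta>" and \<epsilon>: "0 < \<epsilon>" "\<epsilon> < 1" and u: "u \<in> H"
    and sol: "\<And>y. y \<in> H \<Longrightarrow> A \<epsilon> \<theta> u y = d \<theta> g y"
  obtains v z where "v \<in> Vs" "z \<in> Z"
    "nrm 0 v \<le> C6 * form_norm (d \<theta>) g"
    "(1 + (norm \<theta> / \<epsilon>)\<^sup>2) * nrm 0 z \<le> C6 * form_norm (d \<theta>) g"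
    "quad (A \<epsilon> \<theta>) (u - J \<theta> v z) \<le> C5 * \<epsilon> * quad (d \<theta>) g"
proof -
  interpret a: sesq_form sc H "a \<theta>" using form_a \<theta> .
  interpret b: sesq_form sc H "b \<theta>" using form_b \<theta> .
  interpret n: sesq_form sc H "ab a b \<theta>" using form_ab \<theta> .
  interpret d: sesq_form sc UNIV "d \<theta>" using form_d \<theta> .
  let ?G = "form_norm (d \<theta>) g" and ?t = "norm \<theta>"
  have G: "0 \<le> ?G"
    by simp
  note C1 = C_nonneg(1)
  have M0: "0 \<le> M" "1 \<le> M"
    using M by auto
  have c\<kappa>0: "0 \<le> c\<kappa>"
    using c\<kappa> by simp
  have u_bound: "nrm \<theta> u \<le> 2 * ?G"
    using solution_bounds(1)[OF \<theta> \<epsilon> u] sol by blast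
  have small: "cmod (a \<theta> u y) \<le> 2 * \<epsilon>\<^sup>2 * ?G * nrm \<theta> y" if "y \<in> H" for y
    using solution_bounds(2)[OF \<theta> \<epsilon> u _ that] sol by blast
  obtain p q where pq: "p \<in> Vst \<theta>" "q \<in> H" "u = p + q"
    and q_bound: "(1 + (?t / \<epsilon>)\<^sup>2) * nrm \<theta> q \<le> C1 * ?G"
    using splitting[OF \<theta> \<epsilon>(1) u G u_bound small] unfolding C1_def by blast
  have pV: "p \<in> V \<theta>" "p \<in> H"
    using pq(1) Vst_subset_V V_H by blast+
  have nq: "0 \<le> nrm \<theta> q"
    using pq by simp
  have sq: "0 \<le> (?t / \<epsilon>)\<^sup>2 * nrm \<theta> q"
    using nq by simp
  then have q1: "nrm \<theta> q \<le> C1 * ?G" and q3: "(?t / \<epsilon>)\<^sup>2 * nrm \<theta> q \<le> C1 * ?G"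
    using q_bound nq unfolding distrib_right by linarith+
  have q2: "?t * nrm \<theta> q \<le> \<epsilon> * (C1 * ?G)"
  proof -
    have "?t / \<epsilon> * nrm \<theta> q \<le> (1 + (?t / \<epsilon>)\<^sup>2) * nrm \<theta> q"
      using nq le_one_plus_sq by (rule mult_right_mono[rotated])
    then have "?t / \<epsilon> * nrm \<theta> q \<le> C1 * ?G"
      using q_bound by linarith
    then show ?thesis
      using \<epsilon>(1) by (simp add: field_simps)
  qed
  have tt: "?t\<^sup>2 * nrm \<theta> q \<le> \<epsilon>\<^sup>2 * (C1 * ?G)"
    using q3 \<epsilon>(1) by (simp add: power_divide field_simps)
  obtain x w where xw: "x \<in> V 0" "w \<in> W 0" "q = x + w"
    using V_W_decomposition[OF zero_in pq(2)] .
  obtain vs z where vz: "vs \<in> Vs" "z \<in> Z" "x = vs + z"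
    using V0_E[OF xw(1)] .
  have zV: "z \<in> V 0"
    using vz Z_subset by blast
  have H: "x \<in> H" "w \<in> H" "vs \<in> H" "z \<in> H" "N \<theta> z \<in> H"
    using xw vz V_H W_H Vs_H Z_H corrector_H[OF zV] by auto
  have nqM: "nrm 0 q \<le> M * nrm \<theta> q"
    using nrm_ge \<theta> pq by blast
  have "ab a b 0 w x = 0"
    using xw by (simp add: Wsp_def)
  then have "ab a b 0 x w = 0"
    using n0.hermitian[OF H(2,1)] by simp
  then have "quad (ab a b 0) x \<le> quad (ab a b 0) q"
    using H n0.quad_nonneg[OF H(2)] by (simp add: xw(3) n0.quad_add)
  then have "nrm 0 x \<le> nrm 0 q"
    unfolding form_norm_def by (rule real_sqrt_le_mono)
  then have "nrm 0 x \<le> M * nrm \<theta> q"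
    using nqM by linarith
  then have "c\<kappa> * nrm 0 x \<le> c\<kappa> * (M * nrm \<theta> q)"
    using c\<kappa>0 by (rule mult_left_mono)
  then have comp: "nrm 0 vs \<le> c\<kappa> * M * nrm \<theta> q" "nrm 0 z \<le> c\<kappa> * M * nrm \<theta> q"
    using component_bounds[OF vz(1,2)] vz(3) by (auto simp: mult.assoc intro: order_trans)
  \<comment> \<open>a_0[w] = a_0(q, w), which differs from a_\<theta>(q, w) by a Lipschitz term with
    |\<theta>| |q| = O(\<epsilon>); and a_\<theta>(q, w) = a_\<theta>(u, w) is small by the
    equation.\<close>
  have nw: "nrm 0 w \<le> C2 * \<epsilon> * ?G"
  proof -
    have x0: "a 0 x w = 0"
      using V_null(1)[OF zero_in xw(1) H(2)] .
    have "a 0 q w = a 0 w w"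
      using H x0 by (simp add: xw(3) a0.add_left)
    then have "\<nu> * (nrm 0 w)\<^sup>2 \<le> cmod (a 0 q w)"
      using gap[OF xw(2)] complex_Re_le_cmod[of "a 0 w w"] by (simp add: quad_def)
    also have "\<dots> \<le> cmod (a \<theta> q w) + cmod (a \<theta> q w - a 0 q w)"
      by (metis norm_minus_commute norm_triangle_sub)
    also have "cmod (a \<theta> q w) = cmod (a \<theta> u w)"
      using V_null(1)[OF \<theta> pV(1) H(2)] pV pq H by (simp add: a.add_left)
    also have "cmod (a \<theta> u w) \<le> 2 * \<epsilon>\<^sup>2 * ?G * (M * nrm 0 w)"
      using small[OF H(2)] nrm_le[OF \<theta> H(2)] G by (meson mult_left_mono mult_nonneg_nonneg order_trans zero_le_numeral zero_le_power2)
    \<comment> \<open>One power of \<epsilon> is given away, since the Lipschitz term is only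
      O(\<epsilon>) anyway.\<close>
    also have "2 * \<epsilon>\<^sup>2 * ?G * (M * nrm 0 w) \<le> 2 * \<epsilon> * ?G * (M * nrm 0 w)"
      using \<epsilon> G M0 H by (intro mult_right_mono) (auto simp: power2_eq_square mult_left_le)
    also have "cmod (a \<theta> q w - a 0 q w) \<le> (M * ?t * nrm 0 q) * nrm 0 w"
      using a_lipschitz[OF \<theta> pq(2) H(2)] by simp
    also have "\<dots> \<le> (M\<^sup>2 * (\<epsilon> * (C1 * ?G))) * nrm 0 w"
    proof (rule mult_right_mono)
      have "M * ?t * nrm 0 q \<le> M * ?t * (M * nrm \<theta> q)"
        using nqM M0 by (intro mult_left_mono) auto
      also have "\<dots> = M\<^sup>2 * (?t * nrm \<theta> q)"
        by (simp add: power2_eq_square)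
      also have "\<dots> \<le> M\<^sup>2 * (\<epsilon> * (C1 * ?G))"
        using q2 by (intro mult_left_mono) auto
      finally show "M * ?t * nrm 0 q \<le> M\<^sup>2 * (\<epsilon> * (C1 * ?G))" .
    qed (use H in simp)
    finally have "\<nu> * (nrm 0 w)\<^sup>2 \<le> ((2 * M + M\<^sup>2 * C1) * \<epsilon> * ?G) * nrm 0 w"
      by (simp add: algebra_simps)
    moreover have "0 \<le> (2 * M + M\<^sup>2 * C1) * \<epsilon> * ?G"
      using M0 C1 \<epsilon> G by simp
    ultimately show ?thesis
      using le_of_sq_le_mult[OF \<nu>, of "nrm 0 w"] H by (simp add: C2_def)
  qed
  have "vs \<in> Vst 0"
    using vz by (simp add: Vstar_def)
  then obtain v2 where v2: "v2 \<in> Vst \<theta>" "nrm \<theta> (vs - v2) \<le> M * ?t * nrm 0 vs"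
    using Vstar_close[OF zero_in \<theta>] by fastforce
  have v2H: "v2 \<in> V \<theta>" "v2 \<in> H"
    using v2 Vst_subset_V V_H by blast+
  have "p + v2 \<in> E \<theta> ` Vs"
    using pq(1) v2(1) subspace_add[OF subspace_Vst[OF \<theta>]] E_Vs[OF \<theta>] by simp
  then obtain v where v: "v \<in> Vs" "E \<theta> v = p + v2"
    by fastforce
  define r where "r = u - J \<theta> v z"
  \<comment> \<open>p and z cancel between u = p + vs + z + w and the trial vector p + v2 + z + N
    z.\<close>
  have r_eq: "r = (vs - v2) + w - N \<theta> z"
    by (simp add: r_def J_def v(2) pq(3) xw(3) vz(3) algebra_simps)
  have rH: "r \<in> H"
    unfolding r_eq using H v2H by simp
  have d1: "nrm 0 (vs - v2) \<le> M ^ 3 * c\<kappa> * C1 * \<epsilon> * ?G"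
  proof -
    have "nrm 0 (vs - v2) \<le> M * nrm \<theta> (vs - v2)"
      using nrm_ge[OF \<theta>, of "vs - v2"] H v2H by simp
    also have "\<dots> \<le> M * (M * ?t * nrm 0 vs)"
      using v2 M0 by (intro mult_left_mono) auto
    also have "\<dots> \<le> M * (M * ?t * (c\<kappa> * M * nrm \<theta> q))"
      using comp M0 by (intro mult_left_mono) auto
    also have "\<dots> = M ^ 3 * c\<kappa> * (?t * nrm \<theta> q)"
      by (simp add: power3_eq_cube)
    also have "\<dots> \<le> M ^ 3 * c\<kappa> * (\<epsilon> * (C1 * ?G))"
      using q2 M0 c\<kappa>0 by (intro mult_left_mono) auto
    finally show ?thesis
      by (simp add: mult_ac)
  qed
  have d2: "nrm 0 (N \<theta> z) \<le> K1 * c\<kappa> * M * C1 * \<epsilon> * ?G"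
  proof -
    have "nrm 0 (N \<theta> z) \<le> K1 * ?t * nrm 0 z"
      using corrector_bound[OF zV, of \<theta>] by (simp add: K1_def)
    also have "\<dots> \<le> K1 * ?t * (c\<kappa> * M * nrm \<theta> q)"
      using comp K1_nonneg by (intro mult_left_mono) auto
    also have "\<dots> = K1 * c\<kappa> * M * (?t * nrm \<theta> q)"
      by simp
    also have "\<dots> \<le> K1 * c\<kappa> * M * (\<epsilon> * (C1 * ?G))"
      using q2 M0 c\<kappa>0 K1_nonneg by (intro mult_left_mono) auto
    finally show ?thesis
      by (simp add: mult_ac)
  qed
  have nr: "nrm 0 r \<le> C3 * \<epsilon> * ?G"
  proof -
    have "nrm 0 r \<le> nrm 0 (vs - v2) + nrm 0 w + nrm 0 (N \<theta> z)"
      unfolding r_eq using n0.form_norm_triangle_diff[of "vs - v2 + w" "N \<theta> z"]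
        n0.form_norm_triangle[of "vs - v2" w] H v2H by simp
    then show ?thesis
      using d1 d2 nw by (simp add: C3_def algebra_simps)
  qed
  have CG: "0 \<le> C3 * \<epsilon> * ?G"
    using C_nonneg(3) \<epsilon> G by simp
  \<comment> \<open>Squaring the norm bound of r would leave O(1) after division by the square of
    \<epsilon>. Instead r is paired with u and with z + N z; both pairings are O(\<epsilon>^2) times
    the norm of r, and E v is a null vector. This yields the third power of \<epsilon>.\<close>
  have ar: "quad (a \<theta>) r \<le> C4 * C3 * \<epsilon> ^ 3 * ?G\<^sup>2"
  proof -
    have "a \<theta> (E \<theta> v) r = 0"
      using V_null(1)[OF \<theta> E_Vs_V(1)[OF \<theta> v(1)] rH] .
    then have "a \<theta> r r = a \<theta> u r - a \<theta> (z + N \<theta> z) r"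
      using u H rH E_Vs_V(2)[OF \<theta> v(1)]
      by (subst (1) r_def) (simp add: J_def a.diff_left a.add_left)
    then have "cmod (a \<theta> r r) \<le> cmod (a \<theta> u r) + cmod (a \<theta> (z + N \<theta> z) r)"
      by (simp add: norm_triangle_ineq4)
    moreover have "cmod (a \<theta> u r) \<le> 2 * M * \<epsilon>\<^sup>2 * ?G * nrm 0 r"
    proof -
      have "2 * \<epsilon>\<^sup>2 * ?G * nrm \<theta> r \<le> 2 * \<epsilon>\<^sup>2 * ?G * (M * nrm 0 r)"
        using nrm_le[OF \<theta> rH] G by (intro mult_left_mono) auto
      then show ?thesis
        using small[OF rH] by (simp add: mult_ac)
    qed
    moreover have "cmod (a \<theta> (z + N \<theta> z) r) \<le> (M + M * K1) * (c\<kappa> * M * (\<epsilon>\<^sup>2 * (C1 * ?G))) * nrm 0 r"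
    proof -
      have "?t\<^sup>2 * nrm 0 z \<le> ?t\<^sup>2 * (c\<kappa> * M * nrm \<theta> q)"
        using comp by (intro mult_left_mono) auto
      also have "\<dots> = c\<kappa> * M * (?t\<^sup>2 * nrm \<theta> q)"
        by simp
      also have "\<dots> \<le> c\<kappa> * M * (\<epsilon>\<^sup>2 * (C1 * ?G))"
        using tt c\<kappa>0 M0 by (intro mult_left_mono) auto
      finally have "(M + M * K1) * (?t\<^sup>2 * nrm 0 z) * nrm 0 r
          \<le> (M + M * K1) * (c\<kappa> * M * (\<epsilon>\<^sup>2 * (C1 * ?G))) * nrm 0 r"
        using M0 K1_nonneg rH by (intro mult_right_mono mult_left_mono) auto
      then show ?thesis
        using corrected_residual[OF zV rH \<theta>] by (simp add: mult.assoc)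
    qed
    ultimately have "cmod (a \<theta> r r) \<le> (C4 * \<epsilon>\<^sup>2 * ?G) * nrm 0 r"
      by (simp add: C4_def algebra_simps)
    also have "\<dots> \<le> (C4 * \<epsilon>\<^sup>2 * ?G) * (C3 * \<epsilon> * ?G)"
      using nr C_nonneg(4) G by (intro mult_left_mono) auto
    finally have "cmod (a \<theta> r r) \<le> C4 * C3 * \<epsilon> ^ 3 * ?G\<^sup>2"
      by (simp add: power2_eq_square power3_eq_cube mult_ac)
    then show ?thesis
      using complex_Re_le_cmod[of "a \<theta> r r"] by (simp add: quad_def)
  qed
  have br: "quad (b \<theta>) r \<le> M\<^sup>2 * C3\<^sup>2 * \<epsilon> * ?G\<^sup>2"
  proof -
    have "form_norm (b \<theta>) r \<le> M * nrm 0 r"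
      using form_norm_b_le[OF \<theta> rH] nrm_le[OF \<theta> rH] by linarith
    also have "\<dots> \<le> M * (C3 * \<epsilon> * ?G)"
      using nr M0 by (intro mult_left_mono) auto
    finally have "(form_norm (b \<theta>) r)\<^sup>2 \<le> (M * (C3 * \<epsilon> * ?G))\<^sup>2"
      using rH by (intro power_mono) auto
    then have "quad (b \<theta>) r \<le> (M\<^sup>2 * C3\<^sup>2 * ?G\<^sup>2) * \<epsilon>\<^sup>2"
      using rH by (simp add: b.form_norm_sq power_mult_distrib mult_ac)
    also have "\<dots> \<le> (M\<^sup>2 * C3\<^sup>2 * ?G\<^sup>2) * \<epsilon>"
      using \<epsilon> by (intro mult_left_mono) (auto simp: power2_eq_square mult_left_le)
    finally show ?thesis
      by (simp add: mult_ac)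
  qed
  have "1 / \<epsilon>\<^sup>2 * quad (a \<theta>) r \<le> 1 / \<epsilon>\<^sup>2 * (C4 * C3 * \<epsilon> ^ 3 * ?G\<^sup>2)"
    using ar by (intro mult_left_mono) auto
  also have "\<dots> = C4 * C3 * \<epsilon> * ?G\<^sup>2"
    using \<epsilon> by (simp add: power2_eq_square power3_eq_cube)
  finally have Ar: "quad (A \<epsilon> \<theta>) r \<le> C5 * \<epsilon> * quad (d \<theta>) g"
    using br by (simp add: quad_A C5_def d.form_norm_sq algebra_simps)
  have "(1 + (?t / \<epsilon>)\<^sup>2) * nrm 0 z \<le> (1 + (?t / \<epsilon>)\<^sup>2) * (c\<kappa> * M * nrm \<theta> q)"
    using comp by (intro mult_left_mono) auto
  also have "\<dots> = c\<kappa> * M * ((1 + (?t / \<epsilon>)\<^sup>2) * nrm \<theta> q)"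
    by simp
  also have "\<dots> \<le> c\<kappa> * M * (C1 * ?G)"
    using q_bound c\<kappa>0 M0 by (intro mult_left_mono) auto
  finally have z_bound: "(1 + (?t / \<epsilon>)\<^sup>2) * nrm 0 z \<le> c\<kappa> * M * C1 * ?G"
    by (simp add: mult.assoc)
  have nz: "nrm 0 z \<le> c\<kappa> * M * C1 * ?G"
  proof -
    have "c\<kappa> * M * nrm \<theta> q \<le> c\<kappa> * M * (C1 * ?G)"
      using q1 c\<kappa>0 M0 by (intro mult_left_mono) auto
    then show ?thesis
      using comp(2) by (simp add: mult.assoc)
  qed
  \<comment> \<open>E preserves the norm on Vs, so the size of v is read off from E v = u - r - (z +
    N z).\<close>
  have v_bound: "nrm 0 v \<le> 2 * ?G + M * C3 * ?G + M * (1 + K1 * M) * c\<kappa> * M * C1 * ?G"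
  proof -
    let ?y = "z + N \<theta> z"
    have yH: "?y \<in> H"
      using H by simp
    have "E \<theta> v = u - r - ?y"
      by (simp add: r_def J_def)
    then have "nrm \<theta> (E \<theta> v) \<le> nrm \<theta> u + nrm \<theta> r + nrm \<theta> ?y"
      using n.form_norm_triangle_diff[of "u - r" ?y] n.form_norm_triangle_diff[of u r] u rH yH by simp
    moreover have "nrm \<theta> r \<le> M * C3 * ?G"
    proof -
      have "C3 * ?G * \<epsilon> \<le> C3 * ?G * 1"
        using \<epsilon> C_nonneg(3) G by (intro mult_left_mono) auto
      then have "nrm 0 r \<le> C3 * ?G"
        using nr by (simp add: mult_ac)
      then have "M * nrm 0 r \<le> M * (C3 * ?G)"
        using M0 by (intro mult_left_mono) auto
      then show ?thesis
        using nrm_le[OF \<theta> rH] by (simp add: mult.assoc)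
    qed
    moreover have "nrm \<theta> ?y \<le> M * (1 + K1 * M) * c\<kappa> * M * C1 * ?G"
    proof -
      have "nrm 0 ?y \<le> nrm 0 z + nrm 0 (N \<theta> z)"
        using n0.form_norm_triangle H by blast
      also have "nrm 0 (N \<theta> z) \<le> K1 * ?t * nrm 0 z"
        using corrector_bound[OF zV, of \<theta>] by (simp add: K1_def)
      also have "\<dots> \<le> K1 * M * nrm 0 z"
        using bounded[OF \<theta>] K1_nonneg H by (intro mult_right_mono mult_left_mono) auto
      finally have "nrm 0 ?y \<le> (1 + K1 * M) * nrm 0 z"
        by (simp add: algebra_simps)
      also have "\<dots> \<le> (1 + K1 * M) * (c\<kappa> * M * C1 * ?G)"
        using nz K1_nonneg M0 by (intro mult_left_mono) auto
      finally have "M * nrm 0 ?y \<le> M * ((1 + K1 * M) * (c\<kappa> * M * C1 * ?G))"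
        using M0 by (intro mult_left_mono) auto
      then show ?thesis
        using nrm_le[OF \<theta> yH] by (simp add: mult.assoc)
    qed
    ultimately show ?thesis
      using nrm_E[OF \<theta> v(1)] u_bound by linarith
  qed
  have "0 \<le> M * C3 * ?G" "0 \<le> M * (1 + K1 * M) * c\<kappa> * M * C1 * ?G" "0 \<le> c\<kappa> * M * C1 * ?G"
    using M0 C_nonneg C1 G K1_nonneg c\<kappa>0 by (auto intro!: mult_nonneg_nonneg add_nonneg_nonneg)
  then have "nrm 0 v \<le> C6 * ?G" "(1 + (?t / \<epsilon>)\<^sup>2) * nrm 0 z \<le> C6 * ?G"
    using v_bound z_bound G unfolding C6_def distrib_right by linarith+
  then show ?thesis
    using that[OF v(1) vz(2)] Ar unfolding r_def by blast
qed

text \<open>Since u solves the scaled problem, the energy of u - J is exactly the amount by which J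
  misses the maximum of the scaled functional. So J is optimal up to O(\<epsilon>), and
  \<open>transfer_error\<close> carries its value to v + z.\<close>

lemma transfer_to_homogenised:
  "\<exists>C\<ge>0. \<forall>\<epsilon> \<theta> f u. 0 < \<epsilon> \<and> \<epsilon> < 1 \<and> \<theta> \<in> \<Theta> \<and> u \<in> H \<and> (\<forall>y\<in>H. A \<epsilon> \<theta> u y = d \<theta> (E \<theta> f) y) \<longrightarrow>
     (\<exists>x\<in>V 0. quad (A \<epsilon> \<theta>) u - C * \<epsilon> * quad (d 0) f
        \<le> 2 * Re (d 0 f x) - quad (S (\<theta> /\<^sub>R \<epsilon>)) x)"
proof -
  define C where "C = 2 * K5 * C6 + 2 * K4 * C6\<^sup>2 + C5"
  have "\<exists>x\<in>V 0. quad (A \<epsilon> \<theta>) u - C * \<epsilon> * quad (d 0) f \<le> 2 * Re (d 0 f x) - quad (S (\<theta> /\<^sub>R \<epsilon>)) x"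
    if \<epsilon>: "0 < \<epsilon>" "\<epsilon> < 1" and \<theta>: "\<theta> \<in> \<Theta>" and u: "u \<in> H"
      and sol: "\<And>y. y \<in> H \<Longrightarrow> A \<epsilon> \<theta> u y = d \<theta> (E \<theta> f) y" for \<epsilon> \<theta> f u
  proof -
    interpret A: sesq_form sc H "A \<epsilon> \<theta>" using form_A \<theta> .
    obtain v z where vz: "v \<in> Vs" "z \<in> Z" "nrm 0 v \<le> C6 * form_norm (d \<theta>) (E \<theta> f)"
      "(1 + (norm \<theta> / \<epsilon>)\<^sup>2) * nrm 0 z \<le> C6 * form_norm (d \<theta>) (E \<theta> f)"
      "quad (A \<epsilon> \<theta>) (u - J \<theta> v z) \<le> C5 * \<epsilon> * quad (d \<theta>) (E \<theta> f)"
      using solution_approximation[OF \<theta> \<epsilon> u sol] .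
    have dE: "quad (d \<theta>) (E \<theta> f) = quad (d 0) f"
      by (simp add: quad_def E_unitary[OF \<theta>])
    have JH: "J \<theta> v z \<in> H"
      using J_H[OF \<theta> vz(1,2)] .
    have "quad (A \<epsilon> \<theta>) (u - J \<theta> v z)
        = quad (A \<epsilon> \<theta>) u + quad (A \<epsilon> \<theta>) (J \<theta> v z) - 2 * Re (d \<theta> (E \<theta> f) (J \<theta> v z))"
      using A.quad_diff[OF u JH] sol[OF JH] by simp
    then have "quad (A \<epsilon> \<theta>) u - C5 * \<epsilon> * quad (d 0) f
        \<le> 2 * Re (d \<theta> (E \<theta> f) (J \<theta> v z)) - quad (A \<epsilon> \<theta>) (J \<theta> v z)"
      using vz(5) dE by simp
    moreover have "\<bar>(2 * Re (d \<theta> (E \<theta> f) (J \<theta> v z)) - quad (A \<epsilon> \<theta>) (J \<theta> v z))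
        - (2 * Re (d 0 f (v + z)) - quad (S (\<theta> /\<^sub>R \<epsilon>)) (v + z))\<bar>
      \<le> (2 * K5 * C6 + 2 * K4 * C6\<^sup>2) * \<epsilon> * quad (d 0) f"
      using vz(3,4) form_norm_E[OF \<theta>] by (intro transfer_error[OF vz(1,2) \<theta> \<epsilon>(1)]) auto
    ultimately have "quad (A \<epsilon> \<theta>) u - C * \<epsilon> * quad (d 0) f
        \<le> 2 * Re (d 0 f (v + z)) - quad (S (\<theta> /\<^sub>R \<epsilon>)) (v + z)"
      unfolding C_def distrib_right by linarith
    then show ?thesis
      using V0_I[OF vz(1,2)] by blast
  qed
  moreover have "C \<ge> 0"
    unfolding C_def using K4_nonneg K5_nonneg C_nonneg by simp
  ultimately show ?thesis
    by blast
qed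

section \<open>The two problems as compact eigenvalue problems\<close>

lemma eigen_problem_A:
  assumes "\<theta> \<in> \<Theta>" "0 < \<epsilon>" "\<epsilon> < 1"
  shows "eigen_problem sc H (A \<epsilon> \<theta>) (d \<theta>)"
proof -
  interpret A: sesq_form sc H "A \<epsilon> \<theta>" using form_A assms(1) .
  interpret d: sesq_form sc UNIV "d \<theta>" using form_d assms(1) .
  show ?thesis
  proof
    show "form_complete H (A \<epsilon> \<theta>)"
      using A_lower[OF assms] A_upper[OF assms] assms
      by (intro form_complete_equivalent[OF complete_ab[OF assms(1)], of sc _ 1 "1 / \<epsilon>"])
         (auto simp: A.sesq_form_axioms)
    show "quad (d \<theta>) u \<le> quad (A \<epsilon> \<theta>) u" if "u \<in> H" for u
    proof -
      have "0 \<le> 1 / \<epsilon>\<^sup>2 * quad (a \<theta>) u"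
        using sesq_form.quad_nonneg[OF form_a[OF assms(1)] that] by simp
      then show ?thesis
        using d_le_b[OF assms(1) that] by (simp add: quad_A)
    qed
    show "\<exists>r::nat \<Rightarrow> nat. strict_mono r \<and> form_Cauchy (d \<theta>) (x \<circ> r)"
      if x: "\<And>n. x n \<in> H" "\<And>n. quad (A \<epsilon> \<theta>) (x n) \<le> 1" for x
    proof (rule compact_d[OF assms(1) x(1)])
      fix n
      have "form_norm (A \<epsilon> \<theta>) (x n) \<le> 1"
        using x(2)[of n] real_sqrt_le_mono unfolding form_norm_def by fastforce
      then have "M * nrm \<theta> (x n) \<le> M * 1"
        using A_lower[OF assms x(1)[of n]] M by (intro mult_left_mono) auto
      then show "nrm 0 (x n) \<le> M"
        using nrm_ge[OF assms(1) x(1)[of n]] by simp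
    qed
  qed (use definite_d assms in auto)
qed

lemma eigen_problem_S: "eigen_problem sc (V 0) (S \<xi>) (d 0)"
proof -
  interpret S: sesq_form sc "V 0" "S \<xi>" by (rule form_S)
  have low: "nrm 0 x \<le> form_norm (S \<xi>) x" if "x \<in> V 0" for x
    using quad_b0_le_S[OF that, of \<xi>] nrm_V[OF zero_in that] by (simp add: form_norm_def)
  obtain C where C: "C > 0" "\<forall>x\<in>V 0. form_norm (S \<xi>) x \<le> C * nrm 0 x"
    using S_bounded by blast
  show ?thesis
  proof
    show "form_complete (V 0) (S \<xi>)"
      using low C
      by (intro form_complete_equivalent[OF complete_V[OF zero_in], of sc _ 1 C])
         (auto simp: S.sesq_form_axioms)
    show "quad (d 0) x \<le> quad (S \<xi>) x" if "x \<in> V 0" for x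
      using d_le_b[OF zero_in V_H[OF that]] quad_b0_le_S[OF that, of \<xi>] by linarith
    show "\<exists>r::nat \<Rightarrow> nat. strict_mono r \<and> form_Cauchy (d 0) (x \<circ> r)"
      if x: "\<And>n. x n \<in> V 0" "\<And>n. quad (S \<xi>) (x n) \<le> 1" for x
    proof (rule compact_d[OF zero_in V_H[OF x(1)]])
      fix n
      have "form_norm (S \<xi>) (x n) \<le> 1"
        using x(2)[of n] real_sqrt_le_mono unfolding form_norm_def by fastforce
      then show "nrm 0 (x n) \<le> M"
        using low[OF x(1)[of n]] M by simp
    qed
  qed (use definite_d zero_in in auto)
qed

text \<open>The graph also demands \<open>sc \<mu> u\<close> in X, which D \<subseteq> X
  supplies.\<close>

lemma eigenspace_form_operator:
  assumes "D \<subseteq> X" "subspace D" "sesq_form sc UNIV g" "eigen_problem sc D t g"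
  shows "eigenspace sc (form_operator X g D t) \<mu> = {u. eigen_problem.eig D t g \<mu> u}"
proof -
  interpret g: sesq_form sc UNIV g by fact
  show ?thesis
    using assms subspace_scale[OF assms(2)]
    by (auto simp: eigenspace_def form_operator_def eigen_problem.eig_def[OF assms(4)] g.scale_left)
qed

text \<open>Keeping the index set I abstract treats both dimension cases at once: either k and all
  smaller indices are listed for the homogenised problem, or its list ends before k.\<close>

lemma eigenvalue_estimates:
  assumes L: "\<And>\<epsilon> \<theta>. 0 < \<epsilon> \<Longrightarrow> \<epsilon> < 1 \<Longrightarrow> \<theta> \<in> \<Theta> \<Longrightarrow>
      lists_eigenvalues sc (L_operator sc H a b d \<epsilon> \<theta>) {1..} (lam \<epsilon> \<theta>)"
    and hom: "\<And>\<xi>. lists_eigenvalues sc (form_operator X (d 0) (V 0) (S \<xi>)) I (lam_hom \<xi>)"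
    and X: "V 0 \<subseteq> X" and I: "I \<subseteq> {1..}"
  shows "\<exists>C>0. \<forall>\<epsilon> \<theta> k. 0 < \<epsilon> \<and> \<epsilon> < 1 \<and> \<theta> \<in> \<Theta> \<and> 1 \<le> k \<longrightarrow>
    ({1..k} \<subseteq> I \<longrightarrow> \<bar>1 / lam \<epsilon> \<theta> k - 1 / lam_hom (\<theta> /\<^sub>R \<epsilon>) k\<bar> \<le> C * \<epsilon>) \<and>
    (I \<subseteq> {1..<k} \<longrightarrow> \<bar>1 / lam \<epsilon> \<theta> k\<bar> \<le> C * \<epsilon>)"
proof -
  obtain CA where CA: "CA \<ge> 0" "\<And>\<epsilon> \<theta> f x. 0 < \<epsilon> \<Longrightarrow> \<theta> \<in> \<Theta> \<Longrightarrow> x \<in> V 0 \<Longrightarrow>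
      (\<And>y. y \<in> V 0 \<Longrightarrow> S (\<theta> /\<^sub>R \<epsilon>) x y = d 0 f y) \<Longrightarrow>
      \<exists>w\<in>H. quad (S (\<theta> /\<^sub>R \<epsilon>)) x - CA * \<epsilon> * quad (d 0) f
        \<le> 2 * Re (d \<theta> (E \<theta> f) w) - quad (A \<epsilon> \<theta>) w"
    using transfer_from_homogenised by blast
  obtain CB where CB: "CB \<ge> 0" "\<And>\<epsilon> \<theta> f u. 0 < \<epsilon> \<Longrightarrow> \<epsilon> < 1 \<Longrightarrow> \<theta> \<in> \<Theta> \<Longrightarrow> u \<in> H \<Longrightarrow>
      (\<And>y. y \<in> H \<Longrightarrow> A \<epsilon> \<theta> u y = d \<theta> (E \<theta> f) y) \<Longrightarrow>
      \<exists>x\<in>V 0. quad (A \<epsilon> \<theta>) u - CB * \<epsilon> * quad (d 0) f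
        \<le> 2 * Re (d 0 f x) - quad (S (\<theta> /\<^sub>R \<epsilon>)) x"
    using transfer_to_homogenised by blast
  \<comment> \<open>The summand 1 makes C strictly positive.\<close>
  define C where "C = CA + CB + 1"
  have estimate: "({1..k} \<subseteq> I \<longrightarrow> \<bar>1 / lam \<epsilon> \<theta> k - 1 / lam_hom (\<theta> /\<^sub>R \<epsilon>) k\<bar> \<le> C * \<epsilon>) \<and>
      (I \<subseteq> {1..<k} \<longrightarrow> \<bar>1 / lam \<epsilon> \<theta> k\<bar> \<le> C * \<epsilon>)"
    if \<epsilon>: "0 < \<epsilon>" "\<epsilon> < 1" and \<theta>: "\<theta> \<in> \<Theta>" and k: "1 \<le> k" for \<epsilon> \<theta> k
  proof -
    let ?\<xi> = "\<theta> /\<^sub>R \<epsilon>"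
    note pA = eigen_problem_A[OF \<theta> \<epsilon>] and pS = eigen_problem_S[of ?\<xi>]
    have L_eq: "L_operator sc H a b d \<epsilon> \<theta> = form_operator UNIV (d \<theta>) H (A \<epsilon> \<theta>)"
      by (simp add: L_operator_def A_def[abs_def])
    have eigA: "eigenspace sc (L_operator sc H a b d \<epsilon> \<theta>) \<mu>
        = {u. eigen_problem.eig H (A \<epsilon> \<theta>) (d \<theta>) \<mu> u}" for \<mu>
      unfolding L_eq using eigenspace_form_operator[OF subset_UNIV subspace_H form_d[OF \<theta>] pA] .
    have eigS: "eigenspace sc (form_operator X (d 0) (V 0) (S ?\<xi>)) \<mu>
        = {u. eigen_problem.eig (V 0) (S ?\<xi>) (d 0) \<mu> u}" for \<mu>
      using eigenspace_form_operator[OF X subspace_V[OF zero_in] form_d[OF zero_in] pS] .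
    \<comment> \<open>The comparison starting from the scaled problem is transported by the inverse
      of E, which is an isometry by surjectivity.\<close>
    have E_inv: "E \<theta> (inv (E \<theta>) u) = u" for u
      using E_surj[OF \<theta>] by (simp add: surj_f_inv_f)
    have inv_unitary: "d 0 (inv (E \<theta>) u) (inv (E \<theta>) w) = d \<theta> u w" for u w
      using E_unitary[OF \<theta>, of "inv (E \<theta>) u" "inv (E \<theta>) w"] by (simp add: E_inv)
    have to_L: "\<exists>w\<in>H. quad (S ?\<xi>) x - CA * \<epsilon> * quad (d 0) f
          \<le> 2 * Re (d \<theta> (E \<theta> f) w) - quad (A \<epsilon> \<theta>) w"
      if "x \<in> V 0" "\<And>y. y \<in> V 0 \<Longrightarrow> S ?\<xi> x y = d 0 f y" for f x
      using CA(2)[OF \<epsilon>(1) \<theta> that] .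
    have to_hom: "\<exists>x\<in>V 0. quad (A \<epsilon> \<theta>) u - CB * \<epsilon> * quad (d \<theta>) g
          \<le> 2 * Re (d 0 (inv (E \<theta>) g) x) - quad (S ?\<xi>) x"
      if u: "u \<in> H" "\<And>y. y \<in> H \<Longrightarrow> A \<epsilon> \<theta> u y = d \<theta> g y" for g u
    proof -
      have "quad (d 0) (inv (E \<theta>) g) = quad (d \<theta>) g"
        by (simp add: quad_def inv_unitary)
      then show ?thesis
        using CB(2)[OF \<epsilon> \<theta> u(1), of "inv (E \<theta>) g"] u(2) by (simp add: E_inv)
    qed
    have sub: "{1..k} \<subseteq> {1..}"
      by auto
    have CA_C: "CA * \<epsilon> \<le> C * \<epsilon>" and CB_C: "CB * \<epsilon> \<le> C * \<epsilon>"
      using CA(1) CB(1) \<epsilon>(1) by (auto simp: C_def intro: mult_right_mono)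
    have "0 < lam \<epsilon> \<theta> k"
      using eigen_problem.listed_eigenvalue_pos[OF pA L[OF \<epsilon> \<theta>] eigA] k by simp
    show ?thesis
    proof (intro conjI impI)
      assume kI: "{1..k} \<subseteq> I"
      then have "k \<in> I"
        using k by auto
      have "1 / lam \<epsilon> \<theta> k - 1 / lam_hom ?\<xi> k \<le> CB * \<epsilon>"
        by (rule eigenvalue_comparison(1)[where U = "inv (E \<theta>)",
              OF pA pS inv_unitary _ L[OF \<epsilon> \<theta>] eigA hom eigS k sub I \<open>k \<in> I\<close>])
          (rule to_hom)
      moreover have "1 / lam_hom ?\<xi> k - 1 / lam \<epsilon> \<theta> k \<le> CA * \<epsilon>"
        by (rule eigenvalue_comparison(1)[where U = "E \<theta>",
              OF pS pA E_unitary[OF \<theta>] _ hom eigS L[OF \<epsilon> \<theta>] eigA k kI subset_refl])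
          (use k in \<open>auto intro: to_L\<close>)
      ultimately show "\<bar>1 / lam \<epsilon> \<theta> k - 1 / lam_hom ?\<xi> k\<bar> \<le> C * \<epsilon>"
        using CA_C CB_C by linarith
    next
      assume "I \<subseteq> {1..<k}"
      then have "1 / lam \<epsilon> \<theta> k \<le> CB * \<epsilon>"
        by (intro eigenvalue_comparison(2)[where U = "inv (E \<theta>)",
              OF pA pS inv_unitary _ L[OF \<epsilon> \<theta>] eigA hom eigS k sub I]) (rule to_hom)
      then show "\<bar>1 / lam \<epsilon> \<theta> k\<bar> \<le> C * \<epsilon>"
        using CB_C \<open>0 < lam \<epsilon> \<theta> k\<close> by simp
    qed
  qed
  have "C > 0"
    using CA(1) CB(1) by (simp add: C_def)
  with estimate show ?thesis
    by blast
qed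

end

section \<open>From the stated conditions to the locale assumptions\<close>

lemma sesq_formI: "vector_space sc \<Longrightarrow> module.subspace sc S \<Longrightarrow> nonneg_form sc S g \<Longrightarrow> sesq_form sc S g"
  by (simp add: sesq_form_def sesq_form_axioms_def)

lemma Metric_space_form_dist:
  assumes "vector_space sc" "module.subspace sc S" "inner_product_on sc S g"
  shows "Metric_space S (form_dist S g)"
proof -
  interpret g: sesq_form sc S g
    using assms by (intro sesq_formI) (auto simp: inner_product_on_def)
  show ?thesis
  proof
    show "0 \<le> form_dist S g x y" for x y
      by (simp add: form_dist_def)
    show "form_dist S g x y = form_dist S g y x" for x y
      using g.form_norm_minus_commute by (auto simp: form_dist_def)
    show "form_dist S g x y = 0 \<longleftrightarrow> x = y" if "x \<in> S" "y \<in> S" for x y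
    proof -
      have xy: "x - y \<in> S"
        using that by simp
      have "form_norm g (x - y) = 0 \<Longrightarrow> g (x - y) (x - y) = 0"
        using g.diag[OF xy] g.form_norm_sq[OF xy] by simp
      then have "form_norm g (x - y) = 0 \<Longrightarrow> x - y = 0"
        using assms(3) xy by (auto simp: inner_product_on_def)
      then show ?thesis
        using that by (auto simp: form_dist_def)
    qed
    show "form_dist S g x z \<le> form_dist S g x y + form_dist S g y z"
      if "x \<in> S" "y \<in> S" "z \<in> S" for x y z
      using g.form_norm_triangle[of "x - y" "y - z"] that by (simp add: form_dist_def)
  qed
qed

lemma form_complete_of_hilbert_space:
  assumes "vector_space sc" "separable_hilbert_space sc S g"
  shows "form_complete S g"
  unfolding form_complete_def
proof (intro allI impI)
  interpret m: Metric_space S "form_dist S g"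
    using assms by (intro Metric_space_form_dist) (auto simp: separable_hilbert_space_def)
  fix x
  assume x: "(\<forall>n. x n \<in> S) \<and> form_Cauchy g x"
  have "m.MCauchy x"
    unfolding m.MCauchy_def
  proof (intro conjI allI impI)
    fix e :: real
    assume "e > 0"
    then obtain N where "\<forall>m\<ge>N. \<forall>n\<ge>N. form_norm g (x m - x n) < e"
      using x unfolding form_Cauchy_def by meson
    then show "\<exists>N. \<forall>n n'. N \<le> n \<longrightarrow> N \<le> n' \<longrightarrow> form_dist S g (x n) (x n') < e"
      using x by (intro exI[of _ N]) (simp add: form_dist_def)
  qed (use x in auto)
  then obtain l where "limitin m.mtopology x l sequentially"
    using assms(2) by (auto simp: separable_hilbert_space_def m.mcomplete_def)
  then have l: "l \<in> S" "(\<lambda>n. form_dist S g (x n) l) \<longlonglongrightarrow> 0"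
    by (auto simp: m.limitin_metric_dist_null)
  moreover have "form_dist S g (x n) l = form_norm g (x n - l)" for n
    using x l(1) by (simp add: form_dist_def)
  ultimately show "\<exists>l\<in>S. (\<lambda>n. form_norm g (x n - l)) \<longlonglongrightarrow> 0"
    by auto
qed

lemma (in sesq_form) convergent_imp_form_Cauchy:
  assumes "\<And>n. x n \<in> S" "l \<in> S" "(\<lambda>n. form_norm g (x n - l)) \<longlonglongrightarrow> 0"
  shows "form_Cauchy g x"
  unfolding form_Cauchy_def
proof (intro allI impI)
  fix e :: real
  assume "e > 0"
  then have "\<forall>\<^sub>F n in sequentially. form_norm g (x n - l) < e / 2"
    using order_tendstoD(2)[OF assms(3), of "e / 2"] by simp
  then obtain N where N: "\<And>n. n \<ge> N \<Longrightarrow> form_norm g (x n - l) < e / 2"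
    by (auto simp: eventually_sequentially)
  have "form_norm g (x m - x n) < e" if "m \<ge> N" "n \<ge> N" for m n
    using form_norm_triangle[of "x m - l" "l - x n"] N[OF that(1)] N[OF that(2)] assms(1,2)
      form_norm_minus_commute[of l "x n"] by simp
  then show "\<exists>N. \<forall>m\<ge>N. \<forall>n\<ge>N. form_norm g (x m - x n) < e"
    by blast
qed

text \<open>The sequence is scaled by 1/R into the unit ball, where the compact closure gives a
  subsequence converging in the ambient norm; scaling back and the bound of g by that norm preserve
  the Cauchy property.\<close>

lemma compact_embedding_subsequence:
  assumes sc: "vector_space sc" and H: "sesq_form sc H h"
    and ip: "inner_product_on sc UNIV ip" and g: "sesq_form sc UNIV g"
    and compact: "compactin (form_topology UNIV ip)
       (form_topology UNIV ip closure_of {u \<in> H. form_norm h u \<le> 1})"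
    and C: "C > 0" "\<And>u. form_norm g u \<le> C * form_norm ip u"
    and x: "\<And>n. x n \<in> H" "\<And>n. form_norm h (x n) \<le> R" and R: "R > 0"
  obtains r :: "nat \<Rightarrow> nat" where "strict_mono r" "form_Cauchy g (x \<circ> r)"
proof -
  interpret vector_space sc by fact
  interpret h: sesq_form sc H h by fact
  interpret g: sesq_form sc UNIV g by fact
  have ip_form: "sesq_form sc UNIV ip"
    using sc ip by (intro sesq_formI) (auto simp: inner_product_on_def)
  interpret ip: sesq_form sc UNIV ip by (rule ip_form)
  interpret m: Metric_space UNIV "form_dist UNIV ip"
    using sc ip by (intro Metric_space_form_dist) auto
  define y where "y n = sc (complex_of_real (1 / R)) (x n)" for n
  let ?B = "{u \<in> H. form_norm h u \<le> 1}"
  have "y n \<in> ?B" for n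
    using x[of n] R by (simp add: y_def h.form_norm_scale norm_divide)
  moreover have "?B \<subseteq> form_topology UNIV ip closure_of ?B"
    by (rule closure_of_subset) (simp add: form_topology_def)
  ultimately have "range y \<subseteq> form_topology UNIV ip closure_of ?B"
    by blast
  then obtain l r where r: "strict_mono r" "limitin m.mtopology (y \<circ> r) l sequentially"
    using compact unfolding form_topology_def m.compactin_sequentially by meson
  then have "(\<lambda>n. form_norm ip ((y \<circ> r) n - l)) \<longlonglongrightarrow> 0"
    by (simp add: m.limitin_metric_dist_null form_dist_def)
  then have cauchy: "form_Cauchy ip (y \<circ> r)"
    by (rule ip.convergent_imp_form_Cauchy[rotated 2]) auto
  have "form_Cauchy g (x \<circ> r)"
  proof (rule form_Cauchy_dominated[OF cauchy])
    show "form_norm g ((x \<circ> r) m - (x \<circ> r) n) \<le> (R * C) * form_norm ip ((y \<circ> r) m - (y \<circ> r) n)" for m n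
    proof -
      have x_eq: "x k = sc (complex_of_real R) (y k)" for k
        using R by (simp add: y_def flip: of_real_mult)
      have "form_norm g (x (r m) - x (r n)) = R * form_norm g (y (r m) - y (r n))"
        unfolding x_eq using R g.form_norm_scale[of "y (r m) - y (r n)" "complex_of_real R"]
        by (simp add: scale_right_diff_distrib)
      also have "\<dots> \<le> R * (C * form_norm ip (y (r m) - y (r n)))"
        using C(2) R by (intro mult_left_mono) auto
      finally show ?thesis
        by (simp add: mult.assoc)
    qed
  qed (use R C in simp)
  then show ?thesis
    using that r(1) by blast
qed

text \<open>The removable singularity condition bounds an infimum; a slightly larger constant buys
  an actual vector.\<close>

lemma cINF_almost_attained:
  fixes f :: "'b \<Rightarrow> real"
  assumes "A \<noteq> {}" "(INF x\<in>A. f x) < c"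
  shows "\<exists>x\<in>A. f x \<le> c"
  using cInf_lessD[of "f ` A" c] assms by (auto intro: less_imp_le)

theorem theorem6p4:
  fixes sc :: "complex \<Rightarrow> 'a::ab_group_add \<Rightarrow> 'a"
    and ip ipH :: "'a form" and H Vs Z :: "'a set"
    and \<Theta> :: "(real^'n) set"
    and a b d :: "real^'n \<Rightarrow> 'a form"
    and a' :: "'a \<Rightarrow> 'a \<Rightarrow> complex^'n" and a'' :: "'a \<Rightarrow> 'a \<Rightarrow> complex^'n^'n"
    and E :: "real^'n \<Rightarrow> 'a \<Rightarrow> 'a"
    and lam :: "real \<Rightarrow> real^'n \<Rightarrow> nat \<Rightarrow> real" and lam_hom :: "real^'n \<Rightarrow> nat \<Rightarrow> real"
  assumes "vector_space sc"
    and "standing_assumptions sc H ipH \<Theta> a b"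
    and "ambient_space sc ip H ipH \<Theta> b d"
    and "spectral_gap H \<Theta> a b"
    and "removable_singularity sc H ipH \<Theta> a b Vs"
    and "admissible_complement sc H ipH a b Vs Z"
    and "quadratic_degeneracy H \<Theta> a b"
    and "a_regularity sc H \<Theta> a b a' a''"
    and "b_regularity H \<Theta> a b"
    and "unitary_transfer sc H \<Theta> a b d Vs Z E"
    and "\<And>\<epsilon> \<theta>. 0 < \<epsilon> \<Longrightarrow> \<epsilon> < 1 \<Longrightarrow> \<theta> \<in> \<Theta> \<Longrightarrow>
           lists_eigenvalues sc (L_operator sc H a b d \<epsilon> \<theta>) {1..} (lam \<epsilon> \<theta>)"
    and "\<And>\<xi>. lists_eigenvalues sc (hom_operator ip H a b d a' a'' Vs Z \<xi>)
           (eigenvalue_indices sc (direct_sum Vs Z)) (lam_hom \<xi>)"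
  shows "\<exists>C>0.
      (\<not> finite_dim sc (direct_sum Vs Z) \<longrightarrow>
        (\<forall>\<epsilon> \<theta> k. 0 < \<epsilon> \<and> \<epsilon> < 1 \<and> \<theta> \<in> \<Theta> \<and> k \<ge> 1 \<longrightarrow>
           \<bar>1 / lam \<epsilon> \<theta> k - 1 / lam_hom (\<theta> /\<^sub>R \<epsilon>) k\<bar> \<le> C * \<epsilon>)) \<and>
      (finite_dim sc (direct_sum Vs Z) \<longrightarrow>
        (\<forall>\<epsilon> \<theta>. 0 < \<epsilon> \<and> \<epsilon> < 1 \<and> \<theta> \<in> \<Theta> \<longrightarrow>
           (\<forall>k. 1 \<le> k \<and> k \<le> vector_space.dim sc (direct_sum Vs Z) \<longrightarrow>
              \<bar>1 / lam \<epsilon> \<theta> k - 1 / lam_hom (\<theta> /\<^sub>R \<epsilon>) k\<bar> \<le> C * \<epsilon>) \<and>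
           (\<forall>p \<ge> vector_space.dim sc (direct_sum Vs Z) + 1. \<bar>1 / lam \<epsilon> \<theta> p\<bar> \<le> C * \<epsilon>)))"
proof -
  note standing = assms(2)[unfolded standing_assumptions_def]
    and ambient = assms(3)[unfolded ambient_space_def]
    and transfer = assms(10)[unfolded unitary_transfer_def]
  interpret vector_space sc by fact
  let ?n = "\<lambda>\<theta>. form_norm (ab a b \<theta>)"
  have zero_int: "0 \<in> interior \<Theta>"
    using standing by blast
  then have zero: "0 \<in> \<Theta>"
    using interior_subset by blast
  have hilbert: "separable_hilbert_space sc H ipH"
    using standing by blast
  have subH: "subspace H"
    using hilbert by (simp add: separable_hilbert_space_def)
  have ip_ab: "inner_product_on sc H (ab a b \<theta>)" if "\<theta> \<in> \<Theta>" for \<theta>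
    using standing that by blast
  have nonneg_a: "nonneg_form sc H (a \<theta>)" and nonneg_b: "nonneg_form sc H (b \<theta>)" if "\<theta> \<in> \<Theta>" for \<theta>
    using standing that by blast+
  have form_ab: "sesq_form sc H (ab a b \<theta>)" if "\<theta> \<in> \<Theta>" for \<theta>
    using assms(1) subH ip_ab[OF that] by (intro sesq_formI) (auto simp: inner_product_on_def)
  have norm0: "0 \<le> ?n \<theta> u" if "\<theta> \<in> \<Theta>" "u \<in> H" for \<theta> u
    using sesq_form.form_norm_nonneg[OF form_ab] that .
  obtain \<rho> where \<rho>: "\<rho> > 0" "\<And>\<theta>. norm \<theta> \<le> \<rho> \<Longrightarrow> \<theta> \<in> \<Theta>"
  proof -
    obtain e where "e > 0" "cball 0 e \<subseteq> \<Theta>"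
      using zero_int mem_interior_cball by blast
    then show ?thesis
      using that[of e] by (auto simp: subset_iff)
  qed
  obtain R where R: "R > 0" "\<And>\<theta>. \<theta> \<in> \<Theta> \<Longrightarrow> norm \<theta> \<le> R"
    using compact_imp_bounded[OF standing[THEN conjunct2, THEN conjunct1]] bounded_pos[of \<Theta>] by blast
  obtain K where K: "K > 0" "\<And>u \<theta>1 \<theta>2. u \<in> H \<Longrightarrow> \<theta>1 \<in> \<Theta> \<Longrightarrow> \<theta>2 \<in> \<Theta> \<Longrightarrow> ?n \<theta>1 u \<le> K * ?n \<theta>2 u"
    using standing[THEN conjunct2, THEN conjunct2, THEN conjunct2, THEN conjunct2, THEN conjunct2, THEN conjunct1] by blast
  obtain La where La: "La > 0" "\<And>u v \<theta>1 \<theta>2. u \<in> H \<Longrightarrow> v \<in> H \<Longrightarrow> \<theta>1 \<in> \<Theta> \<Longrightarrow> \<theta>2 \<in> \<Theta> \<Longrightarrow>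
      cmod (a \<theta>1 u v - a \<theta>2 u v) \<le> La * norm (\<theta>1 - \<theta>2) * ?n \<theta>1 u * ?n \<theta>1 v"
    using standing[THEN conjunct2, THEN conjunct2, THEN conjunct2, THEN conjunct2, THEN conjunct2, THEN conjunct2] by blast
  obtain \<nu> where \<nu>: "\<nu> > 0" "\<And>w. w \<in> Wsp H a b 0 \<Longrightarrow> \<nu> * (?n 0 w)\<^sup>2 \<le> quad (a 0) w"
    using assms(4) zero unfolding spectral_gap_def by blast
  obtain Ls where Ls: "Ls \<ge> 0" "\<And>\<theta>1 \<theta>2 v. \<theta>1 \<in> \<Theta> \<Longrightarrow> \<theta>2 \<in> \<Theta> \<Longrightarrow> v \<in> Vstar H a Vs \<theta>1 \<Longrightarrow>
      (INF w\<in>Vstar H a Vs \<theta>2. ?n \<theta>2 (v - w)) \<le> Ls * norm (\<theta>1 - \<theta>2) * ?n \<theta>1 v"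
    using assms(5)[unfolded removable_singularity_def, THEN conjunct2] by blast
  have sub_Vs: "subspace Vs"
    using assms(5) by (simp add: removable_singularity_def closed_subspace_def)
  obtain \<kappa> where \<kappa>: "\<kappa> \<ge> 0" "\<kappa> < 1" "\<And>v z. v \<in> Vs \<Longrightarrow> z \<in> Z \<Longrightarrow>
      cmod (ab a b 0 v z) \<le> \<kappa> * ?n 0 v * ?n 0 z"
    using assms(6)[unfolded admissible_complement_def, THEN conjunct2, THEN conjunct2, THEN conjunct2] by blast
  have sub_Z: "subspace Z" and V0: "Vsp H a 0 = direct_sum Vs Z" "Vs \<inter> Z = {0}"
    using assms(6) by (simp_all add: admissible_complement_def closed_subspace_def)
  obtain \<gamma> where \<gamma>: "\<gamma> > 0" "\<And>\<theta> w. \<theta> \<in> \<Theta> \<Longrightarrow> w \<in> Wsp H a b \<theta> \<Longrightarrow>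
      \<gamma> * (norm \<theta>)\<^sup>2 * (?n \<theta> w)\<^sup>2 \<le> quad (a \<theta>) w"
    using assms(7) unfolding quadratic_degeneracy_def by blast
  obtain K' where K': "K' \<ge> 0" "\<And>v u \<theta>. v \<in> Vsp H a 0 \<Longrightarrow> u \<in> H \<Longrightarrow> \<theta> \<in> \<Theta> \<Longrightarrow>
      cmod (a \<theta> v u - cdot (a' v u) \<theta>) \<le> K' * (norm \<theta>)\<^sup>2 * ?n 0 v * ?n 0 u"
    using assms(8)[unfolded a_regularity_def, THEN conjunct2, THEN conjunct2, THEN conjunct1] by blast
  obtain K'' where K'': "K'' \<ge> 0" "\<And>v u \<theta>. v \<in> Vsp H a 0 \<Longrightarrow> u \<in> Vsp H a 0 \<Longrightarrow> \<theta> \<in> \<Theta> \<Longrightarrow>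
      cmod (a \<theta> v u - cquad (a'' v u) \<theta>) \<le> K'' * norm \<theta> ^ 3 * ?n 0 v * ?n 0 u"
    using assms(8)[unfolded a_regularity_def, THEN conjunct2, THEN conjunct2, THEN conjunct2] by blast
  have sesq: "\<forall>i. sesquilinear_on sc (Vsp H a 0) H (\<lambda>v u. a' v u $ i)"
    "\<forall>i j. sesquilinear_on sc (Vsp H a 0) (Vsp H a 0) (\<lambda>v u. a'' v u $ i $ j)"
    using assms(8) unfolding a_regularity_def by blast+
  obtain Lb where Lb: "Lb \<ge> 0" "\<And>v u \<theta>. v \<in> Vsp H a 0 \<Longrightarrow> u \<in> Vsp H a 0 \<Longrightarrow> \<theta> \<in> \<Theta> \<Longrightarrow>
      cmod (b \<theta> v u - b 0 v u) \<le> Lb * norm \<theta> * ?n 0 v * ?n \<theta> u"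
    using assms(9) unfolding b_regularity_def by blast
  obtain Kb where Kb: "Kb \<ge> 0" "\<And>\<theta> v z. \<theta> \<in> \<Theta> \<Longrightarrow> v \<in> Vs \<Longrightarrow> z \<in> Z \<Longrightarrow>
      cmod (b \<theta> (E \<theta> v) z - b 0 v z) \<le> Kb * norm \<theta> * ?n 0 v * ?n 0 z"
    using transfer[THEN conjunct2, THEN conjunct1] by blast
  obtain Ke where Ke: "Ke \<ge> 0" "\<And>\<theta>1 \<theta>2 u. \<theta>1 \<in> \<Theta> \<Longrightarrow> \<theta>2 \<in> \<Theta> \<Longrightarrow>
      form_norm (d \<theta>1) (E \<theta>1 u - E \<theta>2 u) \<le> Ke * norm (\<theta>1 - \<theta>2) * form_norm (d 0) u"
    using transfer[THEN conjunct2, THEN conjunct2, THEN conjunct2, THEN conjunct2] by blast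
  have compact_ball: "compactin (form_topology UNIV ip)
      (form_topology UNIV ip closure_of {u \<in> H. form_norm ipH u \<le> 1})"
    using ambient by blast
  have E0: "E 0 = id"
    using transfer by blast
  have ip_d: "inner_product_on sc UNIV (d \<theta>)" and equiv_d: "equivalent_on UNIV (d \<theta>) ip"
    if "\<theta> \<in> \<Theta>" for \<theta>
    using ambient that by blast+
  have form_d: "sesq_form sc UNIV (d \<theta>)" if "\<theta> \<in> \<Theta>" for \<theta>
    using assms(1) ip_d[OF that] by (intro sesq_formI) (auto simp: inner_product_on_def)
  have definite: "u = 0" if "inner_product_on sc T g" "u \<in> T" "quad g u = 0" for T g u
  proof -
    have "g u u \<in> \<real>\<^sub>\<ge>\<^sub>0"
      using that by (simp add: inner_product_on_def nonneg_form_def)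
    then have "g u u = 0"
      using that(3) by (simp add: quad_def complex_nonneg_Reals_iff complex_eq_iff)
    then show ?thesis
      using that by (simp add: inner_product_on_def)
  qed
  obtain c C where cC: "c > 0" "C > 0" "\<And>u. u \<in> H \<Longrightarrow> c * form_norm ipH u \<le> ?n 0 u \<and> ?n 0 u \<le> C * form_norm ipH u"
    using standing zero unfolding equivalent_on_def by meson
  have ipH: "sesq_form sc H ipH"
    using assms(1) hilbert by (intro sesq_formI) (auto simp: separable_hilbert_space_def inner_product_on_def)
  \<comment> \<open>Ls + 1 pays for replacing the infimum by a vector, and Lb * K for measuring the
    second argument of b-regularity in the norm at 0.\<close>
  define M where "M = 1 + K + La + (Ls + 1) + K' + K'' + Lb * K + Kb + Ke + R"
  have LbK: "0 \<le> Lb * K"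
    using Lb(1) K(1) by simp
  have M: "1 \<le> M" "K \<le> M" "La \<le> M" "Ls + 1 \<le> M" "K' \<le> M" "K'' \<le> M" "Lb * K \<le> M" "Kb \<le> M"
    "Ke \<le> M" "R \<le> M"
    unfolding M_def using K(1) La(1) Ls(1) K'(1) K''(1) Kb(1) Ke(1) R(1) LbK by linarith+
  have weaken: "x \<le> M * y" if "x \<le> k * y" "k \<le> M" "0 \<le> y" for x y k :: real
    using that by (meson mult_right_mono order_trans)
  have V_H: "u \<in> H" if "u \<in> Vsp H a \<theta>" for u \<theta>
    using that by (simp add: Vsp_def)
  have Vs_V0: "Vs \<subseteq> Vsp H a 0" and Z_V0: "Z \<subseteq> Vsp H a 0"
    using V0(1) subspace_0[OF sub_Vs] subspace_0[OF sub_Z] by (force simp: direct_sum_def)+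
  have Vst_H: "v \<in> H" if "v \<in> Vstar H a Vs \<theta>" for v \<theta>
    using that Vs_V0 V_H by (auto simp: Vstar_def split: if_splits)
  have Vst_0: "0 \<in> Vstar H a Vs \<theta>" if "\<theta> \<in> \<Theta>" for \<theta>
    using subspace_0[OF sub_Vs] subspace_0[OF subH]
      sesq_form.zero_left[OF sesq_formI[OF assms(1) subH nonneg_a[OF that]]]
    by (auto simp: Vstar_def Vsp_def)
  interpret T: transfer_family sc H Vs Z \<Theta> a b a' a'' M \<nu> \<gamma> \<kappa> \<rho> d E
  proof
    show "form_complete H (ab a b \<theta>)" if \<theta>: "\<theta> \<in> \<Theta>" for \<theta>
    proof -
      obtain c' C' where "c' > 0" "C' > 0"
        "\<forall>u\<in>H. c' * form_norm ipH u \<le> ?n \<theta> u \<and> ?n \<theta> u \<le> C' * form_norm ipH u"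
        using standing \<theta> unfolding equivalent_on_def by meson
      then show ?thesis
        by (intro form_complete_equivalent[OF form_complete_of_hilbert_space[OF assms(1) hilbert]
              form_ab[OF \<theta>], of "1 / c'" C']) (simp_all add: pos_le_divide_eq mult.commute)
    qed
    show "norm \<theta> \<le> M" if "\<theta> \<in> \<Theta>" for \<theta>
      using R(2)[OF that] M by linarith
    show "?n \<theta>1 u \<le> M * ?n \<theta>2 u" if "\<theta>1 \<in> \<Theta>" "\<theta>2 \<in> \<Theta>" "u \<in> H" for \<theta>1 \<theta>2 u
      using weaken[OF K(2) M(2) norm0] that by blast
    show "cmod (a \<theta> u v - a 0 u v) \<le> M * norm \<theta> * ?n 0 u * ?n 0 v"
      if "\<theta> \<in> \<Theta>" "u \<in> H" "v \<in> H" for \<theta> u v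
    proof -
      have "cmod (a \<theta> u v - a 0 u v) \<le> La * (norm \<theta> * ?n 0 u * ?n 0 v)"
        using La(2)[OF that(2,3) zero that(1)] by (simp add: norm_minus_commute mult.assoc)
      from weaken[OF this M(3)] show ?thesis
        using norm0[OF zero] that by (simp add: mult.assoc)
    qed
    show "\<exists>w\<in>Vstar H a Vs \<theta>2. ?n \<theta>2 (v - w) \<le> M * norm (\<theta>1 - \<theta>2) * ?n \<theta>1 v"
      if \<theta>: "\<theta>1 \<in> \<Theta>" "\<theta>2 \<in> \<Theta>" and v: "v \<in> Vstar H a Vs \<theta>1" for \<theta>1 \<theta>2 v
    \<comment> \<open>A vanishing right-hand side leaves no slack for almost attaining the infimum,
      so w is chosen exactly: w = v if \<theta>1 = \<theta>2, and otherwise v = 0 by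
      definiteness.\<close>
    proof (cases "norm (\<theta>1 - \<theta>2) * ?n \<theta>1 v = 0")
      case True
      have vH: "v \<in> H"
        using Vst_H[OF v] .
      have "\<exists>w\<in>Vstar H a Vs \<theta>2. v = w"
      proof (cases "\<theta>1 = \<theta>2")
        case False
        then have "?n \<theta>1 v = 0"
          using True by simp
        then have "quad (ab a b \<theta>1) v = 0"
          using sesq_form.form_norm_sq[OF form_ab[OF \<theta>(1)] vH] by simp
        then show ?thesis
          using definite[OF ip_ab[OF \<theta>(1)] vH] Vst_0[OF \<theta>(2)] by simp
      qed (use v in blast)
      then obtain w where "w \<in> Vstar H a Vs \<theta>2" "v - w = 0"
        by auto
      then show ?thesis
        using True by (intro bexI[of _ w]) (auto simp: form_norm_def quad_def
            sesq_form.zero_left[OF form_ab[OF \<theta>(2)] subspace_0[OF subH]] mult.assoc)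
    next
      case False
      have vH: "v \<in> H"
        using Vst_H[OF v] .
      have P: "norm (\<theta>1 - \<theta>2) * ?n \<theta>1 v > 0"
        using False norm0[OF \<theta>(1) vH] by (simp add: less_le)
      have "(INF w\<in>Vstar H a Vs \<theta>2. ?n \<theta>2 (v - w)) \<le> Ls * (norm (\<theta>1 - \<theta>2) * ?n \<theta>1 v)"
        using Ls(2)[OF \<theta> v] by (simp add: mult.assoc)
      also have "\<dots> < (Ls + 1) * (norm (\<theta>1 - \<theta>2) * ?n \<theta>1 v)"
        using P by (simp add: algebra_simps)
      finally have "\<exists>w\<in>Vstar H a Vs \<theta>2. ?n \<theta>2 (v - w) \<le> (Ls + 1) * (norm (\<theta>1 - \<theta>2) * ?n \<theta>1 v)"
      proof (intro cINF_almost_attained)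
        show "Vstar H a Vs \<theta>2 \<noteq> {}"
          using Vst_0[OF \<theta>(2)] by blast
      qed
      then obtain w where w: "w \<in> Vstar H a Vs \<theta>2"
        "?n \<theta>2 (v - w) \<le> (Ls + 1) * (norm (\<theta>1 - \<theta>2) * ?n \<theta>1 v)"
        by blast
      from weaken[OF w(2) M(4)] P w(1) show ?thesis
        by (auto simp: mult.assoc)
    qed
    show "cmod (a \<theta> v u - cdot (a' v u) \<theta>) \<le> M * (norm \<theta>)\<^sup>2 * ?n 0 v * ?n 0 u"
      if "v \<in> Vsp H a 0" "u \<in> H" "\<theta> \<in> \<Theta>" for v u \<theta>
      using weaken[OF _ M(5), of _ "(norm \<theta>)\<^sup>2 * ?n 0 v * ?n 0 u"] K'(2)[OF that]
        norm0[OF zero] that V_H by (simp add: mult.assoc)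
    show "cmod (a \<theta> v u - cquad (a'' v u) \<theta>) \<le> M * norm \<theta> ^ 3 * ?n 0 v * ?n 0 u"
      if "v \<in> Vsp H a 0" "u \<in> Vsp H a 0" "\<theta> \<in> \<Theta>" for v u \<theta>
      using weaken[OF _ M(6), of _ "norm \<theta> ^ 3 * ?n 0 v * ?n 0 u"] K''(2)[OF that]
        norm0[OF zero] that V_H by (simp add: mult.assoc)
    show "u = 0" if "\<theta> \<in> \<Theta>" "u \<in> H" "quad (ab a b \<theta>) u = 0" for \<theta> u
      using definite[OF ip_ab] that by blast
    show "u = 0" if "\<theta> \<in> \<Theta>" "quad (d \<theta>) u = 0" for \<theta> u
      using definite[OF ip_d, of \<theta> u] that by simp
    show "nonneg_form sc UNIV (d \<theta>)" if "\<theta> \<in> \<Theta>" for \<theta>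
      using ip_d[OF that] by (simp add: inner_product_on_def)
    show "quad (d \<theta>) u \<le> quad (b \<theta>) u" if "\<theta> \<in> \<Theta>" "u \<in> H" for \<theta> u
      using ambient that by blast
    show "\<exists>r::nat \<Rightarrow> nat. strict_mono r \<and> form_Cauchy (d \<theta>) (x \<circ> r)"
      if \<theta>: "\<theta> \<in> \<Theta>" and x: "\<And>n. x n \<in> H" "\<And>n. ?n 0 (x n) \<le> M" for \<theta> x
    proof -
      obtain C' where C': "C' > 0" "\<And>u. form_norm (d \<theta>) u \<le> C' * form_norm ip u"
        using equiv_d[OF \<theta>] unfolding equivalent_on_def by (metis UNIV_I)
      have ip: "inner_product_on sc UNIV ip"
        using ambient by (simp add: separable_hilbert_space_def)
      have bound: "form_norm ipH (x n) \<le> M / c" for n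
      proof -
        have "c * form_norm ipH (x n) \<le> M"
          using cC(3)[OF x(1)[of n]] x(2)[of n] by linarith
        then show ?thesis
          using cC(1) by (simp add: pos_le_divide_eq mult.commute)
      qed
      have "M / c > 0"
        using M(1) cC(1) by simp
      obtain r :: "nat \<Rightarrow> nat" where "strict_mono r" "form_Cauchy (d \<theta>) (x \<circ> r)"
        by (rule compact_embedding_subsequence[OF assms(1) ipH ip form_d[OF \<theta>] compact_ball C' x(1) bound
              \<open>M / c > 0\<close>])
      then show ?thesis
        by blast
    qed
    show "cmod (b \<theta> v w - b 0 v w) \<le> M * norm \<theta> * ?n 0 v * ?n 0 w"
      if "\<theta> \<in> \<Theta>" "v \<in> Vsp H a 0" "w \<in> Vsp H a 0" for \<theta> v w
    proof -
      have n: "0 \<le> ?n 0 v" "0 \<le> ?n 0 w"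
        using norm0[OF zero] that V_H by blast+
      have "cmod (b \<theta> v w - b 0 v w) \<le> Lb * norm \<theta> * ?n 0 v * ?n \<theta> w"
        using Lb(2) that by blast
      also have "\<dots> \<le> Lb * norm \<theta> * ?n 0 v * (K * ?n 0 w)"
        using K(2)[OF V_H[OF that(3)] that(1) zero] Lb(1) n by (intro mult_left_mono) auto
      also have "\<dots> = (Lb * K) * (norm \<theta> * ?n 0 v * ?n 0 w)"
        by simp
      finally show ?thesis
        using weaken[OF _ M(7), of _ "norm \<theta> * ?n 0 v * ?n 0 w"] n by (simp add: mult.assoc)
    qed
    show "E \<theta> ` Vs = Vstar H a Vs \<theta>" if "\<theta> \<in> \<Theta>" for \<theta>
      using transfer that by (simp add: bij_betw_def)
    show "b \<theta> (E \<theta> v) (E \<theta> w) = b 0 v w" if "\<theta> \<in> \<Theta>" "v \<in> Vs" "w \<in> Vs" for \<theta> v w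
      using transfer that by blast
    show "cmod (b \<theta> (E \<theta> v) z - b 0 v z) \<le> M * norm \<theta> * ?n 0 v * ?n 0 z"
      if "\<theta> \<in> \<Theta>" "v \<in> Vs" "z \<in> Z" for \<theta> v z
    proof -
      have "0 \<le> ?n 0 v" "0 \<le> ?n 0 z"
        using norm0[OF zero] that V_H Vs_V0 Z_V0 by blast+
      then show ?thesis
        using weaken[OF _ M(8), of _ "norm \<theta> * ?n 0 v * ?n 0 z"] Kb(2)[OF that]
        by (simp add: mult.assoc)
    qed
    show "d \<theta> (E \<theta> u) (E \<theta> w) = d 0 u w" if "\<theta> \<in> \<Theta>" for \<theta> u w
      using transfer that by blast
    show "surj (E \<theta>)" if "\<theta> \<in> \<Theta>" for \<theta>
      using transfer that bij_is_surj by blast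
    show "form_norm (d \<theta>) (E \<theta> u - u) \<le> M * norm \<theta> * form_norm (d 0) u" if "\<theta> \<in> \<Theta>" for \<theta> u
      using weaken[OF _ M(9), of _ "norm \<theta> * form_norm (d 0) u"] Ke(2)[OF that zero, of u]
        sesq_form.form_norm_nonneg[OF form_d[OF zero], of u] by (simp add: E0 mult.assoc)
  qed (use M(1) \<rho> \<nu> \<gamma> \<kappa> subH nonneg_a nonneg_b sub_Vs sub_Z V0 sesq in auto)
  let ?V = "direct_sum Vs Z"
  let ?X = "form_topology UNIV ip closure_of ?V"
  let ?I = "eigenvalue_indices sc ?V"
  have "Metric_space UNIV (form_dist UNIV ip)"
    using assms(1) ambient by (intro Metric_space_form_dist) (auto simp: separable_hilbert_space_def)
  then have V_X: "?V \<subseteq> ?X"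
    by (intro closure_of_subset) (simp add: form_topology_def Metric_space.topspace_mtopology)
  \<comment> \<open>V_0 is the direct sum of Vs and Z, so the form domain of the homogenised
    operator is the V 0 of the locale.\<close>
  have hom: "lists_eigenvalues sc (form_operator ?X (d 0) (Vsp H a 0) (T.S \<xi>)) ?I (lam_hom \<xi>)" for \<xi>
    using assms(12)[of \<xi>] unfolding hom_operator_def V0(1) .
  have I1: "?I \<subseteq> {1..}"
    by (auto simp: eigenvalue_indices_def)
  obtain C where C: "C > 0" "\<And>\<epsilon> \<theta> k. 0 < \<epsilon> \<Longrightarrow> \<epsilon> < 1 \<Longrightarrow> \<theta> \<in> \<Theta> \<Longrightarrow> 1 \<le> k \<Longrightarrow>
      ({1..k} \<subseteq> ?I \<longrightarrow> \<bar>1 / lam \<epsilon> \<theta> k - 1 / lam_hom (\<theta> /\<^sub>R \<epsilon>) k\<bar> \<le> C * \<epsilon>) \<and>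
      (?I \<subseteq> {1..<k} \<longrightarrow> \<bar>1 / lam \<epsilon> \<theta> k\<bar> \<le> C * \<epsilon>)"
    using T.eigenvalue_estimates[OF assms(11) hom _ I1] V_X V0(1) by auto
  show ?thesis
  proof (intro exI[of _ C] conjI impI allI)
    fix \<epsilon> :: real and \<theta> and k :: nat
    assume "\<not> finite_dim sc ?V" and *: "0 < \<epsilon> \<and> \<epsilon> < 1 \<and> \<theta> \<in> \<Theta> \<and> 1 \<le> k"
    then have "{1..k} \<subseteq> ?I"
      by (auto simp: eigenvalue_indices_def)
    then show "\<bar>1 / lam \<epsilon> \<theta> k - 1 / lam_hom (\<theta> /\<^sub>R \<epsilon>) k\<bar> \<le> C * \<epsilon>"
      using C(2)[of \<epsilon> \<theta> k] * by blast
  next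
    fix \<epsilon> :: real and \<theta> and k :: nat
    assume "finite_dim sc ?V" and *: "0 < \<epsilon> \<and> \<epsilon> < 1 \<and> \<theta> \<in> \<Theta>" "1 \<le> k \<and> k \<le> dim ?V"
    then have "{1..k} \<subseteq> ?I"
      by (auto simp: eigenvalue_indices_def)
    then show "\<bar>1 / lam \<epsilon> \<theta> k - 1 / lam_hom (\<theta> /\<^sub>R \<epsilon>) k\<bar> \<le> C * \<epsilon>"
      using C(2)[of \<epsilon> \<theta> k] * by blast
  next
    fix \<epsilon> :: real and \<theta> and p :: nat
    assume "finite_dim sc ?V" and *: "0 < \<epsilon> \<and> \<epsilon> < 1 \<and> \<theta> \<in> \<Theta>" "dim ?V + 1 \<le> p"
    \<comment> \<open>The list of the homogenised problem ends at the dimension, so every larger p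
      lies beyond it.\<close>
    then have "?I \<subseteq> {1..<p}" "1 \<le> p"
      by (auto simp: eigenvalue_indices_def)
    then show "\<bar>1 / lam \<epsilon> \<theta> p\<bar> \<le> C * \<epsilon>"
      using C(2)[of \<epsilon> \<theta> p] * by blast
  qed (fact C(1))
qed

end
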